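(* Let $L/K$ and $M/K$ be field extensions with $L/K$ finite and separable, and let $\phi\colon L\otimes_K M\to F_1\times F_2\times\dots\times F_n$ be an isomorphism with $n>0$ and each $F_i$ a field, so that each $F_i$ is viewed as an extension of both $L$ and $M$. Let $|\cdot|_L$ and $|\cdot|_M$ be absolute values on $L$ and $M$ which extend the same absolute value $|\cdot|_K$ on $K$. Let $\mathcal{V}_i$ be the set of all absolute values on $F_i$ extending both $|\cdot|_L$ and $|\cdot|_M$, and for $\nu\in\mathcal{V}_i$ let $\widehat{F_{i,\nu}}$ be the completion of $F_i$ with respect to $\nu$. Then: (1) there is a canonical bijection between the disjoint union $\coprod_{i=1}^n \mathcal{V}_i$ and the set of equivalence classes of all $\widehat{K}$-algebra embeddings $\widehat{L}\to\widehat{M}^a$ up to composition with elements of $\operatorname{Aut}_{\widehat M}(\widehat{M}^a)$; (2) $\sum_{i=1}^n \sum_{\nu\in\mathcal{V}_i} [\widehat{F_{i,\nu}} : \widehat{M}] = [\widehat{L} : \widehat{K}]$.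
   Context: $\widehat{K},\widehat{L},\widehat{M}$ denote the completions of $K,L,M$ with respect to $|\cdot|_K,|\cdot|_L,|\cdot|_M$, and $\widehat{M}^a$ is an algebraic closure of $\widehat{M}$. By the universal property of completions, the inclusions $K\to L$, $K\to M$ induce unique absolute-value-preserving $K$-algebra embeddings $\widehat K\to\widehat L$ and $\widehat K\to\widehat M$; likewise $\widehat M\to\widehat{F_{i,\nu}}$ for $\nu\in\mathcal V_i$. These embeddings define the algebra structures and degrees in the statement. Since $L/K$ is finite separable, an isomorphism $\phi$ as in the statement exists. The field $F_i$ is an extension of $L$ via $L\to L\otimes_K M\xrightarrow{\phi}\prod_k F_k\to F_i$ (canonical map, then $\phi$, then projection to the $i$-th coordinate), and an extension of $M$ similarly; the two resulting embeddings $K\to F_i$ agree. The absolute value on $\widehat M$ has a unique extension to $\widehat{M}^a$. The canonical correspondence in (1) is the following: a $\widehat K$-algebra embedding $\beta\colon\widehat L\to\widehat{M}^a$, restricted to $L$, together with $M\to\widehat M\to\widehat{M}^a$ induces a ring homomorphism $L\otimes_K M\to\widehat{M}^a$, which factors through the projection to exactly one $F_i$; the class of $\beta$ corresponds to the element of $\mathcal V_i$ obtained by restricting the absolute value of $\widehat{M}^a$ to $F_i$ along the resulting embedding $F_i\to\widehat{M}^a$. *)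

theory Defs
  imports
    Complex_Main
    "HOL-Algebra.Algebra"
    "HOL-Algebra.Free_Abelian_Groups"
begin

section \<open>Finite separable extensions\<close>

text \<open>A field extension is given by a ring homomorphism \<open>f\<close> from \<open>R\<close> to \<open>S\<close> between fields; the
  library's linear algebra over subfields is applied to the subfield \<open>f ` carrier R\<close> of \<open>S\<close>.\<close>

definition finite_ext ::
  "('a, 'x) ring_scheme \<Rightarrow> ('b, 'y) ring_scheme \<Rightarrow> ('a \<Rightarrow> 'b) \<Rightarrow> bool"
  where "finite_ext R S f \<longleftrightarrow> ring.finite_dimension S (f ` carrier R) (carrier S)"

text \<open>\<^const>\<open>ring.dim\<close> is meaningful only together with \<open>finite_ext\<close>.\<close>

definition ext_degree ::
  "('a, 'x) ring_scheme \<Rightarrow> ('b, 'y) ring_scheme \<Rightarrow> ('a \<Rightarrow> 'b) \<Rightarrow> nat"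
  where "ext_degree R S f = ring.dim S (f ` carrier R) (carrier S)"

text \<open>Polynomials are coefficient lists, with the leading coefficient first.\<close>

definition (in ring) poly_deriv :: "'a list \<Rightarrow> 'a list"
  where "poly_deriv p =
    normalize (map (\<lambda>i. [Suc i] \<cdot> coeff p (Suc i)) (rev [0..<degree p]))"

definition (in ring) separable_poly :: "'a set \<Rightarrow> 'a list \<Rightarrow> bool"
  where "separable_poly K p \<longleftrightarrow> p \<in> carrier (K[X]) \<and>
    (\<forall>d \<in> carrier (K[X]).
      d divides\<^bsub>K[X]\<^esub> p \<and> d divides\<^bsub>K[X]\<^esub> poly_deriv p \<longrightarrow> d \<in> Units (K[X]))"

definition (in ring) separable_element :: "'a set \<Rightarrow> 'a \<Rightarrow> bool"
  where "separable_element K x \<longleftrightarrow> (algebraic over K) x \<and> separable_poly K (Irr K x)"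

definition separable_ext ::
  "('a, 'x) ring_scheme \<Rightarrow> ('b, 'y) ring_scheme \<Rightarrow> ('a \<Rightarrow> 'b) \<Rightarrow> bool"
  where "separable_ext R S f \<longleftrightarrow>
    (\<forall>x \<in> carrier S. ring.separable_element S (f ` carrier R) x)"


section \<open>Tensor products\<close>

text \<open>The free abelian group on the set \<open>carrier L \<times> carrier M\<close> (compare
  \<^const>\<open>free_Abelian_group\<close>), with the biadditive multiplication that is given on generators by
  the componentwise product.\<close>

definition pair_ring ::
  "('l, 'x) ring_scheme \<Rightarrow> ('m, 'y) ring_scheme \<Rightarrow> (('l \<times> 'm) \<Rightarrow>\<^sub>0 int) ring"
  where "pair_ring L M =
    \<lparr>carrier = {c. Poly_Mapping.keys c \<subseteq> carrier L \<times> carrier M},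
     monoid.mult = (\<lambda>c d. frag_extend (\<lambda>(a, b). frag_extend
        (\<lambda>(a', b'). frag_of (a \<otimes>\<^bsub>L\<^esub> a', b \<otimes>\<^bsub>M\<^esub> b')) d) c),
     one = frag_of (\<one>\<^bsub>L\<^esub>, \<one>\<^bsub>M\<^esub>),
     ring.zero = 0,
     ring.add = (+)\<rparr>"

text \<open>For \<open>f\<close> from \<open>K\<close> to \<open>L\<close> and \<open>g\<close> from \<open>K\<close> to \<open>M\<close>: biadditivity and \<open>K\<close>-balancedness.\<close>

inductive_set tensor_rels ::
  "('k, 'z) ring_scheme \<Rightarrow> ('l, 'x) ring_scheme \<Rightarrow> ('m, 'y) ring_scheme
    \<Rightarrow> ('k \<Rightarrow> 'l) \<Rightarrow> ('k \<Rightarrow> 'm) \<Rightarrow> (('l \<times> 'm) \<Rightarrow>\<^sub>0 int) set"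
  for K L M f g where
  add_left: "\<lbrakk>a \<in> carrier L; a' \<in> carrier L; b \<in> carrier M\<rbrakk> \<Longrightarrow>
    frag_of (a \<oplus>\<^bsub>L\<^esub> a', b) - frag_of (a, b) - frag_of (a', b) \<in> tensor_rels K L M f g"
| add_right: "\<lbrakk>a \<in> carrier L; b \<in> carrier M; b' \<in> carrier M\<rbrakk> \<Longrightarrow>
    frag_of (a, b \<oplus>\<^bsub>M\<^esub> b') - frag_of (a, b) - frag_of (a, b') \<in> tensor_rels K L M f g"
| balanced: "\<lbrakk>k \<in> carrier K; a \<in> carrier L; b \<in> carrier M\<rbrakk> \<Longrightarrow>
    frag_of (f k \<otimes>\<^bsub>L\<^esub> a, b) - frag_of (a, g k \<otimes>\<^bsub>M\<^esub> b) \<in> tensor_rels K L M f g"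

text \<open>The additive subgroup generated by the relations. The relations are stable under
  multiplication by generators, so this subgroup is an ideal of \<open>pair_ring L M\<close>.\<close>

definition tensor_ideal ::
  "('k, 'z) ring_scheme \<Rightarrow> ('l, 'x) ring_scheme \<Rightarrow> ('m, 'y) ring_scheme
    \<Rightarrow> ('k \<Rightarrow> 'l) \<Rightarrow> ('k \<Rightarrow> 'm) \<Rightarrow> (('l \<times> 'm) \<Rightarrow>\<^sub>0 int) set"
  where "tensor_ideal K L M f g = generate (add_monoid (pair_ring L M)) (tensor_rels K L M f g)"

definition tensor_ring ::
  "('k, 'z) ring_scheme \<Rightarrow> ('l, 'x) ring_scheme \<Rightarrow> ('m, 'y) ring_scheme
    \<Rightarrow> ('k \<Rightarrow> 'l) \<Rightarrow> ('k \<Rightarrow> 'm) \<Rightarrow> (('l \<times> 'm) \<Rightarrow>\<^sub>0 int) set ring"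
  where "tensor_ring K L M f g = pair_ring L M Quot tensor_ideal K L M f g"

definition tensor ::
  "('k, 'z) ring_scheme \<Rightarrow> ('l, 'x) ring_scheme \<Rightarrow> ('m, 'y) ring_scheme
    \<Rightarrow> ('k \<Rightarrow> 'l) \<Rightarrow> ('k \<Rightarrow> 'm) \<Rightarrow> 'l \<Rightarrow> 'm \<Rightarrow> (('l \<times> 'm) \<Rightarrow>\<^sub>0 int) set"
  where "tensor K L M f g a b = tensor_ideal K L M f g +>\<^bsub>pair_ring L M\<^esub> frag_of (a, b)"


section \<open>Absolute values and completions\<close>

definition absolute_value :: "('a, 'x) ring_scheme \<Rightarrow> ('a \<Rightarrow> real) \<Rightarrow> bool"
  where "absolute_value R v \<longleftrightarrow>
    (\<forall>x \<in> carrier R. 0 \<le> v x) \<and>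
    (\<forall>x \<in> carrier R. v x = 0 \<longleftrightarrow> x = \<zero>\<^bsub>R\<^esub>) \<and>
    (\<forall>x \<in> carrier R. \<forall>y \<in> carrier R. v (x \<otimes>\<^bsub>R\<^esub> y) = v x * v y) \<and>
    (\<forall>x \<in> carrier R. \<forall>y \<in> carrier R. v (x \<oplus>\<^bsub>R\<^esub> y) \<le> v x + v y)"

definition cauchy_seqs :: "('a, 'x) ring_scheme \<Rightarrow> ('a \<Rightarrow> real) \<Rightarrow> (nat \<Rightarrow> 'a) set"
  where "cauchy_seqs R v = {x. (\<forall>n. x n \<in> carrier R) \<and>
    (\<forall>e>0. \<exists>N. \<forall>m\<ge>N. \<forall>n\<ge>N. v (x m \<ominus>\<^bsub>R\<^esub> x n) < e)}"

definition null_seqs :: "('a, 'x) ring_scheme \<Rightarrow> ('a \<Rightarrow> real) \<Rightarrow> (nat \<Rightarrow> 'a) set"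
  where "null_seqs R v = {x. (\<forall>n. x n \<in> carrier R) \<and> (\<lambda>n. v (x n)) \<longlonglongrightarrow> 0}"

definition cauchy_ring :: "('a, 'x) ring_scheme \<Rightarrow> ('a \<Rightarrow> real) \<Rightarrow> (nat \<Rightarrow> 'a) ring"
  where "cauchy_ring R v =
    \<lparr>carrier = cauchy_seqs R v,
     monoid.mult = (\<lambda>x y n. x n \<otimes>\<^bsub>R\<^esub> y n),
     one = (\<lambda>_. \<one>\<^bsub>R\<^esub>),
     ring.zero = (\<lambda>_. \<zero>\<^bsub>R\<^esub>),
     ring.add = (\<lambda>x y n. x n \<oplus>\<^bsub>R\<^esub> y n)\<rparr>"

definition field_completion :: "('a, 'x) ring_scheme \<Rightarrow> ('a \<Rightarrow> real) \<Rightarrow> (nat \<Rightarrow> 'a) set ring"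
  where "field_completion R v = cauchy_ring R v Quot null_seqs R v"

definition completion_embed :: "('a, 'x) ring_scheme \<Rightarrow> ('a \<Rightarrow> real) \<Rightarrow> 'a \<Rightarrow> (nat \<Rightarrow> 'a) set"
  where "completion_embed R v a = null_seqs R v +>\<^bsub>cauchy_ring R v\<^esub> (\<lambda>_. a)"

definition completion_abs :: "('a, 'x) ring_scheme \<Rightarrow> ('a \<Rightarrow> real) \<Rightarrow> (nat \<Rightarrow> 'a) set \<Rightarrow> real"
  where "completion_abs R v C = (THE r. \<forall>x \<in> C. (\<lambda>n. v (x n)) \<longlonglongrightarrow> r)"

text \<open>The embedding of completions induced by an embedding \<open>f\<close> with \<open>v' (f a) = v a\<close>.\<close>

definition completion_map ::
  "('a, 'x) ring_scheme \<Rightarrow> ('a \<Rightarrow> real) \<Rightarrow> ('b, 'y) ring_scheme \<Rightarrow> ('b \<Rightarrow> real)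
    \<Rightarrow> ('a \<Rightarrow> 'b) \<Rightarrow> (nat \<Rightarrow> 'a) set \<Rightarrow> (nat \<Rightarrow> 'b) set"
  where "completion_map R v S v' f = (THE h.
    h \<in> extensional (carrier (field_completion R v)) \<and>
    h \<in> ring_hom (field_completion R v) (field_completion S v') \<and>
    (\<forall>C \<in> carrier (field_completion R v). completion_abs S v' (h C) = completion_abs R v C) \<and>
    (\<forall>a \<in> carrier R. h (completion_embed R v a) = completion_embed S v' (f a)))"

text \<open>The unique extension of the absolute value of the completion of \<open>M\<close> along an algebraic
  closure, given as an embedding \<open>\<iota>\<close> of the completion into \<open>A\<close>.\<close>

definition closure_abs ::
  "('m, 'x) ring_scheme \<Rightarrow> ('m \<Rightarrow> real) \<Rightarrow> ('a, 'y) ring_scheme \<Rightarrow> ((nat \<Rightarrow> 'm) set \<Rightarrow> 'a)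
    \<Rightarrow> 'a \<Rightarrow> real"
  where "closure_abs M v A \<iota> = (THE w.
    w \<in> extensional (carrier A) \<and> absolute_value A w \<and>
    (\<forall>x \<in> carrier (field_completion M v). w (\<iota> x) = completion_abs M v x))"


section \<open>The factors of the tensor product\<close>

text \<open>In this section \<open>\<phi>\<close> maps \<open>tensor_ring K L M f g\<close> isomorphically to \<open>RDirProd_list Fs\<close>, whose
  elements are lists; the factors are indexed by \<open>i < length Fs\<close>.\<close>

definition left_emb ::
  "('k, 'z) ring_scheme \<Rightarrow> ('l, 'x) ring_scheme \<Rightarrow> ('m, 'y) ring_scheme
    \<Rightarrow> ('k \<Rightarrow> 'l) \<Rightarrow> ('k \<Rightarrow> 'm) \<Rightarrow> ((('l \<times> 'm) \<Rightarrow>\<^sub>0 int) set \<Rightarrow> 'f list) \<Rightarrow> nat \<Rightarrow> 'l \<Rightarrow> 'f"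
  where "left_emb K L M f g \<phi> i a = \<phi> (tensor K L M f g a \<one>\<^bsub>M\<^esub>) ! i"

definition right_emb ::
  "('k, 'z) ring_scheme \<Rightarrow> ('l, 'x) ring_scheme \<Rightarrow> ('m, 'y) ring_scheme
    \<Rightarrow> ('k \<Rightarrow> 'l) \<Rightarrow> ('k \<Rightarrow> 'm) \<Rightarrow> ((('l \<times> 'm) \<Rightarrow>\<^sub>0 int) set \<Rightarrow> 'f list) \<Rightarrow> nat \<Rightarrow> 'm \<Rightarrow> 'f"
  where "right_emb K L M f g \<phi> i b = \<phi> (tensor K L M f g \<one>\<^bsub>L\<^esub> b) ! i"

text \<open>\<open>ext_abs L v M v' F p q\<close> is the set of absolute values on \<open>F\<close> that extend both \<open>v\<close> (along
  \<open>p\<close>, from \<open>L\<close>) and \<open>v'\<close> (along \<open>q\<close>, from \<open>M\<close>). Extensionality makes equality of its elements the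
  equality on \<open>carrier F\<close>.\<close>

definition ext_abs ::
  "('l, 'x) ring_scheme \<Rightarrow> ('l \<Rightarrow> real) \<Rightarrow> ('m, 'y) ring_scheme \<Rightarrow> ('m \<Rightarrow> real)
    \<Rightarrow> ('f, 'w) ring_scheme \<Rightarrow> ('l \<Rightarrow> 'f) \<Rightarrow> ('m \<Rightarrow> 'f) \<Rightarrow> ('f \<Rightarrow> real) set"
  where "ext_abs L v M v' F p q = {\<nu> \<in> extensional (carrier F). absolute_value F \<nu> \<and>
    (\<forall>a \<in> carrier L. \<nu> (p a) = v a) \<and> (\<forall>b \<in> carrier M. \<nu> (q b) = v' b)}"


section \<open>Embeddings into the algebraic closure\<close>

text \<open>For ring homomorphisms \<open>p\<close> from \<open>R\<close> to \<open>S\<close> and \<open>q\<close> from \<open>R\<close> to \<open>A\<close>: the \<open>R\<close>-algebra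
  homomorphisms from \<open>S\<close> to \<open>A\<close>. They are injective when \<open>S\<close> and \<open>A\<close> are fields.\<close>

definition alg_embs ::
  "('r, 'x) ring_scheme \<Rightarrow> ('s, 'y) ring_scheme \<Rightarrow> ('a, 'z) ring_scheme
    \<Rightarrow> ('r \<Rightarrow> 's) \<Rightarrow> ('r \<Rightarrow> 'a) \<Rightarrow> ('s \<Rightarrow> 'a) set"
  where "alg_embs R S A p q = {\<beta> \<in> extensional (carrier S). \<beta> \<in> ring_hom S A \<and>
    (\<forall>x \<in> carrier R. \<beta> (p x) = q x)}"

definition alg_auts ::
  "('r, 'x) ring_scheme \<Rightarrow> ('a, 'z) ring_scheme \<Rightarrow> ('r \<Rightarrow> 'a) \<Rightarrow> ('a \<Rightarrow> 'a) set"
  where "alg_auts R A q = {\<sigma> \<in> ring_iso A A. \<forall>x \<in> carrier R. \<sigma> (q x) = q x}"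

definition conj_rel ::
  "('s, 'y) ring_scheme \<Rightarrow> ('a \<Rightarrow> 'a) set \<Rightarrow> ('s \<Rightarrow> 'a) set \<Rightarrow> (('s \<Rightarrow> 'a) \<times> ('s \<Rightarrow> 'a)) set"
  where "conj_rel S G E = {(\<beta>, \<beta>'). \<beta> \<in> E \<and> \<beta>' \<in> E \<and>
    (\<exists>\<sigma> \<in> G. \<forall>y \<in> carrier S. \<beta>' y = \<sigma> (\<beta> y))}"

text \<open>\<open>corresponds \<dots> \<beta> i \<nu>\<close>: the ring homomorphism \<open>h\<close> from the tensor product to \<open>A\<close> that is induced
  by \<open>\<beta>\<close> (restricted to \<open>L\<close>) and \<open>\<iota>\<close> (restricted to \<open>M\<close>) factors through the projection to the
  \<open>i\<close>-th factor \<open>F\<close>, as \<open>\<gamma>\<close> after the projection, and \<open>\<nu>\<close> is the restriction along \<open>\<gamma>\<close> of the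
  absolute value of \<open>A\<close>.\<close>

definition corresponds ::
  "('k, 'z) ring_scheme \<Rightarrow> ('l, 'x) ring_scheme \<Rightarrow> ('m, 'y) ring_scheme
    \<Rightarrow> ('k \<Rightarrow> 'l) \<Rightarrow> ('k \<Rightarrow> 'm) \<Rightarrow> ('l \<Rightarrow> real) \<Rightarrow> ('m \<Rightarrow> real)
    \<Rightarrow> ('f, 'w) ring_scheme list \<Rightarrow> ((('l \<times> 'm) \<Rightarrow>\<^sub>0 int) set \<Rightarrow> 'f list)
    \<Rightarrow> ('a, 'v) ring_scheme \<Rightarrow> ((nat \<Rightarrow> 'm) set \<Rightarrow> 'a)
    \<Rightarrow> ((nat \<Rightarrow> 'l) set \<Rightarrow> 'a) \<Rightarrow> nat \<Rightarrow> ('f \<Rightarrow> real) \<Rightarrow> bool"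
  where "corresponds K L M f g vL vM Fs \<phi> A \<iota> \<beta> i \<nu> \<longleftrightarrow>
    (\<exists>h \<gamma>. h \<in> ring_hom (tensor_ring K L M f g) A \<and>
      (\<forall>a \<in> carrier L. \<forall>b \<in> carrier M. h (tensor K L M f g a b) =
        \<beta> (completion_embed L vL a) \<otimes>\<^bsub>A\<^esub> \<iota> (completion_embed M vM b)) \<and>
      \<gamma> \<in> ring_hom (Fs ! i) A \<and>
      (\<forall>t \<in> carrier (tensor_ring K L M f g). h t = \<gamma> (\<phi> t ! i)) \<and>
      \<nu> = (\<lambda>x \<in> carrier (Fs ! i). closure_abs M vM A \<iota> (\<gamma> x)))"

end

theory Submission
  imports Defs
begin

text \<open>
Write \<open>E\<close> for the set of \<open>Kh\<close>-algebra homomorphisms from \<open>Lh\<close> to the algebraic closure \<open>A\<close> of \<open>Mh\<close>,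
where \<open>Kh\<close>, \<open>Lh\<close>, \<open>Mh\<close> are the completions, and let \<open>w\<close> be the absolute value of \<open>A\<close>. Both parts of the
theorem come from computing the fibres of the correspondence between \<open>E\<close> and the pairs
\<open>(i, \<nu>)\<close> with \<open>\<nu> \<in> V i\<close>.

A \<open>\<beta> \<in> E\<close> and \<open>\<iota>\<close> induce a homomorphism from the tensor product to a domain. Such a homomorphism kills
all but one of the orthogonal idempotents of \<open>F\<^sub>1 \<times> \<dots> \<times> F\<^sub>n\<close>, so it factors through exactly one
\<open>F\<^sub>i\<close>, as some \<open>\<gamma>\<close>, and \<open>\<nu> = w \<circ> \<gamma>\<close> belongs to \<open>V i\<close>: every \<open>\<beta> \<in> E\<close> is an isometry, because an
absolute value extends uniquely from a complete field to an algebraic extension. Hence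
\<open>E\<close> is the disjoint union of the fibres over the pairs \<open>(i, \<nu>)\<close>.

The fibre over \<open>(i, \<nu>)\<close> is in bijection with the set \<open>D i \<nu>\<close> of \<open>Mh\<close>-algebra homomorphisms from the
completion of \<open>(F\<^sub>i, \<nu>)\<close> to \<open>A\<close>. In one direction, restrict along the completion of \<open>L \<rightarrow> F\<^sub>i\<close>. In the
other direction, \<open>\<gamma>\<close> is an isometry from \<open>(F\<^sub>i, \<nu>)\<close> into a finite extension of \<open>\<iota>(Mh)\<close> inside \<open>A\<close>, which is
complete, so \<open>\<gamma>\<close> extends to the completion of \<open>F\<^sub>i\<close>. This gives everything:

\<^item> All of \<open>D i \<nu>\<close> is conjugate under the automorphisms of \<open>A\<close> over \<open>Mh\<close>, and these automorphisms
  preserve \<open>w\<close>; so the fibres are exactly the conjugacy classes in \<open>E\<close>.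

\<^item> The completion of \<open>L\<close> is generated over \<open>Kh\<close> by a basis of \<open>L\<close> over \<open>K\<close>, and the completion of \<open>F\<^sub>i\<close> is
  generated over \<open>Mh\<close> by the image of this basis: the subfield that is generated is finite over a complete
  field, hence complete, and contains a dense subset. The generators are roots of polynomials with
  simple roots, so the number of homomorphisms into \<open>A\<close> equals the degree, both for \<open>E\<close> and for \<open>D i \<nu>\<close>
  (\<open>completion_embeddings\<close>). Counting \<open>E\<close> by fibres is the degree formula.

Two ingredients about absolute values carry this. Uniqueness of extensions from a complete field
(\<open>algebraic_abs_unique\<close>) is the equivalence of norms on a finite-dimensional space
(\<open>finite_dimension_bounded\<close>). Existence (\<open>algebraic_absolute_value\<close>), which makes \<open>w\<close> available at all, is
proved uniformly for archimedean and non-archimedean absolute values: on a field, a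
minimal submultiplicative seminorm is multiplicative (\<open>p_multiplicative\<close>), and minimal seminorms
exist below the operator norm of a finite extension by Zorn's lemma.
\<close>

section \<open>Absolute values and completions\<close>

lemma null_comparison:
  fixes f g :: "nat \<Rightarrow> real"
  assumes "\<And>n. norm (f n) \<le> g n" "g \<longlonglongrightarrow> 0" shows "f \<longlonglongrightarrow> 0"
proof (rule tendsto_0_le[OF assms(2)])
  show "\<forall>\<^sub>F n in sequentially. norm (f n) \<le> norm (g n) * 1"
    using order_trans[OF assms(1) abs_ge_self] by (intro always_eventually allI) simp
qed

locale valued_field = field R for R (structure) +
  fixes v :: "'a \<Rightarrow> real"
  assumes abs_v: "absolute_value R v"
begin

lemma v_nonneg [simp]: "x \<in> carrier R \<Longrightarrow> 0 \<le> v x"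
  and v_eq_0_iff [simp]: "x \<in> carrier R \<Longrightarrow> v x = 0 \<longleftrightarrow> x = \<zero>"
  and v_mult [simp]: "\<lbrakk>x \<in> carrier R; y \<in> carrier R\<rbrakk> \<Longrightarrow> v (x \<otimes> y) = v x * v y"
  and v_add: "\<lbrakk>x \<in> carrier R; y \<in> carrier R\<rbrakk> \<Longrightarrow> v (x \<oplus> y) \<le> v x + v y"
  using abs_v unfolding absolute_value_def by auto

lemma v_zero [simp]: "v \<zero> = 0"
  by simp

lemma v_pos: "\<lbrakk>x \<in> carrier R; x \<noteq> \<zero>\<rbrakk> \<Longrightarrow> 0 < v x"
  by (metis v_eq_0_iff v_nonneg order_le_less)

lemma v_one [simp]: "v \<one> = 1"
  using v_mult[of \<one> \<one>] v_eq_0_iff[of \<one>] by simp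

lemma v_minus [simp]:
  assumes x: "x \<in> carrier R" shows "v (\<ominus> x) = v x"
proof -
  have "v (\<ominus> \<one>) * v (\<ominus> \<one>) = v (\<ominus> \<one> \<otimes> \<ominus> \<one>)"
    by (simp del: l_minus r_minus)
  also have "\<ominus> \<one> \<otimes> \<ominus> \<one> = \<one>"
    by (simp add: l_minus)
  finally have "v (\<ominus> \<one>) = 1"
    using v_nonneg[of "\<ominus> \<one>"] by (metis add.inv_closed v_one mult_cancel_left2 one_closed power2_eq_imp_eq power2_eq_square zero_le_one mult_1)
  moreover have "\<ominus> x = \<ominus> \<one> \<otimes> x"
    using x by (simp add: l_minus)
  ultimately show ?thesis
    using x v_mult[of "\<ominus> \<one>" x] by simp
qed

lemma v_diff: "\<lbrakk>x \<in> carrier R; y \<in> carrier R\<rbrakk> \<Longrightarrow> v (x \<ominus> y) \<le> v x + v y"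
  using v_add[of x "\<ominus> y"] by (simp add: a_minus_def)

lemma v_diff_commute: "\<lbrakk>x \<in> carrier R; y \<in> carrier R\<rbrakk> \<Longrightarrow> v (x \<ominus> y) = v (y \<ominus> x)"
  using v_minus[of "x \<ominus> y"] by (simp add: a_minus_def minus_add a_comm)

lemma v_diff_triangle:
  assumes "x \<in> carrier R" "y \<in> carrier R" "z \<in> carrier R"
  shows "v (x \<ominus> z) \<le> v (x \<ominus> y) + v (y \<ominus> z)"
proof -
  have "x \<ominus> z = (x \<ominus> y) \<oplus> (y \<ominus> z)"
    using assms by algebra
  then show ?thesis
    using assms v_add[of "x \<ominus> y" "y \<ominus> z"] by simp
qed

lemma v_abs_diff:
  assumes "x \<in> carrier R" "y \<in> carrier R"
  shows "\<bar>v x - v y\<bar> \<le> v (x \<ominus> y)"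
proof -
  have "x = (x \<ominus> y) \<oplus> y" "y = (y \<ominus> x) \<oplus> x"
    using assms by algebra+
  then have "v x \<le> v (x \<ominus> y) + v y" "v y \<le> v (y \<ominus> x) + v x"
    using assms v_add[of "x \<ominus> y" y] v_add[of "y \<ominus> x" x] by auto
  then show ?thesis
    using v_diff_commute[OF assms] by simp
qed

lemma v_pow [simp]: "x \<in> carrier R \<Longrightarrow> v (x [^] (n::nat)) = v x ^ n"
  by (induction n) (simp_all add: mult.commute)

lemma v_inv: "\<lbrakk>x \<in> carrier R; x \<noteq> \<zero>\<rbrakk> \<Longrightarrow> v (inv x) = inverse (v x)"
  by (metis Diff_iff Units_inv_closed Units_r_inv empty_iff field_Units insert_iff inverse_unique v_mult v_one)

lemma diff_eq_zero: "\<lbrakk>x \<in> carrier R; y \<in> carrier R; x \<ominus> y = \<zero>\<rbrakk> \<Longrightarrow> x = y"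
  by (simp add: r_right_minus_eq)

lemma cauchy_seqs_iff:
  "x \<in> cauchy_seqs R v \<longleftrightarrow> (\<forall>n. x n \<in> carrier R) \<and> (\<forall>e>0. \<exists>N. \<forall>m\<ge>N. \<forall>n\<ge>N. v (x m \<ominus> x n) < e)"
  by (simp add: cauchy_seqs_def)

lemma cauchy_closed: "x \<in> cauchy_seqs R v \<Longrightarrow> x n \<in> carrier R"
  by (simp add: cauchy_seqs_iff)

lemma convergent_v:
  assumes x: "x \<in> cauchy_seqs R v" shows "convergent (\<lambda>n. v (x n))"
proof -
  have "Cauchy (\<lambda>n. v (x n))"
    unfolding Cauchy_def dist_real_def
  proof (intro allI impI)
    fix e :: real assume "e > 0"
    then obtain N where N: "\<forall>m\<ge>N. \<forall>n\<ge>N. v (x m \<ominus> x n) < e"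
      using x unfolding cauchy_seqs_iff by blast
    have "\<bar>v (x m) - v (x n)\<bar> < e" if "m \<ge> N" "n \<ge> N" for m n
      using le_less_trans[OF v_abs_diff, of "x m" "x n" e] x N that by (simp add: cauchy_seqs_iff)
    then show "\<exists>M. \<forall>m\<ge>M. \<forall>n\<ge>M. \<bar>v (x m) - v (x n)\<bar> < e" by blast
  qed
  then show ?thesis
    by (simp add: Cauchy_convergent_iff)
qed

lemma cauchy_bounded:
  assumes "x \<in> cauchy_seqs R v" obtains B where "B > 0" "\<forall>n. v (x n) \<le> B"
proof -
  from convergent_imp_Bseq[OF convergent_v[OF assms]]
  obtain B where "B > 0" "\<forall>n. norm (v (x n)) \<le> B"
    by (auto elim: BseqE)
  then show ?thesis
    using that[of B] by (auto simp: abs_le_iff)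
qed

lemma null_seqs_iff: "x \<in> null_seqs R v \<longleftrightarrow> (\<forall>n. x n \<in> carrier R) \<and> (\<lambda>n. v (x n)) \<longlonglongrightarrow> 0"
  by (simp add: null_seqs_def)

lemma tendsto_add_seq:
  assumes "\<forall>n. x n \<in> carrier R" "\<forall>n. y n \<in> carrier R" "a \<in> carrier R" "b \<in> carrier R"
    and "(\<lambda>n. v (x n \<ominus> a)) \<longlonglongrightarrow> 0" "(\<lambda>n. v (y n \<ominus> b)) \<longlonglongrightarrow> 0"
  shows "(\<lambda>n. v (x n \<oplus> y n \<ominus> (a \<oplus> b))) \<longlonglongrightarrow> 0"
proof (rule tendsto_sandwich[OF _ _ tendsto_const])
  show "\<forall>\<^sub>F n in sequentially. 0 \<le> v (x n \<oplus> y n \<ominus> (a \<oplus> b))"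
    using assms by simp
  have "x n \<oplus> y n \<ominus> (a \<oplus> b) = (x n \<ominus> a) \<oplus> (y n \<ominus> b)" for n
    using assms(1,2)[rule_format, of n] assms(3,4) by algebra
  then show "\<forall>\<^sub>F n in sequentially. v (x n \<oplus> y n \<ominus> (a \<oplus> b)) \<le> v (x n \<ominus> a) + v (y n \<ominus> b)"
    using assms by (auto intro!: always_eventually v_add)
  show "(\<lambda>n. v (x n \<ominus> a) + v (y n \<ominus> b)) \<longlonglongrightarrow> 0"
    using tendsto_add[OF assms(5,6)] by simp
qed

lemma tendsto_mult_seq:
  assumes "\<forall>n. x n \<in> carrier R" "\<forall>n. y n \<in> carrier R" "a \<in> carrier R" "b \<in> carrier R"
    and "(\<lambda>n. v (x n \<ominus> a)) \<longlonglongrightarrow> 0" "(\<lambda>n. v (y n \<ominus> b)) \<longlonglongrightarrow> 0"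
  shows "(\<lambda>n. v (x n \<otimes> y n \<ominus> (a \<otimes> b))) \<longlonglongrightarrow> 0"
proof (rule tendsto_sandwich[OF _ _ tendsto_const])
  show "\<forall>\<^sub>F n in sequentially. 0 \<le> v (x n \<otimes> y n \<ominus> (a \<otimes> b))"
    using assms by simp
  have eq: "x n \<otimes> y n \<ominus> (a \<otimes> b) = (x n \<ominus> a) \<otimes> (y n \<ominus> b) \<oplus> ((x n \<ominus> a) \<otimes> b \<oplus> a \<otimes> (y n \<ominus> b))" for n
    using assms(1,2)[rule_format, of n] assms(3,4) by algebra
  have "v (x n \<otimes> y n \<ominus> (a \<otimes> b)) \<le> v (x n \<ominus> a) * v (y n \<ominus> b) + (v (x n \<ominus> a) * v b + v a * v (y n \<ominus> b))" for n
    unfolding eq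
    by (rule order_trans[OF v_add] order_trans[OF add_left_mono[OF v_add]]; use assms in simp)+
  then show "\<forall>\<^sub>F n in sequentially. v (x n \<otimes> y n \<ominus> (a \<otimes> b))
      \<le> v (x n \<ominus> a) * v (y n \<ominus> b) + (v (x n \<ominus> a) * v b + v a * v (y n \<ominus> b))"
    by simp
  have "(\<lambda>n. v (x n \<ominus> a) * v (y n \<ominus> b) + (v (x n \<ominus> a) * v b + v a * v (y n \<ominus> b))) \<longlonglongrightarrow> 0 * 0 + (0 * v b + v a * 0)"
    by (intro tendsto_intros assms)
  then show "(\<lambda>n. v (x n \<ominus> a) * v (y n \<ominus> b) + (v (x n \<ominus> a) * v b + v a * v (y n \<ominus> b))) \<longlonglongrightarrow> 0"
    by simp
qed

lemma limit_unique:
  assumes "\<forall>n. x n \<in> carrier R" "a \<in> carrier R" "b \<in> carrier R"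
    and "(\<lambda>n. v (x n \<ominus> a)) \<longlonglongrightarrow> 0" "(\<lambda>n. v (x n \<ominus> b)) \<longlonglongrightarrow> 0"
  shows "a = b"
proof -
  have "v (a \<ominus> b) \<le> v (x n \<ominus> a) + v (x n \<ominus> b)" for n
    using v_diff_triangle[of a "x n" b] v_diff_commute[of a "x n"] assms(1-3) by simp
  moreover have "(\<lambda>n. v (x n \<ominus> a) + v (x n \<ominus> b)) \<longlonglongrightarrow> 0"
    using tendsto_add[OF assms(4,5)] by simp
  ultimately have "v (a \<ominus> b) \<le> 0"
    by (meson LIMSEQ_le_const)
  then have "v (a \<ominus> b) = 0"
    using v_nonneg[OF minus_closed[OF assms(2,3)]] by linarith
  then show ?thesis
    using v_eq_0_iff[OF minus_closed[OF assms(2,3)]] diff_eq_zero[OF assms(2,3)] by blast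
qed

lemma tendsto_v:
  assumes "\<forall>n. x n \<in> carrier R" "a \<in> carrier R" "(\<lambda>n. v (x n \<ominus> a)) \<longlonglongrightarrow> 0"
  shows "(\<lambda>n. v (x n)) \<longlonglongrightarrow> v a"
proof -
  have "(\<lambda>n. v (x n) - v a) \<longlonglongrightarrow> 0"
    by (rule null_comparison[OF _ assms(3)]) (use assms v_abs_diff in auto)
  then show ?thesis
    by (simp add: LIM_zero_iff)
qed

lemma convergent_imp_cauchy:
  assumes "\<forall>n. x n \<in> carrier R" "a \<in> carrier R" "(\<lambda>n. v (x n \<ominus> a)) \<longlonglongrightarrow> 0"
  shows "x \<in> cauchy_seqs R v"
  unfolding cauchy_seqs_iff
proof (intro conjI allI impI)
  show "x n \<in> carrier R" for n using assms by simp
  fix e :: real assume "e > 0"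
  then obtain N where N: "\<forall>n\<ge>N. v (x n \<ominus> a) < e / 2"
    using order_tendstoD(2)[OF assms(3), of "e/2"] unfolding eventually_sequentially by auto
  have "v (x m \<ominus> x n) < e" if "m \<ge> N" "n \<ge> N" for m n
    using v_diff_triangle[of "x m" a "x n"] v_diff_commute[of a "x n"] N that assms
    by (smt (verit) field_sum_of_halves)
  then show "\<exists>N. \<forall>m\<ge>N. \<forall>n\<ge>N. v (x m \<ominus> x n) < e" by blast
qed

end

text \<open>Completeness of a subset of a valued field, where Cauchy sequences and limits are taken in the ambient field.
It applies to subfields and to linear subspaces alike.\<close>

definition complete_subset :: "('a, 'x) ring_scheme \<Rightarrow> ('a \<Rightarrow> real) \<Rightarrow> 'a set \<Rightarrow> bool"
  where "complete_subset R v k \<longleftrightarrow> (\<forall>x \<in> cauchy_seqs R v. range x \<subseteq> k \<longrightarrow>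
    (\<exists>a \<in> k. (\<lambda>n. v (x n \<ominus>\<^bsub>R\<^esub> a)) \<longlonglongrightarrow> 0))"

subsection \<open>The completion of a valued field\<close>

context valued_field
begin

abbreviation "CR \<equiv> cauchy_ring R v"
abbreviation "Rh \<equiv> field_completion R v"
abbreviation "emb \<equiv> completion_embed R v"
abbreviation "vh \<equiv> completion_abs R v"
abbreviation "cls x \<equiv> null_seqs R v +>\<^bsub>CR\<^esub> x"

lemma cauchy_ring_simps [simp]:
  "carrier CR = cauchy_seqs R v" "monoid.mult CR = (\<lambda>x y n. x n \<otimes> y n)" "one CR = (\<lambda>_. \<one>)"
  "ring.zero CR = (\<lambda>_. \<zero>)" "ring.add CR = (\<lambda>x y n. x n \<oplus> y n)"
  by (simp_all add: cauchy_ring_def)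

lemma const_cauchy: "a \<in> carrier R \<Longrightarrow> (\<lambda>_. a) \<in> cauchy_seqs R v"
  by (simp add: cauchy_seqs_iff a_minus_def r_neg)

lemma add_cauchy:
  assumes x: "x \<in> cauchy_seqs R v" and y: "y \<in> cauchy_seqs R v"
  shows "(\<lambda>n. x n \<oplus> y n) \<in> cauchy_seqs R v"
  unfolding cauchy_seqs_iff
proof (intro conjI allI impI)
  note c = cauchy_closed[OF x] cauchy_closed[OF y]
  show "x n \<oplus> y n \<in> carrier R" for n using c by simp
  fix e :: real assume "e > 0"
  then have "e / 2 > 0" by simp
  then obtain N N' where N: "\<forall>m\<ge>N. \<forall>n\<ge>N. v (x m \<ominus> x n) < e / 2" and N': "\<forall>m\<ge>N'. \<forall>n\<ge>N'. v (y m \<ominus> y n) < e / 2"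
    using x y unfolding cauchy_seqs_iff by meson
  have "v (x m \<oplus> y m \<ominus> (x n \<oplus> y n)) < e" if "m \<ge> max N N'" "n \<ge> max N N'" for m n
  proof -
    have "x m \<oplus> y m \<ominus> (x n \<oplus> y n) = (x m \<ominus> x n) \<oplus> (y m \<ominus> y n)"
      using c[of m] c[of n] by algebra
    then have "v (x m \<oplus> y m \<ominus> (x n \<oplus> y n)) \<le> v (x m \<ominus> x n) + v (y m \<ominus> y n)"
      using v_add c by simp
    also have "\<dots> < e / 2 + e / 2"
      using N N' that by (intro add_strict_mono) auto
    finally show ?thesis by simp
  qed
  then show "\<exists>N. \<forall>m\<ge>N. \<forall>n\<ge>N. v (x m \<oplus> y m \<ominus> (x n \<oplus> y n)) < e" by blast
qed

lemma mult_cauchy: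
  assumes x: "x \<in> cauchy_seqs R v" and y: "y \<in> cauchy_seqs R v"
  shows "(\<lambda>n. x n \<otimes> y n) \<in> cauchy_seqs R v"
  unfolding cauchy_seqs_iff
proof (intro conjI allI impI)
  note c = cauchy_closed[OF x] cauchy_closed[OF y]
  show "x n \<otimes> y n \<in> carrier R" for n using c by simp
  fix e :: real assume e: "e > 0"
  obtain B B' where B: "B > 0" "\<forall>n. v (x n) \<le> B" and B': "B' > 0" "\<forall>n. v (y n) \<le> B'"
    using cauchy_bounded[OF x] cauchy_bounded[OF y] by metis
  have "e / (2*B') > 0" "e / (2*B) > 0" using e B(1) B'(1) by simp_all
  then obtain N N' where N: "\<forall>m\<ge>N. \<forall>n\<ge>N. v (x m \<ominus> x n) < e / (2*B')"
    and N': "\<forall>m\<ge>N'. \<forall>n\<ge>N'. v (y m \<ominus> y n) < e / (2*B)"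
    using x y unfolding cauchy_seqs_iff by meson
  have "v (x m \<otimes> y m \<ominus> (x n \<otimes> y n)) < e" if "m \<ge> max N N'" "n \<ge> max N N'" for m n
  proof -
    have eq: "x m \<otimes> y m \<ominus> (x n \<otimes> y n) = (x m \<ominus> x n) \<otimes> y m \<oplus> x n \<otimes> (y m \<ominus> y n)"
      using c[of m] c[of n] by algebra
    have "v (x m \<otimes> y m \<ominus> (x n \<otimes> y n)) \<le> v (x m \<ominus> x n) * v (y m) + v (x n) * v (y m \<ominus> y n)"
      unfolding eq using v_add[of "(x m \<ominus> x n) \<otimes> y m" "x n \<otimes> (y m \<ominus> y n)"] c by simp
    also have "\<dots> \<le> v (x m \<ominus> x n) * B' + B * v (y m \<ominus> y n)"
      using B B' c by (intro add_mono mult_mono) auto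
    also have "\<dots> < e / (2*B') * B' + B * (e / (2*B))"
      using N N' that B(1) B'(1) by (intro add_strict_mono mult_strict_right_mono mult_strict_left_mono) auto
    also have "\<dots> = e"
      using B(1) B'(1) by simp
    finally show ?thesis .
  qed
  then show "\<exists>N. \<forall>m\<ge>N. \<forall>n\<ge>N. v (x m \<otimes> y m \<ominus> (x n \<otimes> y n)) < e" by blast
qed

lemma minus_cauchy: "x \<in> cauchy_seqs R v \<Longrightarrow> (\<lambda>n. \<ominus> x n) \<in> cauchy_seqs R v"
  using mult_cauchy[OF const_cauchy[of "\<ominus> \<one>"], of x] cauchy_closed[of x] by (simp add: l_minus)

lemma cauchy_cring: "cring CR"
proof (rule cringI)
  show "abelian_group CR"
  proof (rule abelian_groupI)
    fix x assume "x \<in> carrier CR"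
    then show "\<exists>y \<in> carrier CR. y \<oplus>\<^bsub>CR\<^esub> x = \<zero>\<^bsub>CR\<^esub>"
      using minus_cauchy[of x] by (intro bexI[of _ "\<lambda>n. \<ominus> x n"]) (auto simp: l_neg cauchy_closed)
  qed (auto simp: add_cauchy const_cauchy cauchy_closed fun_eq_iff a_ac)
  show "comm_monoid CR"
    by (rule comm_monoidI) (auto simp: mult_cauchy const_cauchy cauchy_closed fun_eq_iff m_ac)
qed (auto simp: cauchy_closed fun_eq_iff l_distr)

sublocale C: cring CR
  by (rule cauchy_cring)

lemma null_imp_cauchy: "x \<in> null_seqs R v \<Longrightarrow> x \<in> cauchy_seqs R v"
  using convergent_imp_cauchy[of x \<zero>] by (simp add: null_seqs_iff a_minus_def)

lemma a_inv_cauchy [simp]: "x \<in> cauchy_seqs R v \<Longrightarrow> \<ominus>\<^bsub>CR\<^esub> x = (\<lambda>n. \<ominus> x n)"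
proof -
  assume "x \<in> cauchy_seqs R v"
  then show ?thesis
    using minus_cauchy[of x] by (intro C.minus_equality) (auto simp: l_neg cauchy_closed)
qed

lemma a_minus_cauchy [simp]:
  "\<lbrakk>x \<in> cauchy_seqs R v; y \<in> cauchy_seqs R v\<rbrakk> \<Longrightarrow> x \<ominus>\<^bsub>CR\<^esub> y = (\<lambda>n. x n \<ominus> y n)"
  by (simp add: a_minus_def)

lemma null_mult_cauchy:
  assumes x: "x \<in> null_seqs R v" and y: "y \<in> cauchy_seqs R v"
  shows "(\<lambda>n. x n \<otimes> y n) \<in> null_seqs R v"
proof -
  obtain B where B: "B > 0" "\<forall>n. v (y n) \<le> B"
    using cauchy_bounded[OF y] by metis
  have c: "x n \<in> carrier R" "y n \<in> carrier R" for n
    using x y by (auto simp: null_seqs_iff cauchy_closed)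
  have "(\<lambda>n. v (x n \<otimes> y n)) \<longlonglongrightarrow> 0"
  proof (rule null_comparison)
    show "norm (v (x n \<otimes> y n)) \<le> v (x n) * B" for n
      using B c by (auto intro!: mult_left_mono)
    show "(\<lambda>n. v (x n) * B) \<longlonglongrightarrow> 0"
      using x by (intro tendsto_mult_left_zero) (simp add: null_seqs_iff)
  qed
  then show ?thesis using c by (simp add: null_seqs_iff)
qed

lemma null_ideal: "ideal (null_seqs R v) CR"
proof -
  show ?thesis
  proof (rule idealI)
    show "ring CR" by (rule C.ring_axioms)
    show "subgroup (null_seqs R v) (add_monoid CR)"
    proof (rule C.add.subgroupI)
      show "null_seqs R v \<subseteq> carrier CR" using null_imp_cauchy by auto
      have "(\<lambda>_. \<zero>) \<in> null_seqs R v" by (simp add: null_seqs_iff)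
      then show "null_seqs R v \<noteq> {}" by blast
      show "\<ominus>\<^bsub>CR\<^esub> a \<in> null_seqs R v" if "a \<in> null_seqs R v" for a
        using that null_imp_cauchy[OF that] by (simp add: null_seqs_iff)
      show "a \<oplus>\<^bsub>CR\<^esub> b \<in> null_seqs R v" if "a \<in> null_seqs R v" "b \<in> null_seqs R v" for a b
        using tendsto_add_seq[of a b \<zero> \<zero>] that by (simp add: null_seqs_iff a_minus_def)
    qed
    show "x \<otimes>\<^bsub>CR\<^esub> a \<in> null_seqs R v" "a \<otimes>\<^bsub>CR\<^esub> x \<in> null_seqs R v"
      if "a \<in> null_seqs R v" "x \<in> carrier CR" for a x
    proof -
      show "a \<otimes>\<^bsub>CR\<^esub> x \<in> null_seqs R v"
        using null_mult_cauchy that by simp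
      then show "x \<otimes>\<^bsub>CR\<^esub> a \<in> null_seqs R v"
        using C.m_comm[of a x] that null_imp_cauchy[OF that(1)] by simp
    qed
  qed
qed

sublocale nullI: ideal "null_seqs R v" CR
  by (rule null_ideal)

lemma completion_cring: "cring Rh"
  unfolding field_completion_def by (rule nullI.quotient_is_cring[OF cauchy_cring])

lemma cls_hom: "(\<lambda>x. cls x) \<in> ring_hom CR Rh"
  unfolding field_completion_def by (rule nullI.rcos_ring_hom)

lemma cls_closed [simp]: "x \<in> cauchy_seqs R v \<Longrightarrow> cls x \<in> carrier Rh"
  using ring_hom_memE(1)[OF cls_hom] by simp

lemma cls_mult: "\<lbrakk>x \<in> cauchy_seqs R v; y \<in> cauchy_seqs R v\<rbrakk> \<Longrightarrow> cls x \<otimes>\<^bsub>Rh\<^esub> cls y = cls (\<lambda>n. x n \<otimes> y n)"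
  and cls_add: "\<lbrakk>x \<in> cauchy_seqs R v; y \<in> cauchy_seqs R v\<rbrakk> \<Longrightarrow> cls x \<oplus>\<^bsub>Rh\<^esub> cls y = cls (\<lambda>n. x n \<oplus> y n)"
  and cls_one: "\<one>\<^bsub>Rh\<^esub> = cls (\<lambda>n. \<one>)"
  using ring_hom_memE(2-4)[OF cls_hom] by simp_all

lemma cls_surj: "U \<in> carrier Rh \<Longrightarrow> \<exists>x \<in> cauchy_seqs R v. U = cls x"
  by (auto simp: field_completion_def FactRing_def A_RCOSETS_def')

lemma mem_cls: 
  assumes "x \<in> cauchy_seqs R v" "y \<in> cauchy_seqs R v"
  shows "y \<in> cls x \<longleftrightarrow> (\<lambda>n. y n \<ominus> x n) \<in> null_seqs R v"
proof -
  show ?thesis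
    using nullI.a_rcos_module_minus[OF C.ring_axioms, of x y] assms by simp
qed

lemma cls_subset: "\<lbrakk>x \<in> cauchy_seqs R v; y \<in> cls x\<rbrakk> \<Longrightarrow> y \<in> cauchy_seqs R v"
  using C.a_r_coset_subset_G[OF nullI.a_subset, of x] by auto

lemma cls_self: "x \<in> cauchy_seqs R v \<Longrightarrow> x \<in> cls x"
  using nullI.a_rcos_self by simp

lemma cls_eq_iff:
  assumes "x \<in> cauchy_seqs R v" "y \<in> cauchy_seqs R v"
  shows "cls x = cls y \<longleftrightarrow> (\<lambda>n. x n \<ominus> y n) \<in> null_seqs R v"
  using C.quotient_eq_iff_same_a_r_cos[OF null_ideal, of x y] assms by simp

lemma cls_minus: "\<lbrakk>x \<in> cauchy_seqs R v; y \<in> cauchy_seqs R v\<rbrakk> \<Longrightarrow> cls x \<ominus>\<^bsub>Rh\<^esub> cls y = cls (\<lambda>n. x n \<ominus> y n)"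
proof -
  interpret H: ring_hom_ring CR Rh "\<lambda>x. cls x"
    unfolding field_completion_def by (rule nullI.rcos_ring_hom_ring)
  assume "x \<in> cauchy_seqs R v" "y \<in> cauchy_seqs R v"
  then show ?thesis
    using cls_add[of x "\<lambda>n. \<ominus> y n"] H.hom_a_inv[of y] minus_cauchy[of y] by (simp add: a_minus_def)
qed

lemma vh_cls:
  assumes x: "x \<in> cauchy_seqs R v"
  shows "(\<lambda>n. v (x n)) \<longlonglongrightarrow> vh (cls x)"
proof -
  obtain r where r: "(\<lambda>n. v (x n)) \<longlonglongrightarrow> r"
    using convergent_v[OF x] by (auto simp: convergent_def)
  have lim: "(\<lambda>n. v (y n)) \<longlonglongrightarrow> r" if y: "y \<in> cls x" for y
  proof -
    have yc: "y \<in> cauchy_seqs R v" using cls_subset[OF x y] .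
    have "(\<lambda>n. v (y n \<ominus> x n)) \<longlonglongrightarrow> 0"
      using y mem_cls[OF x yc] by (simp add: null_seqs_iff)
    then have "(\<lambda>n. v (y n) - v (x n)) \<longlonglongrightarrow> 0"
      by (rule null_comparison[rotated]) (use v_abs_diff cauchy_closed[OF x] cauchy_closed[OF yc] in auto)
    from tendsto_add[OF this r] show ?thesis by simp
  qed
  have "vh (cls x) = r"
    unfolding completion_abs_def
  proof (rule the_equality)
    show "\<forall>y\<in>cls x. (\<lambda>n. v (y n)) \<longlonglongrightarrow> r" using lim by blast
    show "s = r" if "\<forall>y\<in>cls x. (\<lambda>n. v (y n)) \<longlonglongrightarrow> s" for s
      using that cls_self[OF x] r LIMSEQ_unique by blast
  qed
  then show ?thesis using r by simp
qed

lemma cls_zero: "cls (\<lambda>n. \<zero>) = \<zero>\<^bsub>Rh\<^esub>"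
proof -
  interpret H: ring_hom_ring CR Rh "\<lambda>x. cls x"
    unfolding field_completion_def by (rule nullI.rcos_ring_hom_ring)
  show ?thesis
    using H.hom_zero by simp
qed

lemma cls_eq_zero_iff: "x \<in> cauchy_seqs R v \<Longrightarrow> cls x = \<zero>\<^bsub>Rh\<^esub> \<longleftrightarrow> x \<in> null_seqs R v"
  using cls_eq_iff[of x "\<lambda>n. \<zero>"] const_cauchy[of \<zero>] cauchy_closed[of x] 
  by (simp add: cls_zero a_minus_def)

lemma abs_vh: "absolute_value Rh vh"
  unfolding absolute_value_def
proof (intro conjI ballI)
  fix U assume "U \<in> carrier Rh"
  then obtain x where x: "x \<in> cauchy_seqs R v" "U = cls x" using cls_surj by blast
  note lx = vh_cls[OF x(1), folded x(2)]
  show "0 \<le> vh U"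
    by (rule LIMSEQ_le_const[OF lx]) (use cauchy_closed[OF x(1)] in auto)
  show "vh U = 0 \<longleftrightarrow> U = \<zero>\<^bsub>Rh\<^esub>"
  proof -
    have "(\<lambda>n. v (x n)) \<longlonglongrightarrow> 0 \<longleftrightarrow> vh U = 0"
      by (metis LIMSEQ_unique lx)
    then show ?thesis
      using cls_eq_zero_iff[OF x(1)] x cauchy_closed[OF x(1)] by (simp add: null_seqs_iff)
  qed
  fix W assume "W \<in> carrier Rh"
  then obtain y where y: "y \<in> cauchy_seqs R v" "W = cls y" using cls_surj by blast
  note ly = vh_cls[OF y(1), folded y(2)]
  note c = cauchy_closed[OF x(1)] cauchy_closed[OF y(1)]
  have "(\<lambda>n. v (x n) * v (y n)) \<longlonglongrightarrow> vh (U \<otimes>\<^bsub>Rh\<^esub> W)"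
    using vh_cls[OF mult_cauchy[OF x(1) y(1)]] c by (simp add: x(2) y(2) cls_mult x(1) y(1))
  then show "vh (U \<otimes>\<^bsub>Rh\<^esub> W) = vh U * vh W"
    using tendsto_mult[OF lx ly] LIMSEQ_unique by blast
  have "(\<lambda>n. v (x n \<oplus> y n)) \<longlonglongrightarrow> vh (U \<oplus>\<^bsub>Rh\<^esub> W)"
    using vh_cls[OF add_cauchy[OF x(1) y(1)]] by (simp add: x(2) y(2) cls_add x(1) y(1))
  then show "vh (U \<oplus>\<^bsub>Rh\<^esub> W) \<le> vh U + vh W"
    by (rule LIMSEQ_le[OF _ tendsto_add[OF lx ly]]) (use v_add c in auto)
qed

text \<open>A Cauchy sequence that is not null is bounded away from zero from some point on, so its termwise
inverse is again a Cauchy sequence.\<close>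

lemma completion_field: "field Rh"
proof -
  interpret H: cring Rh by (rule completion_cring)
  show ?thesis
  proof (rule H.cring_fieldI2)
    show "\<zero>\<^bsub>Rh\<^esub> \<noteq> \<one>\<^bsub>Rh\<^esub>"
      using cls_eq_zero_iff[OF const_cauchy[of \<one>]] by (auto simp: cls_one null_seqs_iff LIMSEQ_const_iff)
    fix U assume "U \<in> carrier Rh" and U0: "U \<noteq> \<zero>\<^bsub>Rh\<^esub>"
    then obtain x where x: "x \<in> cauchy_seqs R v" "U = cls x" using cls_surj by blast
    note c = cauchy_closed[OF x(1)]
    have pos: "vh U > 0"
      using abs_vh U0 \<open>U \<in> carrier Rh\<close> unfolding absolute_value_def by (metis order_le_less)
    obtain N where N: "\<forall>n\<ge>N. v (x n) > vh U / 2"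
      using order_tendstoD(1)[OF vh_cls[OF x(1)], of "vh U / 2"] pos x(2)
      unfolding eventually_sequentially by auto
    \<comment> \<open>Finitely many terms may vanish; the value \<open>\<one>\<close> there is arbitrary.\<close>
    define y where "y n = (if n \<ge> N then inv (x n) else \<one>)" for n
    have nz: "x n \<noteq> \<zero>" if "n \<ge> N" for n
      using N that pos by force
    have ic: "inv (x n) \<in> carrier R" "x n \<otimes> inv (x n) = \<one>" if "n \<ge> N" for n
      using nz[OF that] c[of n] field_Units by (auto intro: Units_inv_closed Units_r_inv)
    have yc: "y n \<in> carrier R" for n
      using ic by (simp add: y_def)
    have "y \<in> cauchy_seqs R v"
      unfolding cauchy_seqs_iff
    proof (intro conjI allI impI yc)
      fix e :: real assume "e > 0"
      define d where "d = vh U / 2"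
      have d: "d > 0" "\<forall>n\<ge>N. v (x n) > d" using pos N by (auto simp: d_def)
      have "e * d * d > 0" using d \<open>e > 0\<close> by simp
      then obtain N' where N': "\<forall>m\<ge>N'. \<forall>n\<ge>N'. v (x m \<ominus> x n) < e * d * d"
        using x(1) unfolding cauchy_seqs_iff by meson
      have "v (y m \<ominus> y n) < e" if "m \<ge> max N N'" "n \<ge> max N N'" for m n
      proof -
        have mn: "m \<ge> N" "n \<ge> N" using that by auto
        have "y m \<ominus> y n = inv (x m) \<otimes> inv (x n) \<otimes> (x n \<ominus> x m)"
        proof -
          have "inv (x m) \<otimes> inv (x n) \<otimes> (x n \<ominus> x m)
              = inv (x m) \<otimes> (x n \<otimes> inv (x n)) \<ominus> inv (x n) \<otimes> (x m \<otimes> inv (x m))"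
            using ic(1)[OF mn(1)] ic(1)[OF mn(2)] c[of m] c[of n] by algebra
          also have "\<dots> = y m \<ominus> y n"
            using ic[OF mn(1)] ic[OF mn(2)] mn by (simp add: y_def)
          finally show ?thesis ..
        qed
        then have "v (y m \<ominus> y n) = inverse (v (x m)) * inverse (v (x n)) * v (x m \<ominus> x n)"
          using ic mn c v_diff_commute[of "x n" "x m"] by (simp add: v_inv nz)
        also have "\<dots> \<le> inverse d * inverse d * v (x m \<ominus> x n)"
          using d mn c by (intro mult_mono le_imp_inverse_le) (auto intro: less_imp_le)
        also have "\<dots> < inverse d * inverse d * (e * d * d)"
          using N' that d by (intro mult_strict_left_mono) auto
        also have "\<dots> = e" using d(1) by (simp add: field_simps)
        finally show ?thesis .
      qed
      then show "\<exists>N. \<forall>m\<ge>N. \<forall>n\<ge>N. v (y m \<ominus> y n) < e" by blast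
    qed
    moreover have "cls (\<lambda>n. x n \<otimes> y n) = \<one>\<^bsub>Rh\<^esub>"
    proof -
      have "v (x n \<otimes> y n \<ominus> \<one>) = 0" if "n \<ge> N" for n
        using ic[OF that] c[of n] that by (simp only: y_def if_True a_minus_def r_neg one_closed v_zero)
      then have "(\<lambda>n. v (x n \<otimes> y n \<ominus> \<one>)) \<longlonglongrightarrow> 0"
        by (intro tendsto_eventually eventually_sequentiallyI[of N])
      then show ?thesis
        using c yc mult_cauchy[OF x(1) \<open>y \<in> cauchy_seqs R v\<close>] by (simp add: cls_one cls_eq_iff const_cauchy null_seqs_iff)
    qed
    ultimately show "\<exists>W \<in> carrier Rh. U \<otimes>\<^bsub>Rh\<^esub> W = \<one>\<^bsub>Rh\<^esub>"
      using x(1) by (intro bexI[of _ "cls y"]) (simp_all add: x(2) cls_mult)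
  qed
qed

lemma completion_valued_field: "valued_field Rh vh"
  using completion_field abs_vh by (simp add: valued_field_def valued_field_axioms_def)

lemma emb_eq: "emb a = cls (\<lambda>_. a)"
  by (simp add: completion_embed_def)

lemma emb_hom: "emb \<in> ring_hom R Rh"
  by (rule ring_hom_memI) (auto simp: emb_eq cls_add cls_mult cls_one const_cauchy)

lemma emb_closed [simp]: "a \<in> carrier R \<Longrightarrow> emb a \<in> carrier Rh"
  by (rule ring_hom_memE(1)[OF emb_hom])

lemma vh_emb [simp]: "a \<in> carrier R \<Longrightarrow> vh (emb a) = v a"
  using vh_cls[OF const_cauchy[of a]] by (simp add: emb_eq LIMSEQ_const_iff)

lemma emb_tendsto:
  assumes x: "x \<in> cauchy_seqs R v"
  shows "(\<lambda>n. vh (emb (x n) \<ominus>\<^bsub>Rh\<^esub> cls x)) \<longlonglongrightarrow> 0"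
proof (rule LIMSEQ_I)
  note c = cauchy_closed[OF x]
  interpret H: valued_field Rh vh by (rule completion_valued_field)
  fix e :: real assume "e > 0"
  then have "e / 2 > 0" by simp
  then obtain N where N: "\<forall>m\<ge>N. \<forall>n\<ge>N. v (x m \<ominus> x n) < e / 2"
    using x unfolding cauchy_seqs_iff by meson
  have "norm (vh (emb (x n) \<ominus>\<^bsub>Rh\<^esub> cls x) - 0) < e" if n: "n \<ge> N" for n
  proof -
    have "emb (x n) \<ominus>\<^bsub>Rh\<^esub> cls x = cls (\<lambda>m. x n \<ominus> x m)"
      using x c by (simp add: emb_eq cls_minus const_cauchy)
    moreover have "(\<lambda>m. v (x n \<ominus> x m)) \<longlonglongrightarrow> vh (cls (\<lambda>m. x n \<ominus> x m))"
      using vh_cls[of "\<lambda>m. x n \<ominus> x m"] add_cauchy[OF const_cauchy[of "x n"] minus_cauchy[OF x]] c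
      by (simp add: a_minus_def)
    moreover have "\<forall>m\<ge>N. v (x n \<ominus> x m) \<le> e / 2"
      using N n by (auto intro: less_imp_le)
    ultimately have "vh (emb (x n) \<ominus>\<^bsub>Rh\<^esub> cls x) \<le> e / 2"
      by (metis (no_types, lifting) LIMSEQ_le_const2)
    then show ?thesis
      using \<open>e > 0\<close> x c by simp
  qed
  then show "\<exists>N. \<forall>n\<ge>N. norm (vh (emb (x n) \<ominus>\<^bsub>Rh\<^esub> cls x) - 0) < e" by blast
qed

lemma emb_dense:
  assumes "U \<in> carrier Rh" "e > 0" obtains a where "a \<in> carrier R" "vh (U \<ominus>\<^bsub>Rh\<^esub> emb a) < e"
proof -
  interpret H: valued_field Rh vh by (rule completion_valued_field)
  obtain x where x: "x \<in> cauchy_seqs R v" "U = cls x" using cls_surj assms by blast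
  obtain n where "vh (emb (x n) \<ominus>\<^bsub>Rh\<^esub> cls x) < e"
    using order_tendstoD(2)[OF emb_tendsto[OF x(1)] assms(2)] unfolding eventually_sequentially by auto
  then show ?thesis
    using that[of "x n"] x cauchy_closed[OF x(1)] H.v_diff_commute[of "emb (x n)" U] by simp
qed

text \<open>A Cauchy sequence of classes is replaced by a sequence \<open>a\<close> in the field itself, with \<open>a n\<close> within
\<open>1/(n+1)\<close> of the \<open>n\<close>-th class; the class of \<open>a\<close> is the limit.\<close>

lemma completion_complete: "complete_subset Rh vh (carrier Rh)"
  unfolding complete_subset_def
proof (intro ballI impI)
  interpret H: valued_field Rh vh by (rule completion_valued_field)
  fix U assume U: "U \<in> cauchy_seqs Rh vh"
  have Uc: "U n \<in> carrier Rh" for n using H.cauchy_closed[OF U] .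
  have "\<exists>a. a \<in> carrier R \<and> vh (U n \<ominus>\<^bsub>Rh\<^esub> emb a) < inverse (real (Suc n))" for n
    using emb_dense[OF Uc[of n], of "inverse (real (Suc n))"] by (metis inverse_positive_iff_positive of_nat_0_less_iff zero_less_Suc)
  then obtain a where a: "a n \<in> carrier R" "vh (U n \<ominus>\<^bsub>Rh\<^esub> emb (a n)) < inverse (real (Suc n))" for n
    by metis
  have lim0: "(\<lambda>n. vh (U n \<ominus>\<^bsub>Rh\<^esub> emb (a n))) \<longlonglongrightarrow> 0"
    by (rule null_comparison[OF _ LIMSEQ_inverse_real_of_nat]) (use a Uc in \<open>auto intro: less_imp_le\<close>)
  have ac: "a \<in> cauchy_seqs R v"
    unfolding cauchy_seqs_iff
  proof (intro conjI allI impI a(1))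
    fix e :: real assume "e > 0"
    then have "e / 3 > 0" by simp
    then obtain N N' where N: "\<forall>m\<ge>N. \<forall>n\<ge>N. vh (U m \<ominus>\<^bsub>Rh\<^esub> U n) < e / 3"
      and N': "\<forall>n\<ge>N'. vh (U n \<ominus>\<^bsub>Rh\<^esub> emb (a n)) < e / 3"
      using U order_tendstoD(2)[OF lim0, of "e/3"] unfolding H.cauchy_seqs_iff eventually_sequentially by meson
    have "v (a m \<ominus> a n) < e" if "m \<ge> max N N'" "n \<ge> max N N'" for m n
    proof -
      interpret E: ring_hom_ring R Rh emb
        by (rule ring_hom_ringI2[OF ring_axioms H.ring_axioms emb_hom])
      have "v (a m \<ominus> a n) = vh (emb (a m) \<ominus>\<^bsub>Rh\<^esub> emb (a n))"
        using a(1)[of m] a(1)[of n] vh_emb[of "a m \<ominus> a n"] by (simp add: a_minus_def)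
      also have "\<dots> \<le> vh (emb (a m) \<ominus>\<^bsub>Rh\<^esub> U m) + (vh (U m \<ominus>\<^bsub>Rh\<^esub> U n) + vh (U n \<ominus>\<^bsub>Rh\<^esub> emb (a n)))"
        using H.v_diff_triangle[of "emb (a m)" "U m" "emb (a n)"] H.v_diff_triangle[of "U m" "U n" "emb (a n)"]
          a(1)[of m] a(1)[of n] Uc[of m] Uc[of n] by simp
      also have "\<dots> < e / 3 + (e / 3 + e / 3)"
        using N N' that H.v_diff_commute[of "emb (a m)" "U m"] a(1)[of m] Uc[of m]
        by (intro add_strict_mono) auto
      finally show ?thesis by simp
    qed
    then show "\<exists>N. \<forall>m\<ge>N. \<forall>n\<ge>N. v (a m \<ominus> a n) < e" by blast
  qed
  show "\<exists>l\<in>carrier Rh. (\<lambda>n. vh (U n \<ominus>\<^bsub>Rh\<^esub> l)) \<longlonglongrightarrow> 0"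
  proof (rule bexI[of _ "cls a"])
    show "(\<lambda>n. vh (U n \<ominus>\<^bsub>Rh\<^esub> cls a)) \<longlonglongrightarrow> 0"
    proof (rule null_comparison)
      show "norm (vh (U n \<ominus>\<^bsub>Rh\<^esub> cls a)) \<le> vh (U n \<ominus>\<^bsub>Rh\<^esub> emb (a n)) + vh (emb (a n) \<ominus>\<^bsub>Rh\<^esub> cls a)" for n
        using H.v_diff_triangle a(1) Uc ac by auto
      show "(\<lambda>n. vh (U n \<ominus>\<^bsub>Rh\<^esub> emb (a n)) + vh (emb (a n) \<ominus>\<^bsub>Rh\<^esub> cls a)) \<longlonglongrightarrow> 0"
        using tendsto_add[OF lim0 emb_tendsto[OF ac]] by simp
    qed
    show "cls a \<in> carrier Rh" using ac by simp
  qed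
qed

end

subsection \<open>Extending isometric homomorphisms to the completion\<close>

context valued_field
begin

lemma isometry_cauchy:
  assumes T: "valued_field T w" and f: "f \<in> ring_hom R T"
    and iso: "\<And>a. a \<in> carrier R \<Longrightarrow> w (f a) = v a" and x: "x \<in> cauchy_seqs R v"
  shows "(\<lambda>n. f (x n)) \<in> cauchy_seqs T w"
proof -
  interpret T: valued_field T w by (rule T)
  interpret F: ring_hom_ring R T f by (rule ring_hom_ringI2[OF ring_axioms T.ring_axioms f])
  have "w (f (x m) \<ominus>\<^bsub>T\<^esub> f (x n)) = v (x m \<ominus> x n)" for m n
    using iso[of "x m \<ominus> x n"] cauchy_closed[OF x] by (simp add: a_minus_def)
  then show ?thesis
    using x cauchy_closed[OF x] by (simp add: cauchy_seqs_iff T.cauchy_seqs_iff)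
qed

text \<open>By density. All compatibilities between induced maps of completions are checked on the dense subfields with this
result.\<close>

lemma isometry_unique:
  assumes T: "valued_field T w" and h: "h \<in> ring_hom Rh T" "h' \<in> ring_hom Rh T"
    and iso: "\<And>U. U \<in> carrier Rh \<Longrightarrow> w (h U) = vh U" "\<And>U. U \<in> carrier Rh \<Longrightarrow> w (h' U) = vh U"
    and eq: "\<And>a. a \<in> carrier R \<Longrightarrow> h (emb a) = h' (emb a)" and U: "U \<in> carrier Rh"
  shows "h U = h' U"
proof -
  interpret T: valued_field T w by (rule T)
  interpret H: valued_field Rh vh by (rule completion_valued_field)
  interpret h: ring_hom_ring Rh T h by (rule ring_hom_ringI2[OF H.ring_axioms T.ring_axioms h(1)])
  interpret h': ring_hom_ring Rh T h' by (rule ring_hom_ringI2[OF H.ring_axioms T.ring_axioms h(2)])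
  have "w (h U \<ominus>\<^bsub>T\<^esub> h' U) \<le> 0"
  proof (rule field_le_epsilon)
    fix e :: real assume "e > 0"
    then have "e / 2 > 0" by simp
    then obtain a where a: "a \<in> carrier R" "vh (U \<ominus>\<^bsub>Rh\<^esub> emb a) < e / 2"
      using emb_dense[OF U] by blast
    have "w (h U \<ominus>\<^bsub>T\<^esub> h' U) \<le> w (h U \<ominus>\<^bsub>T\<^esub> h (emb a)) + w (h' (emb a) \<ominus>\<^bsub>T\<^esub> h' U)"
      using T.v_diff_triangle[of "h U" "h (emb a)" "h' U"] U a(1) by (simp add: eq)
    also have "h U \<ominus>\<^bsub>T\<^esub> h (emb a) = h (U \<ominus>\<^bsub>Rh\<^esub> emb a)"
      using U a(1) by (simp add: a_minus_def)
    also have "h' (emb a) \<ominus>\<^bsub>T\<^esub> h' U = h' (emb a \<ominus>\<^bsub>Rh\<^esub> U)"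
      using U a(1) by (simp add: a_minus_def)
    also have "w (h (U \<ominus>\<^bsub>Rh\<^esub> emb a)) + w (h' (emb a \<ominus>\<^bsub>Rh\<^esub> U)) < e"
      using a U H.v_diff_commute[of "emb a" U] by (simp add: iso)
    finally show "w (h U \<ominus>\<^bsub>T\<^esub> h' U) \<le> 0 + e" by simp
  qed
  moreover have c: "h U \<in> carrier T" "h' U \<in> carrier T"
    using U by simp_all
  ultimately have "w (h U \<ominus>\<^bsub>T\<^esub> h' U) = 0"
    using T.v_nonneg[OF T.minus_closed[OF c]] by linarith
  then show ?thesis
    using T.v_eq_0_iff[OF T.minus_closed[OF c]] T.diff_eq_zero[OF c] by blast
qed

text \<open>The universal property of the completion: an isometry sends Cauchy sequences to
Cauchy sequences, which converge in the complete target.\<close>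

lemma isometry_extend:
  assumes T: "valued_field T w" and comp: "complete_subset T w (carrier T)" and f: "f \<in> ring_hom R T"
    and iso: "\<And>a. a \<in> carrier R \<Longrightarrow> w (f a) = v a"
  obtains h where "h \<in> ring_hom Rh T" "\<And>U. U \<in> carrier Rh \<Longrightarrow> w (h U) = vh U"
    "\<And>a. a \<in> carrier R \<Longrightarrow> h (emb a) = f a"
proof -
  interpret T: valued_field T w by (rule T)
  interpret F: ring_hom_ring R T f by (rule ring_hom_ringI2[OF ring_axioms T.ring_axioms f])
  define is_lim where "is_lim x l \<longleftrightarrow> l \<in> carrier T \<and> (\<lambda>n. w (f (x n) \<ominus>\<^bsub>T\<^esub> l)) \<longlonglongrightarrow> 0" for x l
  define h where "h U = (SOME l. \<exists>x \<in> cauchy_seqs R v. U = cls x \<and> is_lim x l)" for U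
  have lim: "is_lim x (h (cls x))" if x: "x \<in> cauchy_seqs R v" for x
  proof -
    have "\<exists>l \<in> carrier T. (\<lambda>n. w (f (x n) \<ominus>\<^bsub>T\<^esub> l)) \<longlonglongrightarrow> 0"
      using comp isometry_cauchy[OF T f iso x] cauchy_closed[OF x] unfolding complete_subset_def by auto
    then have "\<exists>l. \<exists>y \<in> cauchy_seqs R v. cls x = cls y \<and> is_lim y l"
      using x by (auto simp: is_lim_def)
    from someI_ex[OF this] obtain y where y: "y \<in> cauchy_seqs R v" "cls x = cls y" "is_lim y (h (cls x))"
      unfolding h_def by auto
    let ?l = "h (cls x)"
    have l: "?l \<in> carrier T" and yl: "(\<lambda>n. w (f (y n) \<ominus>\<^bsub>T\<^esub> ?l)) \<longlonglongrightarrow> 0"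
      using y(3) by (auto simp: is_lim_def)
    have "(\<lambda>n. v (x n \<ominus> y n)) \<longlonglongrightarrow> 0"
      using y(2) cls_eq_iff[OF x y(1)] by (simp add: null_seqs_iff)
    then have sum: "(\<lambda>n. v (x n \<ominus> y n) + w (f (y n) \<ominus>\<^bsub>T\<^esub> ?l)) \<longlonglongrightarrow> 0"
      using tendsto_add[OF _ yl, of "\<lambda>n. v (x n \<ominus> y n)" 0] by simp
    have "(\<lambda>n. w (f (x n) \<ominus>\<^bsub>T\<^esub> ?l)) \<longlonglongrightarrow> 0"
    proof (rule null_comparison[OF _ sum])
      fix n
      have c: "x n \<in> carrier R" "y n \<in> carrier R"
        using cauchy_closed x y(1) by auto
      have "w (f (x n) \<ominus>\<^bsub>T\<^esub> f (y n)) = v (x n \<ominus> y n)"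
        using iso[of "x n \<ominus> y n"] c by (simp add: a_minus_def)
      then show "norm (w (f (x n) \<ominus>\<^bsub>T\<^esub> ?l)) \<le> v (x n \<ominus> y n) + w (f (y n) \<ominus>\<^bsub>T\<^esub> ?l)"
        using T.v_diff_triangle[of "f (x n)" "f (y n)" ?l] c l by simp
    qed
    then show ?thesis using l by (simp add: is_lim_def)
  qed
  have lim': "h (cls x) \<in> carrier T" "(\<lambda>n. w (f (x n) \<ominus>\<^bsub>T\<^esub> h (cls x))) \<longlonglongrightarrow> 0"
    if "x \<in> cauchy_seqs R v" for x
    using lim[OF that] by (auto simp: is_lim_def)
  have eqI: "h (cls x) = l" if "x \<in> cauchy_seqs R v" "l \<in> carrier T" "(\<lambda>n. w (f (x n) \<ominus>\<^bsub>T\<^esub> l)) \<longlonglongrightarrow> 0" for x l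
    by (rule T.limit_unique[of "\<lambda>n. f (x n)"]) (use that lim' cauchy_closed[OF that(1)] in auto)
  have const: "h (emb a) = f a" if "a \<in> carrier R" for a
    unfolding emb_eq by (rule eqI) (use that in \<open>auto simp: const_cauchy a_minus_def T.r_neg\<close>)
  have "h \<in> ring_hom Rh T"
  proof (rule ring_hom_memI)
    show "h U \<in> carrier T" if "U \<in> carrier Rh" for U
      using cls_surj[OF that] lim' by auto
    show "h \<one>\<^bsub>Rh\<^esub> = \<one>\<^bsub>T\<^esub>"
      using const[of \<one>] by (simp add: cls_one emb_eq)
    fix U W assume "U \<in> carrier Rh" "W \<in> carrier Rh"
    then obtain x y where x: "x \<in> cauchy_seqs R v" "U = cls x" and y: "y \<in> cauchy_seqs R v" "W = cls y"
      using cls_surj by metis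
    note c = cauchy_closed[OF x(1)] cauchy_closed[OF y(1)]
    have "h (cls (\<lambda>n. x n \<otimes> y n)) = h (cls x) \<otimes>\<^bsub>T\<^esub> h (cls y)"
    proof (rule eqI[OF mult_cauchy[OF x(1) y(1)]])
      show "(\<lambda>n. w (f (x n \<otimes> y n) \<ominus>\<^bsub>T\<^esub> h (cls x) \<otimes>\<^bsub>T\<^esub> h (cls y))) \<longlonglongrightarrow> 0"
        using T.tendsto_mult_seq[of "\<lambda>n. f (x n)" "\<lambda>n. f (y n)" "h (cls x)" "h (cls y)"] lim' x(1) y(1) c by simp
    qed (use lim' x(1) y(1) in simp)
    then show "h (U \<otimes>\<^bsub>Rh\<^esub> W) = h U \<otimes>\<^bsub>T\<^esub> h W"
      using x y by (simp add: cls_mult)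
    have "h (cls (\<lambda>n. x n \<oplus> y n)) = h (cls x) \<oplus>\<^bsub>T\<^esub> h (cls y)"
    proof (rule eqI[OF add_cauchy[OF x(1) y(1)]])
      show "(\<lambda>n. w (f (x n \<oplus> y n) \<ominus>\<^bsub>T\<^esub> (h (cls x) \<oplus>\<^bsub>T\<^esub> h (cls y)))) \<longlonglongrightarrow> 0"
        using T.tendsto_add_seq[of "\<lambda>n. f (x n)" "\<lambda>n. f (y n)" "h (cls x)" "h (cls y)"] lim' x(1) y(1) c by simp
    qed (use lim' x(1) y(1) in simp)
    then show "h (U \<oplus>\<^bsub>Rh\<^esub> W) = h U \<oplus>\<^bsub>T\<^esub> h W"
      using x y by (simp add: cls_add)
  qed
  moreover have "w (h U) = vh U" if U: "U \<in> carrier Rh" for U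
  proof -
    obtain x where x: "x \<in> cauchy_seqs R v" "U = cls x" using cls_surj[OF U] by blast
    have "(\<lambda>n. w (f (x n))) \<longlonglongrightarrow> w (h U)"
      using T.tendsto_v[of "\<lambda>n. f (x n)" "h U"] lim'[OF x(1)] x cauchy_closed[OF x(1)] by simp
    then have "(\<lambda>n. v (x n)) \<longlonglongrightarrow> w (h U)"
      using iso cauchy_closed[OF x(1)] by simp
    then show ?thesis
      using vh_cls[OF x(1)] x(2) LIMSEQ_unique by blast
  qed
  ultimately show ?thesis using const that by blast
qed

end

text \<open>Existence and uniqueness of the function that \<open>completion_map\<close> describes are \<open>isometry_extend\<close> and
\<open>isometry_unique\<close>.\<close>

lemma completion_map_isometry:
  assumes "valued_field R v" "valued_field S w" "f \<in> ring_hom R S"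
    and iso: "\<And>a. a \<in> carrier R \<Longrightarrow> w (f a) = v a"
  shows "completion_map R v S w f \<in> ring_hom (field_completion R v) (field_completion S w)" (is ?A)
    and "\<And>U. U \<in> carrier (field_completion R v) \<Longrightarrow>
      completion_abs S w (completion_map R v S w f U) = completion_abs R v U" (is "\<And>U. _ \<Longrightarrow> ?B U")
    and "\<And>a. a \<in> carrier R \<Longrightarrow>
      completion_map R v S w f (completion_embed R v a) = completion_embed S w (f a)" (is "\<And>a. _ \<Longrightarrow> ?C a")
proof -
  interpret R: valued_field R v by fact
  interpret S: valued_field S w by fact
  note fc = ring_hom_memE(1)[OF assms(3)]
  let ?P = "\<lambda>h. h \<in> extensional (carrier R.Rh) \<and> h \<in> ring_hom R.Rh S.Rh \<and>
    (\<forall>U \<in> carrier R.Rh. S.vh (h U) = R.vh U) \<and> (\<forall>a \<in> carrier R. h (R.emb a) = S.emb (f a))"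
  have "(S.emb \<circ> f) \<in> ring_hom R S.Rh"
    using ring_hom_trans[OF assms(3) S.emb_hom] .
  then obtain h where h: "h \<in> ring_hom R.Rh S.Rh" "\<And>U. U \<in> carrier R.Rh \<Longrightarrow> S.vh (h U) = R.vh U"
    "\<And>a. a \<in> carrier R \<Longrightarrow> h (R.emb a) = S.emb (f a)"
    using R.isometry_extend[OF S.completion_valued_field S.completion_complete, of "S.emb \<circ> f"] fc iso by auto
  interpret Rh: field R.Rh by (rule R.completion_field)
  have "?P (restrict h (carrier R.Rh))"
  proof (intro conjI)
    show "restrict h (carrier R.Rh) \<in> ring_hom R.Rh S.Rh"
      by (rule ring_hom_memI) (use ring_hom_memE[OF h(1)] in auto)
  qed (use h in auto)
  moreover have "g = g'" if "?P g" "?P g'" for g g'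
  proof (rule extensionalityI[of g "carrier R.Rh" g'])
    show "g \<in> extensional (carrier R.Rh)" "g' \<in> extensional (carrier R.Rh)"
      using that by blast+
    have hom: "g \<in> ring_hom R.Rh S.Rh" "g' \<in> ring_hom R.Rh S.Rh"
      and abs: "\<And>U. U \<in> carrier R.Rh \<Longrightarrow> S.vh (g U) = R.vh U" "\<And>U. U \<in> carrier R.Rh \<Longrightarrow> S.vh (g' U) = R.vh U"
      and emb: "\<And>a. a \<in> carrier R \<Longrightarrow> g (R.emb a) = g' (R.emb a)"
      using that by simp_all
    show "g U = g' U" if "U \<in> carrier R.Rh" for U
      by (rule R.isometry_unique[OF S.completion_valued_field hom abs emb that])
  qed
  ultimately have "\<exists>!h. ?P h" by blast
  from theI'[OF this] have "?P (completion_map R v S w f)"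
    unfolding completion_map_def .
  then show ?A "\<And>U. U \<in> carrier R.Rh \<Longrightarrow> ?B U" "\<And>a. a \<in> carrier R \<Longrightarrow> ?C a"
    by blast+
qed


section \<open>Uniqueness of extensions of a complete absolute value\<close>

context valued_field
begin

text \<open>Equivalence of norms on a finite-dimensional space over a complete field, for the norm \<open>v\<close> and any seminorm
\<open>N\<close>. The induction adds a vector \<open>u\<close> to a space \<open>E\<close>. As \<open>E\<close> is complete, it is closed, so \<open>u\<close> has a positive
distance \<open>\<delta>\<close> from \<open>E\<close>. Therefore the coefficient \<open>c\<close> of \<open>c u + y\<close> satisfies \<open>v c \<le> v (c u + y) / \<delta>\<close>, which
both bounds \<open>N\<close> and shows that Cauchy sequences in the larger space are Cauchy in each coordinate. The two
conclusions are proved together because both depend on \<open>\<delta>\<close>, which comes from the completeness of \<open>E\<close>.\<close>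

lemma finite_dimension_bounded:
  assumes k: "subfield k R" and comp: "complete_subset R v k" and dim: "dimension n k V"
  shows "complete_subset R v V \<and>
    (\<forall>N::'a \<Rightarrow> real. (\<forall>x\<in>V. \<forall>y\<in>V. N (x \<oplus> y) \<le> N x + N y) \<and> (\<forall>c\<in>k. \<forall>x\<in>V. N (c \<otimes> x) \<le> v c * N x)
      \<longrightarrow> (\<exists>C. \<forall>x\<in>V. N x \<le> C * v x))"
  using dim comp k
proof (induction rule: dimension.induct)
  case (zero_dim k)
  have "complete_subset R v {\<zero>}"
    unfolding complete_subset_def
  proof (intro ballI impI bexI[of _ \<zero>])
    fix x assume "x \<in> cauchy_seqs R v" "range x \<subseteq> {\<zero>}"
    then have "x n = \<zero>" for n by (auto simp: image_subset_iff)
    then show "(\<lambda>n. v (x n \<ominus> \<zero>)) \<longlonglongrightarrow> 0" by (simp add: a_minus_def)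
  qed simp
  moreover have "\<exists>C. \<forall>x\<in>{\<zero>}. N x \<le> C * v x"
    if N: "\<forall>c\<in>k. \<forall>x\<in>{\<zero>}. N (c \<otimes> x) \<le> v c * N x" for N :: "'a \<Rightarrow> real"
    using N[rule_format, of \<zero> \<zero>] subringE(2)[OF subfieldE(1)[OF zero_dim(2)]] by auto
  ultimately show ?case by blast
next
  case (Suc_dim u E n k)
  note u = Suc_dim(1,2) and k = Suc_dim(6) and compk = Suc_dim(5) and dimE = Suc_dim(3)
  note kr = subringE[OF subfieldE(1)[OF k]]
  note sub = space_subgroup_props[OF k dimE]
  have compE: "complete_subset R v E"
    using Suc_dim(4)[OF compk k] by blast
  have kc: "c \<in> carrier R" if "c \<in> k" for c using that kr(1) by auto
  have Ec: "y \<in> carrier R" if "y \<in> E" for y using that sub(1) by auto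
  \<comment> \<open>Otherwise elements of \<open>E\<close> converge to \<open>\<ominus> u\<close>, which then lies in \<open>E\<close>.\<close>
  have "\<exists>\<delta>>0. \<forall>y\<in>E. \<delta> \<le> v (u \<oplus> y)"
  proof (rule ccontr)
    assume "\<not> ?thesis"
    then have "\<exists>y\<in>E. v (u \<oplus> y) < inverse (real (Suc n))" for n
      by (meson not_le inverse_positive_iff_positive of_nat_0_less_iff zero_less_Suc)
    then obtain y where y: "y n \<in> E" "v (u \<oplus> y n) < inverse (real (Suc n))" for n
      by metis
    have eq: "y n \<ominus> \<ominus> u = u \<oplus> y n" for n
      using u(1) Ec[OF y(1)[of n]] by (simp add: a_minus_def a_comm)
    have lim: "(\<lambda>n. v (y n \<ominus> \<ominus> u)) \<longlonglongrightarrow> 0"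
      unfolding eq by (rule null_comparison[OF _ LIMSEQ_inverse_real_of_nat]) (use y u(1) Ec in \<open>auto intro: less_imp_le\<close>)
    have yc: "\<forall>n. y n \<in> carrier R" using y(1) Ec by auto
    have "y \<in> cauchy_seqs R v"
      by (rule convergent_imp_cauchy[OF yc _ lim]) (use u(1) in simp)
    then obtain l where l: "l \<in> E" "(\<lambda>n. v (y n \<ominus> l)) \<longlonglongrightarrow> 0"
      using compE y(1) unfolding complete_subset_def by (metis image_subsetI)
    have "l = \<ominus> u"
      by (rule limit_unique[OF yc _ _ l(2) lim]) (use l(1) Ec u(1) in auto)
    then have "u = \<ominus> l" using u(1) by simp
    then show False using sub(4)[OF l(1)] u(2) by simp
  qed
  then obtain \<delta> where \<delta>: "\<delta> > 0" "\<And>y. y \<in> E \<Longrightarrow> \<delta> \<le> v (u \<oplus> y)" by blast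
  have low: "v c * \<delta> \<le> v (c \<otimes> u \<oplus> y)" if "c \<in> k" "y \<in> E" for c y
  proof (cases "c = \<zero>")
    case True
    then show ?thesis using u(1) Ec[OF that(2)] by simp
  next
    case False
    then have c: "inv c \<in> k" "c \<otimes> inv c = \<one>"
      using subfield_m_inv[OF k, of c] that by auto
    have "c \<otimes> u \<oplus> y = c \<otimes> u \<oplus> (c \<otimes> inv c) \<otimes> y"
      using c(2) Ec[OF that(2)] by simp
    also have "\<dots> = c \<otimes> (u \<oplus> inv c \<otimes> y)"
      using kc[OF that(1)] kc[OF c(1)] Ec[OF that(2)] u(1) by algebra
    finally have "v (c \<otimes> u \<oplus> y) = v c * v (u \<oplus> inv c \<otimes> y)"
      using kc[OF that(1)] kc[OF c(1)] Ec[OF that(2)] u(1) by simp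
    then show ?thesis
      using \<delta>(2)[OF sub(5)[OF c(1) that(2)]] kc[OF that(1)] by (simp add: mult_left_mono)
  qed
  have coord: "\<exists>c y. c \<in> k \<and> y \<in> E \<and> z = c \<otimes> u \<oplus> y" if "z \<in> line_extension k u E" for z
    using that by (auto simp: line_extension_mem_iff)
  have "complete_subset R v (line_extension k u E)"
    unfolding complete_subset_def
  proof (intro ballI impI)
    fix z assume z: "z \<in> cauchy_seqs R v" "range z \<subseteq> line_extension k u E"
    then have "\<exists>c y. c \<in> k \<and> y \<in> E \<and> z n = c \<otimes> u \<oplus> y" for n
      using coord by auto
    then obtain c y where cy: "c n \<in> k" "y n \<in> E" "z n = c n \<otimes> u \<oplus> y n" for n
      by metis
    note cc = kc[OF cy(1)] and yc = Ec[OF cy(2)]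
    have c: "c \<in> cauchy_seqs R v"
      unfolding cauchy_seqs_iff
    proof (intro conjI allI impI cc)
      fix e :: real assume "e > 0"
      then have "e * \<delta> > 0" using \<delta>(1) by simp
      then obtain N where N: "\<forall>m\<ge>N. \<forall>n\<ge>N. v (z m \<ominus> z n) < e * \<delta>"
        using z(1) unfolding cauchy_seqs_iff by meson
      have "v (c m \<ominus> c n) < e" if "m \<ge> N" "n \<ge> N" for m n
      proof -
        have "z m \<ominus> z n = (c m \<ominus> c n) \<otimes> u \<oplus> (y m \<ominus> y n)"
          unfolding cy(3) using cc[of m] cc[of n] yc[of m] yc[of n] u(1) by algebra
        then have "v (c m \<ominus> c n) * \<delta> \<le> v (z m \<ominus> z n)"
          using low[of "c m \<ominus> c n" "y m \<ominus> y n"] cy(1)[of m] cy(1)[of n] cy(2)[of m] cy(2)[of n] kr(5,7) sub(3,4)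
          by (simp add: a_minus_def)
        also have "\<dots> < e * \<delta>" using N that by blast
        finally show ?thesis using \<delta>(1) by simp
      qed
      then show "\<exists>N. \<forall>m\<ge>N. \<forall>n\<ge>N. v (c m \<ominus> c n) < e" by blast
    qed
    have ceq: "y = (\<lambda>n. z n \<oplus> \<ominus> (c n \<otimes> u))"
    proof
      fix n show "y n = z n \<oplus> \<ominus> (c n \<otimes> u)"
        unfolding cy(3) using cc[of n] yc[of n] u(1) by algebra
    qed
    have "(\<lambda>n. c n \<otimes> u) \<in> cauchy_seqs R v"
      using mult_cauchy[OF c const_cauchy[OF u(1)]] .
    then have y: "y \<in> cauchy_seqs R v"
      unfolding ceq by (intro add_cauchy[OF z(1)] minus_cauchy)
    obtain a where a: "a \<in> k" "(\<lambda>n. v (c n \<ominus> a)) \<longlonglongrightarrow> 0"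
      using compk c cy(1) unfolding complete_subset_def by (metis image_subsetI)
    obtain b where b: "b \<in> E" "(\<lambda>n. v (y n \<ominus> b)) \<longlonglongrightarrow> 0"
      using compE y cy(2) unfolding complete_subset_def by (metis image_subsetI)
    have u0: "(\<lambda>n. v (u \<ominus> u)) \<longlonglongrightarrow> 0" using u(1) by (simp add: a_minus_def r_neg)
    have "(\<lambda>n. v (c n \<otimes> u \<ominus> a \<otimes> u)) \<longlonglongrightarrow> 0"
      using tendsto_mult_seq[of c "\<lambda>_. u" a u] cc kc[OF a(1)] u(1) a(2) u0 by simp
    then have "(\<lambda>n. v (z n \<ominus> (a \<otimes> u \<oplus> b))) \<longlonglongrightarrow> 0"
      unfolding cy(3) using tendsto_add_seq[of "\<lambda>n. c n \<otimes> u" y "a \<otimes> u" b] cc kc[OF a(1)] u(1) yc Ec[OF b(1)] b(2) by simp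
    then show "\<exists>l\<in>line_extension k u E. (\<lambda>n. v (z n \<ominus> l)) \<longlonglongrightarrow> 0"
      using a(1) b(1) by (intro bexI[of _ "a \<otimes> u \<oplus> b"]) (auto simp: line_extension_mem_iff)
  qed
  moreover have "\<exists>C. \<forall>z\<in>line_extension k u E. N z \<le> C * v z"
    if add: "\<forall>x\<in>line_extension k u E. \<forall>y\<in>line_extension k u E. N (x \<oplus> y) \<le> N x + N y"
      and smult: "\<forall>c\<in>k. \<forall>x\<in>line_extension k u E. N (c \<otimes> x) \<le> v c * N x" for N :: "'a \<Rightarrow> real"
  proof -
    have E_sub: "y \<in> line_extension k u E" if "y \<in> E" for y
    proof -
      have "y = \<zero> \<otimes> u \<oplus> y" using Ec[OF that] u(1) by simp
      then show ?thesis unfolding line_extension_mem_iff using kr(2) that by blast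
    qed
    have u_mem: "u \<in> line_extension k u E"
    proof -
      have "u = \<one> \<otimes> u \<oplus> \<zero>" using u(1) by simp
      then show ?thesis unfolding line_extension_mem_iff using kr(3) sub(2) by blast
    qed
    have cu_mem: "c \<otimes> u \<in> line_extension k u E" if "c \<in> k" for c
    proof -
      have "c \<otimes> u = c \<otimes> u \<oplus> \<zero>" using u(1) kc[OF that] by simp
      then show ?thesis unfolding line_extension_mem_iff using that sub(2) by blast
    qed
    obtain C where C: "\<And>y. y \<in> E \<Longrightarrow> N y \<le> C * v y"
      using Suc_dim(4)[OF compk k] add smult E_sub by metis
    have "N z \<le> (\<bar>N u\<bar> / \<delta> + \<bar>C\<bar> * (1 + v u / \<delta>)) * v z" if z: "z \<in> line_extension k u E" for z
    proof -
      obtain c y where cy: "c \<in> k" "y \<in> E" "z = c \<otimes> u \<oplus> y"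
        using coord[OF z] by blast
      have cb: "v c \<le> v z / \<delta>"
        using low[OF cy(1,2)] \<delta>(1) by (simp add: cy(3) field_simps)
      have "y = z \<ominus> c \<otimes> u"
        unfolding cy(3) using kc[OF cy(1)] Ec[OF cy(2)] u(1) by algebra
      then have "v y \<le> v z + v c * v u"
        using v_diff[of z "c \<otimes> u"] kc[OF cy(1)] Ec[OF cy(2)] u(1) by (simp add: cy(3))
      also have "\<dots> \<le> v z + v z / \<delta> * v u"
        using cb u(1) by (intro add_left_mono mult_right_mono) auto
      finally have yb: "v y \<le> v z + v z / \<delta> * v u" .
      have "N z \<le> v c * N u + C * v y"
        using add[rule_format, OF cu_mem[OF cy(1)] E_sub[OF cy(2)]] smult[rule_format, OF cy(1) u_mem] C[OF cy(2)]
        by (simp add: cy(3))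
      also have "\<dots> \<le> v c * \<bar>N u\<bar> + \<bar>C\<bar> * v y"
        using kc[OF cy(1)] Ec[OF cy(2)] by (intro add_mono mult_left_mono mult_right_mono) auto
      also have "\<dots> \<le> v z / \<delta> * \<bar>N u\<bar> + \<bar>C\<bar> * (v z + v z / \<delta> * v u)"
        using cb yb by (intro add_mono mult_right_mono mult_left_mono) auto
      also have "\<dots> = (\<bar>N u\<bar> / \<delta> + \<bar>C\<bar> * (1 + v u / \<delta>)) * v z"
        by (simp add: algebra_simps)
      finally show ?thesis .
    qed
    then show ?thesis by blast
  qed
  ultimately show ?case by blast
qed

text \<open>The absolute value \<open>w\<close> is a seminorm on the finite-dimensional space \<open>k(x)\<close>, hence \<open>w \<le> C v\<close> there. Applied to
the powers of \<open>x\<close> this gives \<open>w x ^ m \<le> C * v x ^ m\<close> for all \<open>m\<close>, and \<open>m\<close>-th roots remove the constant.\<close>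

lemma algebraic_abs_le:
  assumes k: "subfield k R" and comp: "complete_subset R v k" and w: "absolute_value R w"
    and eq: "\<And>c. c \<in> k \<Longrightarrow> w c = v c" and x: "x \<in> carrier R" "(algebraic over k) x"
  shows "w x \<le> v x"
proof -
  interpret W: valued_field R w
    using w by unfold_locales
  let ?V = "simple_extension k x"
  have subr: "subring ?V R"
    by (rule simple_extension_is_subring[OF subfieldE(1)[OF k] x(1)])
  have Vc: "y \<in> carrier R" if "y \<in> ?V" for y
    using subringE(1)[OF subr] that by auto
  have "x [^] (m::nat) \<in> ?V" for m
    using subringE(3,6)[OF subr] simple_extension_mem[OF subfieldE(1)[OF k] x(1)] by (induction m) auto
  moreover obtain C where C: "\<And>y. y \<in> ?V \<Longrightarrow> w y \<le> C * v y"
  proof -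
    have "\<forall>y\<in>?V. \<forall>z\<in>?V. w (y \<oplus> z) \<le> w y + w z"
      using Vc W.v_add by simp
    moreover have "\<forall>c\<in>k. \<forall>y\<in>?V. w (c \<otimes> y) \<le> v c * w y"
      using Vc subsetD[OF subfieldE(3)[OF k]] eq by simp
    ultimately show ?thesis
      using finite_dimension_bounded[OF k comp dimension_simple_extension[OF k x]] that by blast
  qed
  ultimately have pow: "w x ^ m \<le> C * v x ^ m" for m
    using C[of "x [^] m"] x(1) by simp
  show ?thesis
  proof (rule ccontr)
    assume gt: "\<not> w x \<le> v x"
    then have "x \<noteq> \<zero>" by auto
    then have pos: "v x > 0" using x(1) v_pos by simp
    then have "1 < w x / v x" using gt by simp
    then obtain m where "C < (w x / v x) ^ m"
      using real_arch_pow by blast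
    then show False
      using pow[of m] pos by (simp add: power_divide field_simps)
  qed
qed

lemma algebraic_abs_unique:
  assumes k: "subfield k R" and comp: "complete_subset R v k" and w: "absolute_value R w"
    and eq: "\<And>c. c \<in> k \<Longrightarrow> w c = v c" and x: "x \<in> carrier R" "(algebraic over k) x"
  shows "w x = v x"
proof -
  interpret W: valued_field R w
    using w by unfold_locales
  note kr = subringE[OF subfieldE(1)[OF k]]
  have "complete_subset R w k"
    unfolding complete_subset_def
  proof (intro ballI impI)
    fix x assume x: "x \<in> cauchy_seqs R w" "range x \<subseteq> k"
    have d: "w (x m \<ominus> b) = v (x m \<ominus> b)" if "b \<in> k" for m b
      using x(2) that kr(5,7) by (intro eq) (auto simp: a_minus_def)
    then have "x \<in> cauchy_seqs R v"
      using x by (simp add: cauchy_seqs_iff W.cauchy_seqs_iff image_subset_iff)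
    then obtain a where "a \<in> k" "(\<lambda>n. v (x n \<ominus> a)) \<longlonglongrightarrow> 0"
      using comp x(2) unfolding complete_subset_def by blast
    then show "\<exists>a\<in>k. (\<lambda>n. w (x n \<ominus> a)) \<longlonglongrightarrow> 0"
      using d by auto
  qed
  then show ?thesis
    using algebraic_abs_le[OF k comp w eq x] W.algebraic_abs_le[OF k _ abs_v eq[symmetric] x] by simp
qed

end

section \<open>Existence of extensions of an absolute value\<close>

text \<open>Submultiplicative seminorms on a ring, normalised at \<open>\<one>\<close>. On a field, the absolute values
are exactly the minimal ones; what is needed is that minimal ones are absolute values.\<close>

definition alg_seminorm :: "('a, 'x) ring_scheme \<Rightarrow> ('a \<Rightarrow> real) \<Rightarrow> bool"
  where "alg_seminorm R p \<longleftrightarrow> p \<one>\<^bsub>R\<^esub> = 1 \<and> p \<zero>\<^bsub>R\<^esub> = 0 \<and> (\<forall>x \<in> carrier R. 0 \<le> p x) \<and>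
    (\<forall>x \<in> carrier R. \<forall>y \<in> carrier R. p (x \<otimes>\<^bsub>R\<^esub> y) \<le> p x * p y) \<and>
    (\<forall>x \<in> carrier R. \<forall>y \<in> carrier R. p (x \<oplus>\<^bsub>R\<^esub> y) \<le> p x + p y)"

lemma le_Inf_mult:
  fixes T :: "real set"
  assumes "T \<noteq> {}" "\<And>t. t \<in> T \<Longrightarrow> a \<le> t * c" "0 \<le> c" shows "a \<le> Inf T * c"
proof (cases "c = 0")
  case True
  then show ?thesis using assms by auto
next
  case False
  then have "a / c \<le> Inf T"
    using assms by (intro cInf_greatest) (auto simp: divide_le_eq)
  then show ?thesis
    using False assms(3) by (simp add: divide_le_eq)
qed

lemma le_Inf_add:
  fixes T :: "real set"
  assumes "T \<noteq> {}" "\<And>t. t \<in> T \<Longrightarrow> a \<le> t + c" shows "a \<le> Inf T + c"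
proof -
  have "a - c \<le> Inf T"
    using assms by (intro cInf_greatest) (auto simp: diff_le_eq)
  then show ?thesis by simp
qed

context ring
begin

text \<open>All seminorms below are built from a relation \<open>G y t\<close> (``\<open>t\<close> is an admissible bound for \<open>y\<close>'') that is compatible with
sums and products; the seminorm of \<open>y\<close> is its best bound.\<close>

lemma gauge_seminorm:
  fixes G :: "'a \<Rightarrow> real \<Rightarrow> bool"
  assumes nonneg: "\<And>y t. G y t \<Longrightarrow> 0 \<le> t" and ex: "\<And>y. y \<in> carrier R \<Longrightarrow> \<exists>t. G y t"
    and add: "\<And>y z t u. \<lbrakk>y \<in> carrier R; z \<in> carrier R; G y t; G z u\<rbrakk> \<Longrightarrow> G (y \<oplus> z) (t + u)"
    and mult: "\<And>y z t u. \<lbrakk>y \<in> carrier R; z \<in> carrier R; G y t; G z u\<rbrakk> \<Longrightarrow> G (y \<otimes> z) (t * u)"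
    and zero: "G \<zero> 0" and one: "G \<one> 1" "\<And>t. G \<one> t \<Longrightarrow> 1 \<le> t"
  shows "alg_seminorm R (\<lambda>y. Inf {t. G y t})" "\<And>y t. G y t \<Longrightarrow> Inf {t. G y t} \<le> t"
proof -
  have bdd: "bdd_below {t. G y t}" for y
    using nonneg by (intro bdd_belowI[of _ 0]) auto
  show le: "Inf {t. G y t} \<le> t" if "G y t" for y t
    using that bdd by (intro cInf_lower) auto
  have nn: "0 \<le> Inf {t. G y t}" if "y \<in> carrier R" for y
    using ex[OF that] nonneg by (intro cInf_greatest) auto
  show "alg_seminorm R (\<lambda>y. Inf {t. G y t})"
    unfolding alg_seminorm_def
  proof (intro conjI ballI)
    show "Inf {t. G \<one> t} = 1"
      using le[OF one(1)] one by (intro antisym cInf_greatest) auto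
    show "Inf {t. G \<zero> t} = 0"
      using le[OF zero] nn[OF zero_closed] by simp
    fix y assume y: "y \<in> carrier R"
    show "0 \<le> Inf {t. G y t}" by (rule nn[OF y])
    fix z assume z: "z \<in> carrier R"
    have 1: "Inf {t. G (y \<otimes> z) t} \<le> t * u" if "G y t" "G z u" for t u
      using le mult[OF y z that] by blast
    have "Inf {t. G (y \<otimes> z) t} \<le> t * Inf {u. G z u}" if "G y t" for t
      using le_Inf_mult[of "{u. G z u}" "Inf {t. G (y \<otimes> z) t}" t] 1[OF that] ex[OF z] nonneg[OF that]
      by (simp add: mult.commute)
    then show "Inf {t. G (y \<otimes> z) t} \<le> Inf {t. G y t} * Inf {t. G z t}"
      using ex[OF y] nn[OF z] by (intro le_Inf_mult) auto
    have 2: "Inf {t. G (y \<oplus> z) t} \<le> t + u" if "G y t" "G z u" for t u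
      using le add[OF y z that] by blast
    have "Inf {t. G (y \<oplus> z) t} \<le> t + Inf {u. G z u}" if "G y t" for t
      using le_Inf_add[of "{u. G z u}" "Inf {t. G (y \<oplus> z) t}" t] 2[OF that] ex[OF z]
      by (simp add: add.commute)
    then show "Inf {t. G (y \<oplus> z) t} \<le> Inf {t. G y t} + Inf {t. G z t}"
      using ex[OF y] by (intro le_Inf_add) auto
  qed
qed

end

text \<open>If each late term is at most \<open>t < 1\<close> times a bound of the window of the \<open>d + 1\<close> terms that ends at it, then no
term after the first \<open>d + 1\<close> can be a new maximum.\<close>

lemma window_bounded:
  fixes s :: "nat \<Rightarrow> real"
  assumes t: "0 \<le> t" "t < 1" and nn: "\<And>n. 0 \<le> s n"
    and win: "\<And>C n. \<lbrakk>n \<ge> d; \<forall>m \<in> {n - d..n}. s m \<le> C\<rbrakk> \<Longrightarrow> s n \<le> t * C"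
  shows "\<exists>C. \<forall>n. s n \<le> C"
proof -
  define C where "C = Max (s ` {..d})"
  have C0: "0 \<le> C"
    unfolding C_def by (intro order_trans[OF nn[of 0] Max_ge]) auto
  have "s n \<le> C" for n
  proof (induction n rule: less_induct)
    case (less n)
    show ?case
    proof (cases "n \<le> d")
      case True
      then show ?thesis unfolding C_def by (intro Max_ge) auto
    next
      case False
      show ?thesis
      proof (rule ccontr)
        assume gt: "\<not> s n \<le> C"
        have "s n \<le> t * s n"
        proof (rule win)
          have "s m \<le> s n" if "m \<le> n" for m
            using less[of m] gt that by (cases "m = n") auto
          then show "\<forall>m\<in>{n - d..n}. s m \<le> s n"
            by auto
        qed (use False in simp)
        moreover have "t * s n < 1 * s n"
          using t gt C0 by (intro mult_strict_right_mono) auto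
        ultimately show False by simp
      qed
    qed
  qed
  then show ?thesis by blast
qed

locale minimal_seminorm = field R for R (structure) +
  fixes p :: "'a \<Rightarrow> real"
  assumes sn: "alg_seminorm R p"
    and minimal: "\<And>q. \<lbrakk>alg_seminorm R q; \<forall>x \<in> carrier R. q x \<le> p x\<rbrakk> \<Longrightarrow> \<forall>x \<in> carrier R. q x = p x"
begin

lemma p_one: "p \<one> = 1"
  and p_zero: "p \<zero> = 0"
  and p_nonneg: "x \<in> carrier R \<Longrightarrow> 0 \<le> p x"
  and p_mult: "\<lbrakk>x \<in> carrier R; y \<in> carrier R\<rbrakk> \<Longrightarrow> p (x \<otimes> y) \<le> p x * p y"
  and p_add: "\<lbrakk>x \<in> carrier R; y \<in> carrier R\<rbrakk> \<Longrightarrow> p (x \<oplus> y) \<le> p x + p y"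
  using sn unfolding alg_seminorm_def by auto

text \<open>For \<open>r < p f\<close>, minimality forbids a seminorm \<open>q \<le> p\<close> with \<open>q f \<le> r\<close>. A candidate for \<open>q\<close> comes from the
weighted orbits \<open>S e n = p (e f\<^sup>-\<^sup>n) r\<^sup>n\<close>: multiplication of \<open>e\<close> by \<open>f\<close> shifts the orbit by one place and scales it by \<open>r\<close>, so
it acts with norm at most \<open>r\<close>. To make the bounds multiplicative, \<open>G y t\<close> compares a term of the orbit of
\<open>y e\<close> with the terms of the orbit of \<open>e\<close> in a window of bounded length. The gauge of \<open>G\<close> satisfies \<open>q \<le> p\<close> and
\<open>q f \<le> r\<close>, so the only way out is that \<open>q\<close> is not normalised: \<open>G \<one> t\<close> holds for some \<open>t < 1\<close>. Then
\<open>window_bounded\<close> bounds the orbit of \<open>\<one>\<close>.\<close>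

lemma inv_pow_bounded:
  assumes f: "f \<in> carrier R" "f \<noteq> \<zero>" and r: "0 < r" "r < p f"
  obtains C where "\<And>n. p (inv f [^] (n::nat)) * r ^ n \<le> C"
proof -
  define g where "g = inv f"
  have g: "g \<in> carrier R" "f \<otimes> g = \<one>"
    using f field_Units by (auto simp: g_def)
  define S where "S e n = p (e \<otimes> g [^] n) * r ^ n" for e and n :: nat
  define G where "G y t \<longleftrightarrow> 0 \<le> t \<and> (\<exists>d. \<forall>e \<in> carrier R. \<forall>C. \<forall>n\<ge>d.
    (\<forall>m \<in> {n - d..n}. S e m \<le> C) \<longrightarrow> S (y \<otimes> e) n \<le> t * C)" for y t
  have GI: "G y t" if "0 \<le> t"
    "\<And>e C n. \<lbrakk>e \<in> carrier R; n \<ge> d; \<forall>m \<in> {n - d..n}. S e m \<le> C\<rbrakk> \<Longrightarrow> S (y \<otimes> e) n \<le> t * C" for y t d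
    unfolding G_def using that by blast
  have Gp: "G y (p y)" if y: "y \<in> carrier R" for y
  proof (rule GI[of _ 0])
    fix e C n assume e: "e \<in> carrier R" and C: "\<forall>m \<in> {n - 0..n}. S e m \<le> C"
    have "S (y \<otimes> e) n \<le> p y * p (e \<otimes> g [^] n) * r ^ n"
      unfolding S_def using p_mult[of y "e \<otimes> g [^] n"] y e g r(1) by (intro mult_right_mono) (auto simp: m_assoc)
    also have "\<dots> = p y * S e n" by (simp add: S_def)
    also have "\<dots> \<le> p y * C" using C p_nonneg[OF y] by (intro mult_left_mono) auto
    finally show "S (y \<otimes> e) n \<le> p y * C" .
  qed (rule p_nonneg[OF y])
  \<comment> \<open>The window has length two: \<open>f\<close> moves the term at \<open>n - 1\<close> to \<open>n\<close>.\<close>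
  have Gf: "G f r"
  proof (rule GI[of _ 1])
    fix e C n assume e: "e \<in> carrier R" and n: "n \<ge> 1" and C: "\<forall>m \<in> {n - 1..n}. S e m \<le> C"
    obtain m where m: "n = Suc m" using n by (cases n) auto
    have "f \<otimes> e \<otimes> g [^] n = (f \<otimes> g) \<otimes> (e \<otimes> g [^] m)"
      using e f(1) g(1) by (simp add: m m_ac)
    then have "S (f \<otimes> e) n = r * S e m"
      using e g by (simp add: S_def m)
    then show "S (f \<otimes> e) n \<le> r * C"
      using C r(1) m by (auto intro: mult_left_mono)
  qed (use r in simp)
  \<comment> \<open>For a sum take the longer of the two windows, for a product concatenate them.\<close>
  have Gadd: "G (y \<oplus> z) (t + u)" if y: "y \<in> carrier R" and z: "z \<in> carrier R" and G: "G y t" "G z u" for y z t u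
  proof -
    obtain d d' where d: "\<And>e C n. \<lbrakk>e \<in> carrier R; n \<ge> d; \<forall>m \<in> {n - d..n}. S e m \<le> C\<rbrakk> \<Longrightarrow> S (y \<otimes> e) n \<le> t * C"
      and d': "\<And>e C n. \<lbrakk>e \<in> carrier R; n \<ge> d'; \<forall>m \<in> {n - d'..n}. S e m \<le> C\<rbrakk> \<Longrightarrow> S (z \<otimes> e) n \<le> u * C"
      using G unfolding G_def by blast
    show ?thesis
    proof (rule GI[of _ "max d d'"])
      show "0 \<le> t + u" using G unfolding G_def by simp
      fix e C n assume e: "e \<in> carrier R" and n: "n \<ge> max d d'" and C: "\<forall>m \<in> {n - max d d'..n}. S e m \<le> C"
      have "S (y \<otimes> e) n \<le> t * C" "S (z \<otimes> e) n \<le> u * C"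
        using C n by (auto intro!: d d' e)
      moreover have "S ((y \<oplus> z) \<otimes> e) n \<le> S (y \<otimes> e) n + S (z \<otimes> e) n"
        unfolding S_def distrib_right[symmetric]
        using p_add[of "y \<otimes> e \<otimes> g [^] n" "z \<otimes> e \<otimes> g [^] n"] y z e g r(1) by (intro mult_right_mono) (auto simp: l_distr)
      ultimately show "S ((y \<oplus> z) \<otimes> e) n \<le> (t + u) * C"
        by (simp add: distrib_right)
    qed
  qed
  have Gmult: "G (y \<otimes> z) (t * u)" if y: "y \<in> carrier R" and z: "z \<in> carrier R" and G: "G y t" "G z u" for y z t u
  proof -
    obtain d d' where d: "\<And>e C n. \<lbrakk>e \<in> carrier R; n \<ge> d; \<forall>m \<in> {n - d..n}. S e m \<le> C\<rbrakk> \<Longrightarrow> S (y \<otimes> e) n \<le> t * C"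
      and d': "\<And>e C n. \<lbrakk>e \<in> carrier R; n \<ge> d'; \<forall>m \<in> {n - d'..n}. S e m \<le> C\<rbrakk> \<Longrightarrow> S (z \<otimes> e) n \<le> u * C"
      using G unfolding G_def by blast
    show ?thesis
    proof (rule GI[of _ "d + d'"])
      show "0 \<le> t * u" using G unfolding G_def by simp
      fix e C n assume e: "e \<in> carrier R" and n: "n \<ge> d + d'" and C: "\<forall>m \<in> {n - (d + d')..n}. S e m \<le> C"
      have "S (z \<otimes> e) m \<le> u * C" if "m \<in> {n - d..n}" for m
        using that n C by (intro d' e) auto
      then have "S (y \<otimes> (z \<otimes> e)) n \<le> t * (u * C)"
        using n z e by (intro d) auto
      then show "S (y \<otimes> z \<otimes> e) n \<le> t * u * C"
        using y z e by (simp add: m_assoc)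
    qed
  qed
  have nonneg: "0 \<le> t" if "G y t" for y t
    using that unfolding G_def by simp
  have G1: "G \<one> 1" and G0: "G \<zero> 0" using Gp[of \<one>] Gp[of \<zero>] p_one p_zero by simp_all
  show thesis
  proof (cases "\<exists>t<1. G \<one> t")
    case True
    then obtain t d where t: "0 \<le> t" "t < 1"
      and d: "\<And>e C n. \<lbrakk>e \<in> carrier R; n \<ge> d; \<forall>m \<in> {n - d..n}. S e m \<le> C\<rbrakk> \<Longrightarrow> S (\<one> \<otimes> e) n \<le> t * C"
      unfolding G_def by blast
    have "\<exists>C. \<forall>n. S \<one> n \<le> C"
    proof (rule window_bounded[OF t, of "S \<one>" d])
      show "0 \<le> S \<one> n" for n using p_nonneg g(1) r(1) by (simp add: S_def)
      show "S \<one> n \<le> t * C" if "n \<ge> d" "\<forall>m\<in>{n - d..n}. S \<one> m \<le> C" for C n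
        using d[OF one_closed that] by simp
    qed
    then show ?thesis
      using that g(1) by (auto simp: S_def g_def)
  next
    case False
    define q where "q y = Inf {t. G y t}" for y
    have ex: "\<exists>t. G y t" if "y \<in> carrier R" for y using Gp[OF that] by blast
    have G1_le: "1 \<le> t" if "G \<one> t" for t using False that by (meson not_less)
    have gauge: "alg_seminorm R (\<lambda>y. Inf {t. G y t})"
      by (rule gauge_seminorm(1)[OF nonneg ex Gadd Gmult G0 G1 G1_le])
    have gauge_le: "Inf {t. G y t} \<le> t" if "G y t" for y t
      by (rule gauge_seminorm(2)[OF nonneg ex Gadd Gmult G0 G1 G1_le that])
    have q: "alg_seminorm R q" "q f \<le> r" "\<And>y. y \<in> carrier R \<Longrightarrow> q y \<le> p y"
      unfolding q_def using gauge gauge_le[OF Gf] gauge_le[OF Gp] by simp_all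
    have "q f = p f"
      using minimal[OF q(1)] q(3) f(1) by simp
    then show ?thesis
      using q(2) r(2) by simp
  qed
qed

lemma p_pos: "\<lbrakk>f \<in> carrier R; f \<noteq> \<zero>\<rbrakk> \<Longrightarrow> 0 < p f"
proof -
  assume f: "f \<in> carrier R" "f \<noteq> \<zero>"
  then have "inv f \<in> carrier R" "f \<otimes> inv f = \<one>"
    using field_Units by auto
  then have "1 \<le> p f * p (inv f)"
    using p_mult[of f "inv f"] f p_one by simp
  then have "p f \<noteq> 0" by auto
  then show ?thesis using p_nonneg[OF f(1)] by simp
qed

text \<open>If \<open>r < p f\<close> and \<open>s < p (inv f)\<close> had \<open>r s > 1\<close>, then \<open>inv_pow_bounded\<close> for \<open>f\<close> and for \<open>inv f\<close> would bound
\<open>p (f\<^sup>-\<^sup>n) p (f\<^sup>n) (r s)\<^sup>n\<close>, which is at least \<open>(r s)\<^sup>n\<close>.\<close>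

lemma p_inv_le:
  assumes f: "f \<in> carrier R" "f \<noteq> \<zero>" shows "p f * p (inv f) \<le> 1"
proof (rule ccontr)
  assume gt: "\<not> ?thesis"
  have i: "inv f \<in> carrier R" "f \<otimes> inv f = \<one>" "inv f \<noteq> \<zero>" "inv (inv f) = f"
    using f field_Units Units_inv_Units[of f] by auto
  have pos: "0 < p f" "0 < p (inv f)"
    using p_pos f i by auto
  then have "1 / p (inv f) < p f"
    using gt by (simp add: divide_less_eq)
  then obtain r where r: "1 / p (inv f) < r" "r < p f"
    using dense by blast
  moreover have r0: "0 < r" using r(1) pos by (smt (verit) divide_pos_pos)
  ultimately have "1 / r < p (inv f)"
    using pos by (simp add: field_simps)
  then obtain s where s: "1 / r < s" "s < p (inv f)"
    using dense by blast
  have s0: "0 < s" using s(1) r0 by (smt (verit) divide_pos_pos)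
  have rs: "1 < r * s" using s(1) r0 by (simp add: field_simps)
  obtain C where C: "\<And>n. p (inv f [^] (n::nat)) * r ^ n \<le> C"
    using inv_pow_bounded[OF f r0 r(2)] by blast
  obtain D where D: "\<And>n. p (f [^] (n::nat)) * s ^ n \<le> D"
    using inv_pow_bounded[OF i(1,3) s0 s(2)] i(4) by metis
  obtain n where n: "C * D < (r * s) ^ n"
    using real_arch_pow[OF rs] by blast
  have "inv f [^] n \<otimes> f [^] n = \<one>"
    using i(1,2) f(1) by (simp add: nat_pow_distrib[symmetric] m_comm)
  then have "1 \<le> p (inv f [^] n) * p (f [^] n)"
    using p_mult[of "inv f [^] n" "f [^] n"] i(1) f(1) p_one by simp
  then have "(r * s) ^ n \<le> p (inv f [^] n) * p (f [^] n) * (r * s) ^ n"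
    using mult_right_mono[of 1 "p (inv f [^] n) * p (f [^] n)" "(r * s) ^ n"] r0 s0 by simp
  also have "\<dots> = (p (inv f [^] n) * r ^ n) * (p (f [^] n) * s ^ n)"
    by (simp add: power_mult_distrib)
  also have "\<dots> \<le> C * D"
    using C[of n] D[of n] r0 s0 p_nonneg f(1) i(1) by (intro mult_mono) (auto intro: order_trans[OF _ C[of n]])
  finally show False using n by simp
qed

text \<open>From \<open>y = x\<^sup>-\<^sup>1 (x y)\<close> one gets \<open>p x * p y \<le> p x * p (inv x) * p (x y) \<le> p (x y)\<close>.\<close>

lemma p_multiplicative:
  assumes x: "x \<in> carrier R" and y: "y \<in> carrier R" shows "p (x \<otimes> y) = p x * p y"
proof (cases "x = \<zero>")
  case True
  then show ?thesis using y p_zero by simp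
next
  case False
  have i: "inv x \<in> carrier R" "inv x \<otimes> x = \<one>"
    using x False field_Units by auto
  have "y = inv x \<otimes> (x \<otimes> y)"
    using i x y by (simp add: m_assoc[symmetric])
  then have "p y \<le> p (inv x) * p (x \<otimes> y)"
    using p_mult[of "inv x" "x \<otimes> y"] i(1) x y by simp
  then have "p x * p y \<le> (p x * p (inv x)) * p (x \<otimes> y)"
    using p_nonneg[OF x] by (metis mult.assoc mult_left_mono)
  also have "\<dots> \<le> 1 * p (x \<otimes> y)"
    using p_inv_le[OF x False] p_nonneg x y by (intro mult_right_mono) auto
  finally show ?thesis
    using p_mult[OF x y] by simp
qed

end


text \<open>Zorn's lemma for the reverse pointwise order. A lower bound of a nonempty chain is the gauge of
the relation that some member of the chain is at most \<open>t\<close> at \<open>y\<close>, that is, the pointwise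
infimum; two bounds can always be realised by one member of the chain, so sums and products cause no trouble.\<close>

lemma (in field) minimal_seminorm_exists:
  assumes p0: "alg_seminorm R p0"
  shows "\<exists>p. minimal_seminorm R p \<and> (\<forall>x \<in> carrier R. p x \<le> p0 x)"
proof -
  define \<A> where "\<A> = {q \<in> extensional (carrier R). alg_seminorm R q \<and> (\<forall>x \<in> carrier R. q x \<le> p0 x)}"
  define P where "P a b \<longleftrightarrow> (\<forall>x \<in> carrier R. b x \<le> a x)" for a b :: "'a \<Rightarrow> real"
  have restrict: "alg_seminorm R (restrict q (carrier R))" if "alg_seminorm R q" for q
    using that unfolding alg_seminorm_def by simp
  have po: "partial_order_on \<A> (relation_of P \<A>)"
  proof (rule partial_order_on_relation_ofI)
    show "P a a" for a by (simp add: P_def)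
    show "P a c" if "P a b" "P b c" for a b c
      using that unfolding P_def by (blast intro: order_trans)
    show "a = b" if "a \<in> \<A>" "b \<in> \<A>" "P a b" "P b a" for a b
      by (rule extensionalityI[of a "carrier R"]) (use that in \<open>auto simp: \<A>_def P_def intro: antisym\<close>)
  qed
  have "\<exists>m\<in>\<A>. \<forall>a\<in>\<A>. P m a \<longrightarrow> a = m"
  proof (rule predicate_Zorn[OF po])
    fix C assume C: "C \<in> Chains (relation_of P \<A>)"
    have CA: "q \<in> \<A>" if "q \<in> C" for q
      using C that unfolding Chains_def relation_of_def by auto
    have sn: "alg_seminorm R q" if "q \<in> C" for q
      using CA[OF that] by (simp add: \<A>_def)
    have chain: "P q q' \<or> P q' q" if "q \<in> C" "q' \<in> C" for q q'
      using C that unfolding Chains_def relation_of_def by auto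
    show "\<exists>u\<in>\<A>. \<forall>a\<in>C. P a u"
    proof (cases "C = {}")
      case True
      then show ?thesis
        using restrict[OF p0] by (intro bexI[of _ "restrict p0 (carrier R)"]) (auto simp: \<A>_def)
    next
      case False
      define G where "G y t \<longleftrightarrow> 0 \<le> t \<and> (\<exists>q\<in>C. q y \<le> t)" for y and t :: real
      have common: "\<exists>q\<in>C. q y \<le> t \<and> q z \<le> u"
        if yz: "y \<in> carrier R" "z \<in> carrier R" and G: "G y t" "G z u" for y z t u
      proof -
        obtain q q' where q: "q \<in> C" "q y \<le> t" "q' \<in> C" "q' z \<le> u"
          using G unfolding G_def by blast
        from chain[OF q(1,3)] show ?thesis
        proof
          assume "P q q'"
          then have "q' y \<le> t" using yz q(2) unfolding P_def by (blast intro: order_trans)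
          then show ?thesis using q by blast
        next
          assume "P q' q"
          then have "q z \<le> u" using yz q(4) unfolding P_def by (blast intro: order_trans)
          then show ?thesis using q by blast
        qed
      qed
      obtain q0 where q0: "q0 \<in> C" using False by blast
      have nonneg: "0 \<le> t" if "G y t" for y t using that by (simp add: G_def)
      have memG: "G y (q y)" if "y \<in> carrier R" "q \<in> C" for y q
        using that sn[OF that(2)] unfolding G_def alg_seminorm_def by auto
      have add: "G (y \<oplus> z) (t + u)"
        if yz: "y \<in> carrier R" "z \<in> carrier R" and G: "G y t" "G z u" for y z t u
      proof -
        obtain q where q: "q \<in> C" "q y \<le> t" "q z \<le> u" using common[OF yz G] by blast
        have "q (y \<oplus> z) \<le> q y + q z" using sn[OF q(1)] yz unfolding alg_seminorm_def by blast
        then have "q (y \<oplus> z) \<le> t + u" using q by linarith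
        then show ?thesis using q(1) nonneg[OF G(1)] nonneg[OF G(2)] unfolding G_def by auto
      qed
      have mult: "G (y \<otimes> z) (t * u)"
        if yz: "y \<in> carrier R" "z \<in> carrier R" and G: "G y t" "G z u" for y z t u
      proof -
        obtain q where q: "q \<in> C" "q y \<le> t" "q z \<le> u" using common[OF yz G] by blast
        have "q (y \<otimes> z) \<le> q y * q z" using sn[OF q(1)] yz unfolding alg_seminorm_def by blast
        also have "\<dots> \<le> t * u"
          using q sn[OF q(1)] yz nonneg[OF G(1)] by (intro mult_mono) (auto simp: alg_seminorm_def)
        finally show ?thesis using q(1) nonneg[OF G(1)] nonneg[OF G(2)] unfolding G_def by force
      qed
      have one: "q \<one> = 1" and zero: "q \<zero> = 0" if "q \<in> C" for q
        using sn[OF that] by (auto simp: alg_seminorm_def)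
      define u where "u y = Inf {t. G y t}" for y
      have u: "alg_seminorm R u" "\<And>y t. G y t \<Longrightarrow> u y \<le> t"
        unfolding u_def
      proof (atomize (full), intro conjI allI impI)
        have ex: "\<And>y. y \<in> carrier R \<Longrightarrow> \<exists>t. G y t" using memG[OF _ q0] by blast
        have o: "G \<one> 1" "G \<zero> 0" using memG[OF _ q0] one[OF q0] zero[OF q0] by force+
        have o': "1 \<le> t" if "G \<one> t" for t using that one unfolding G_def by metis
        show "alg_seminorm R (\<lambda>y. Inf {t. G y t})"
          by (rule gauge_seminorm(1)[OF nonneg ex add mult o(2,1) o'])
        show "Inf {t. G y t} \<le> t" if "G y t" for y t
          by (rule gauge_seminorm(2)[OF nonneg ex add mult o(2,1) o' that])
      qed
      have le: "u x \<le> q x" if "x \<in> carrier R" "q \<in> C" for x q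
        using u(2)[OF memG[OF that]] .
      have "u x \<le> p0 x" if "x \<in> carrier R" for x
        using le[OF that q0] CA[OF q0] that unfolding \<A>_def by force
      then have "restrict u (carrier R) \<in> \<A>"
        using restrict[OF u(1)] by (simp add: \<A>_def)
      then show ?thesis
        using le by (intro bexI[of _ "restrict u (carrier R)"]) (auto simp: P_def)
    qed
  qed
  then obtain p where p: "p \<in> \<A>" "\<And>a. \<lbrakk>a \<in> \<A>; P p a\<rbrakk> \<Longrightarrow> a = p" by blast
  have "minimal_seminorm R p"
  proof
    show "alg_seminorm R p" using p(1) by (simp add: \<A>_def)
    fix q assume q: "alg_seminorm R q" "\<forall>x\<in>carrier R. q x \<le> p x"
    have "restrict q (carrier R) \<in> \<A>"
      using restrict[OF q(1)] q(2) p(1) unfolding \<A>_def by (auto intro: order_trans)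
    then have "restrict q (carrier R) = p"
      using p(2) q(2) by (simp add: P_def)
    then show "\<forall>x\<in>carrier R. q x = p x"
      by (metis restrict_apply')
  qed
  then show ?thesis using p(1) by (auto simp: \<A>_def)
qed

theorem (in field) absolute_value_below_seminorm:
  assumes "alg_seminorm R p0"
  shows "\<exists>w. absolute_value R w \<and> (\<forall>x \<in> carrier R. w x \<le> p0 x)"
proof -
  obtain p where p: "minimal_seminorm R p" "\<forall>x \<in> carrier R. p x \<le> p0 x"
    using minimal_seminorm_exists[OF assms] by blast
  interpret minimal_seminorm R p by (rule p(1))
  have "absolute_value R p"
    unfolding absolute_value_def using p_nonneg p_add p_multiplicative p_zero p_pos by force
  then show ?thesis using p(2) by blast
qed

text \<open>A basis over \<open>k\<close> gives an \<open>l\<^sup>1\<close>-norm, and multiplication operators have finite operator norm for it. This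
operator norm is a submultiplicative seminorm whose value at \<open>c \<in> k\<close> is at most \<open>v c\<close>. An absolute value \<open>w\<close>
below it satisfies \<open>w \<le> v\<close> on \<open>k\<close>, and comparison at \<open>c\<close> and at \<open>inv c\<close> forces equality.\<close>

lemma (in field) finite_extension_absolute_value:
  assumes k: "subfield k R" and fin: "finite_dimension k (carrier R)"
    and v: "absolute_value (R\<lparr>carrier := k\<rparr>) v"
  shows "\<exists>w. absolute_value R w \<and> (\<forall>c \<in> k. w c = v c)"
proof -
  interpret k: valued_field "R\<lparr>carrier := k\<rparr>" v
    using subfield_iff(2)[OF k] v by (simp add: valued_field_def valued_field_axioms_def)
  note kr = subringE[OF subfieldE(1)[OF k]]
  have v_nn: "0 \<le> v c" and v_0: "v c = 0 \<longleftrightarrow> c = \<zero>" if "c \<in> k" for c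
    using k.v_nonneg[of c] k.v_eq_0_iff[of c] that by auto
  have v_mult: "v (c \<otimes> d) = v c * v d" and v_add: "v (c \<oplus> d) \<le> v c + v d" if "c \<in> k" "d \<in> k" for c d
    using k.v_mult[of c d] k.v_add[of c d] that by auto
  have kc: "c \<in> carrier R" if "c \<in> k" for c using that kr(1) by auto
  obtain n where "dimension n k (carrier R)" using fin by auto
  then obtain Us where Us: "set Us \<subseteq> carrier R" "independent k Us" "Span k Us = carrier R"
    using exists_base[OF k] by blast
  have rep: "\<exists>Ks. set Ks \<subseteq> k \<and> length Ks = length Us \<and> z = combine Ks Us" if "z \<in> carrier R" for z
    using Span_mem_iff_length_version[OF k Us(1)] Us(3) that by blast
  \<comment> \<open>The \<open>l\<^sup>1\<close>-norm of the coordinates; \<open>THE\<close> picks the coordinate vector.\<close>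
  define nrm where "nrm z = sum_list (map v (THE Ks. set Ks \<subseteq> k \<and> length Ks = length Us \<and> z = combine Ks Us))" for z
  have nrm: "nrm (combine Ks Us) = sum_list (map v Ks)" if "set Ks \<subseteq> k" "length Ks = length Us" for Ks
  proof -
    have Ksc: "set Ks \<subseteq> carrier R" using that(1) kc by auto
    have "\<exists>!Ls. set Ls \<subseteq> k \<and> length Ls = length Us \<and> combine Ks Us = combine Ls Us"
      using unique_decomposition[OF k Us(2), of "combine Ks Us"] Us Ksc by auto
    then have "(THE Ls. set Ls \<subseteq> k \<and> length Ls = length Us \<and> combine Ks Us = combine Ls Us) = Ks"
      using that by (intro the1_equality) auto
    then show ?thesis by (simp add: nrm_def)
  qed
  have nrm_nn: "0 \<le> nrm z" if "z \<in> carrier R" for z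
  proof -
    obtain Ks where Ks: "set Ks \<subseteq> k" "length Ks = length Us" "z = combine Ks Us" using rep[OF \<open>z \<in> carrier R\<close>] by blast
    show ?thesis
      unfolding Ks(3) nrm[OF Ks(1,2)] using Ks(1) v_nn by (intro sum_list_nonneg) auto
  qed
  have nrm_add: "nrm (y \<oplus> z) \<le> nrm y + nrm z" if yz: "y \<in> carrier R" "z \<in> carrier R" for y z
  proof -
    obtain Ks where Ks: "set Ks \<subseteq> k" "length Ks = length Us" "y = combine Ks Us" using rep[OF yz(1)] by blast
    obtain Ls where Ls: "set Ls \<subseteq> k" "length Ls = length Us" "z = combine Ls Us" using rep[OF yz(2)] by blast
    have "length Ks = length Ls" using Ks Ls by simp
    then have "set (map2 (\<oplus>) Ks Ls) \<subseteq> k \<and> sum_list (map v (map2 (\<oplus>) Ks Ls)) \<le> sum_list (map v Ks) + sum_list (map v Ls)"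
      using Ks(1) Ls(1)
    proof (induction Ks Ls rule: list_induct2)
      case (Cons c Ks d Ls)
      then show ?case using v_add[of c d] kr(7)[of c d] by auto
    qed simp
    moreover have "y \<oplus> z = combine (map2 (\<oplus>) Ks Ls) Us"
      unfolding Ks(3) Ls(3) using Ks Ls kc Us(1) by (intro combine_add) auto
    ultimately show ?thesis
      using nrm[of "map2 (\<oplus>) Ks Ls"] nrm[OF Ks(1,2)] nrm[OF Ls(1,2)] Ks Ls by simp
  qed
  have nrm_smult: "nrm (c \<otimes> z) = v c * nrm z" if c: "c \<in> k" and z: "z \<in> carrier R" for c z
  proof -
    obtain Ks where Ks: "set Ks \<subseteq> k" "length Ks = length Us" "z = combine Ks Us" using rep[OF z] by blast
    have "c \<otimes> z = combine (map ((\<otimes>) c) Ks) Us"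
      unfolding Ks(3) using Ks kc c Us(1) by (intro combine_r_distr) auto
    moreover have "sum_list (map v (map ((\<otimes>) c) Ks)) = v c * sum_list (map v Ks)"
      using Ks(1) by (induction Ks) (auto simp: v_mult c distrib_left)
    moreover have "set (map ((\<otimes>) c) Ks) \<subseteq> k"
      using Ks(1) c kr(6) by auto
    ultimately show ?thesis
      using nrm[of "map ((\<otimes>) c) Ks"] nrm[OF Ks(1,2)] Ks by simp
  qed
  have nrm_0: "z = \<zero>" if z: "z \<in> carrier R" "nrm z \<le> 0" for z
  proof -
    obtain Ks where Ks: "set Ks \<subseteq> k" "length Ks = length Us" "z = combine Ks Us" using rep[OF z(1)] by blast
    have "sum_list (map v Ks) \<le> 0" using z(2) nrm[OF Ks(1,2)] Ks(3) by simp
    with Ks(2) have "combine Ks Us = \<zero>" using Ks(1) Us(1)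
    proof (induction Ks Us rule: list_induct2)
      case (Cons c Ks u Us)
      have "0 \<le> sum_list (map v Ks)" using Cons v_nn by (intro sum_list_nonneg) auto
      moreover have "0 \<le> v c" using Cons v_nn by auto
      moreover have "v c + sum_list (map v Ks) \<le> 0" using Cons by simp
      ultimately have "v c = 0" "sum_list (map v Ks) \<le> 0" by linarith+
      then show ?case using Cons v_0[of c] by auto
    qed simp
    then show ?thesis using Ks(3) by simp
  qed
  have nrm1: "0 < nrm \<one>" using nrm_0[of \<one>] by force
  have nrm_z: "nrm \<zero> = 0" using nrm_smult[OF kr(2) zero_closed] k.v_zero by simp
  have bound: "\<exists>t\<ge>0. \<forall>z \<in> carrier R. nrm (y \<otimes> z) \<le> t * nrm z" if y: "y \<in> carrier R" for y
  proof -
    have *: "nrm (y \<otimes> combine Ks Vs) \<le> sum_list (map v Ks) * sum_list (map (\<lambda>u. nrm (y \<otimes> u)) Vs)"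
      if "length Ks = length Vs" "set Ks \<subseteq> k" "set Vs \<subseteq> carrier R" for Ks Vs
      using that
    proof (induction Ks Vs rule: list_induct2)
      case Nil
      then show ?case using y nrm_z by simp
    next
      case (Cons c Ks u Vs)
      let ?a = "sum_list (map v Ks)" and ?b = "sum_list (map (\<lambda>u. nrm (y \<otimes> u)) Vs)"
      have c: "c \<in> k" "u \<in> carrier R" "set Ks \<subseteq> k" "set Ks \<subseteq> carrier R" "set Vs \<subseteq> carrier R"
        using Cons kc by auto
      have nn: "0 \<le> ?a" "0 \<le> ?b" "0 \<le> v c" "0 \<le> nrm (y \<otimes> u)"
        using v_nn[OF c(1)] nrm_nn[of "y \<otimes> u"] c(2) y v_nn[OF subsetD[OF c(3)]] nrm_nn[OF m_closed[OF y subsetD[OF c(5)]]]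
        by (auto intro!: sum_list_nonneg)
      have C: "combine Ks Vs \<in> carrier R" using c by auto
      have "y \<otimes> combine (c # Ks) (u # Vs) = c \<otimes> (y \<otimes> u) \<oplus> y \<otimes> combine Ks Vs"
        using C c(1,2) kc[OF c(1)] y by (simp add: r_distr m_ac)
      then have "nrm (y \<otimes> combine (c # Ks) (u # Vs)) \<le> nrm (c \<otimes> (y \<otimes> u)) + nrm (y \<otimes> combine Ks Vs)"
        using nrm_add[of "c \<otimes> (y \<otimes> u)" "y \<otimes> combine Ks Vs"] C c kc y by simp
      also have "\<dots> \<le> v c * nrm (y \<otimes> u) + ?a * ?b"
        using Cons.IH c nrm_smult y by simp
      also have "\<dots> \<le> (v c + ?a) * (nrm (y \<otimes> u) + ?b)"
        using nn by (simp add: distrib_left distrib_right)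
      finally show ?case by simp
    qed
    have "nrm (y \<otimes> z) \<le> sum_list (map (\<lambda>u. nrm (y \<otimes> u)) Us) * nrm z" if z: "z \<in> carrier R" for z
    proof -
      obtain Ks where Ks: "set Ks \<subseteq> k" "length Ks = length Us" "z = combine Ks Us" using rep[OF z] by blast
      then show ?thesis
        using *[OF Ks(2,1) Us(1)] nrm[OF Ks(1,2)] by (simp add: mult.commute)
    qed
    moreover have "0 \<le> sum_list (map (\<lambda>u. nrm (y \<otimes> u)) Us)"
      using nrm_nn[OF m_closed[OF y subsetD[OF Us(1)]]] by (auto intro!: sum_list_nonneg)
    ultimately show ?thesis by blast
  qed
  \<comment> \<open>The bounds for the operator of multiplication by \<open>y\<close>.\<close>
  define G where "G y t \<longleftrightarrow> 0 \<le> t \<and> (\<forall>z \<in> carrier R. nrm (y \<otimes> z) \<le> t * nrm z)" for y t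
  have Gk: "G c (v c)" if "c \<in> k" for c
    using that v_nn nrm_smult by (simp add: G_def)
  have nonneg: "0 \<le> t" if "G y t" for y t using that by (simp add: G_def)
  have ex: "\<exists>t. G y t" if "y \<in> carrier R" for y using bound[OF that] by (auto simp: G_def)
  have add: "G (y \<oplus> z) (t + u)"
    if yz: "y \<in> carrier R" "z \<in> carrier R" and G: "G y t" "G z u" for y z t u
    unfolding G_def
  proof (intro conjI ballI)
    fix x assume x: "x \<in> carrier R"
    have "nrm ((y \<oplus> z) \<otimes> x) \<le> nrm (y \<otimes> x) + nrm (z \<otimes> x)"
      using nrm_add[of "y \<otimes> x" "z \<otimes> x"] yz x by (simp add: l_distr)
    also have "\<dots> \<le> t * nrm x + u * nrm x" using G x by (intro add_mono) (auto simp: G_def)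
    finally show "nrm ((y \<oplus> z) \<otimes> x) \<le> (t + u) * nrm x" by (simp add: distrib_right)
  qed (use nonneg[OF G(1)] nonneg[OF G(2)] in simp)
  have mult: "G (y \<otimes> z) (t * u)"
    if yz: "y \<in> carrier R" "z \<in> carrier R" and G: "G y t" "G z u" for y z t u
    unfolding G_def
  proof (intro conjI ballI)
    fix x assume x: "x \<in> carrier R"
    have "nrm (y \<otimes> (z \<otimes> x)) \<le> t * nrm (z \<otimes> x)" using G(1) yz x by (auto simp: G_def)
    also have "\<dots> \<le> t * (u * nrm x)" using G x by (intro mult_left_mono) (auto simp: G_def)
    finally show "nrm ((y \<otimes> z) \<otimes> x) \<le> (t * u) * nrm x" using yz x by (simp add: m_assoc mult.assoc)
  qed (use nonneg[OF G(1)] nonneg[OF G(2)] in simp)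
  have one: "G \<one> 1" "G \<zero> 0"
    using Gk[OF kr(3)] Gk[OF kr(2)] k.v_one k.v_zero by simp_all
  have one_le: "1 \<le> t" if "G \<one> t" for t
  proof -
    have "1 * nrm \<one> \<le> t * nrm \<one>" using that by (simp add: G_def)
    then show ?thesis using nrm1 by (simp only: mult_le_cancel_right_pos)
  qed
  have gauge: "alg_seminorm R (\<lambda>y. Inf {t. G y t})"
    by (rule gauge_seminorm(1)[OF nonneg ex add mult one(2,1) one_le])
  have gauge_le: "Inf {t. G y t} \<le> t" if "G y t" for y t
    by (rule gauge_seminorm(2)[OF nonneg ex add mult one(2,1) one_le that])
  obtain w where w: "absolute_value R w" "\<And>x. x \<in> carrier R \<Longrightarrow> w x \<le> Inf {t. G x t}"
    using absolute_value_below_seminorm[OF gauge] by blast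
  interpret W: valued_field R w using w(1) by unfold_locales
  have le: "w c \<le> v c" if "c \<in> k" for c
    using w(2)[OF kc[OF that]] gauge_le[OF Gk[OF that]] by simp
  have "w c = v c" if c: "c \<in> k" for c
  proof (cases "c = \<zero>")
    case True
    then show ?thesis using v_0[of \<zero>] kr(2) by simp
  next
    case False
    then have i: "inv c \<in> k" "c \<otimes> inv c = \<one>" using subfield_m_inv[OF k, of c] c by auto
    have pos: "0 < v (inv c)"
      using v_nn[OF i(1)] v_mult[OF c i(1)] i(2) k.v_one by (cases "v (inv c) = 0") auto
    have "v c * v (inv c) = w c * w (inv c)"
      using v_mult[OF c i(1)] W.v_mult[OF kc[OF c] kc[OF i(1)]] i(2) k.v_one by simp
    also have "\<dots> \<le> w c * v (inv c)"
      using le[OF i(1)] kc[OF c] by (intro mult_left_mono) auto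
    finally have "v c \<le> w c" using pos by simp
    then show ?thesis using le[OF c] by simp
  qed
  then show ?thesis using w(1) by blast
qed


lemma (in ring) a_minus_subring:
  assumes H: "subring H R" and "x \<in> H" "y \<in> H"
  shows "x \<ominus>\<^bsub>R\<lparr>carrier := H\<rparr>\<^esub> y = x \<ominus> y"
proof -
  interpret H: ring "R\<lparr>carrier := H\<rparr>" by (rule subring_is_ring[OF H])
  have "ring_hom_ring (R\<lparr>carrier := H\<rparr>) R id"
    by (rule ring_hom_ringI[OF H.ring_axioms ring_axioms]) (use subringE(1)[OF H] in auto)
  then interpret I: ring_hom_ring "R\<lparr>carrier := H\<rparr>" R id .
  show ?thesis
    using I.hom_a_inv[of y] assms(3) by (simp add: a_minus_def)
qed

lemma (in ring) subfield_in_subring: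
  assumes "subfield k R" "k \<subseteq> B" "subring B R"
  shows "subfield k (R\<lparr>carrier := B\<rparr>)"
proof -
  interpret B: ring "R\<lparr>carrier := B\<rparr>" by (rule subring_is_ring[OF assms(3)])
  show ?thesis
    using B.subfield_iff(1)[of k] subfield_iff(2)[OF assms(1)] assms(2) by simp
qed

lemma (in ring) finite_dimension_in_subring:
  assumes k: "subfield k R" and "k \<subseteq> B" and B: "subring B R" and fin: "finite_dimension k B"
  shows "ring.finite_dimension (R\<lparr>carrier := B\<rparr>) k B"
proof -
  interpret B: ring "R\<lparr>carrier := B\<rparr>" by (rule subring_is_ring[OF B])
  obtain n where "dimension n k B" using fin by auto
  then obtain Us where Us: "set Us \<subseteq> carrier R" "Span k Us = B"
    using exists_base[OF k] by blast
  then have "B.finite_dimension k (B.Span k Us)"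
    using Span_base_incl[OF k Us(1)] by (intro B.Span_finite_dimension subfield_in_subring[OF k assms(2) B]) simp
  then show ?thesis
    using Us(2) Span_consistent[OF B] by simp
qed

lemma absolute_value_subset:
  assumes "absolute_value R w" "D \<subseteq> carrier R" shows "absolute_value (R\<lparr>carrier := D\<rparr>) w"
  using assms unfolding absolute_value_def by (simp add: subset_iff)

text \<open>The extensions to the finite subextensions \<open>k(x, y)\<close> exist by the previous result and agree on overlaps,
because \<open>k\<close> is complete and extensions to \<open>k(x)\<close> are unique. So they glue.\<close>

lemma (in field) algebraic_absolute_value:
  assumes k: "subfield k R" and v: "absolute_value (R\<lparr>carrier := k\<rparr>) v"
    and comp: "complete_subset R v k" and alg: "\<And>x. x \<in> carrier R \<Longrightarrow> (algebraic over k) x"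
  shows "\<exists>w. absolute_value R w \<and> (\<forall>c \<in> k. w c = v c)"
proof -
  note kr = subringE[OF subfieldE(1)[OF k]]
  define Q where "Q B w \<longleftrightarrow> subfield B R \<and> k \<subseteq> B \<and> absolute_value (R\<lparr>carrier := B\<rparr>) w \<and> (\<forall>c\<in>k. w c = v c)" for B w
  have ex: "\<exists>B w. Q B w \<and> x \<in> B \<and> y \<in> B" if xy: "x \<in> carrier R" "y \<in> carrier R" for x y
  proof -
    define B where "B = finite_extension k [x, y]"
    have al: "\<And>z. z \<in> set [x, y] \<Longrightarrow> (algebraic over k) z" and xys: "set [x, y] \<subseteq> carrier R"
      using alg xy by auto
    have sf: "subfield B R"
      unfolding B_def by (rule finite_extension_is_subfield[OF k xys al])
    have fin: "finite_dimension k B"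
      unfolding B_def by (rule finite_extension_finite_dimension(1)[OF k xys al])
    have kB: "k \<subseteq> B"
      unfolding B_def by (rule finite_extension_incl[OF kr(1) xys])
    have mem: "x \<in> B" "y \<in> B"
      using finite_extension_mem[OF subfieldE(1)[OF k] xys] unfolding B_def by auto
    interpret B: field "R\<lparr>carrier := B\<rparr>" by (rule subfield_iff(2)[OF sf])
    have "\<exists>w. absolute_value (R\<lparr>carrier := B\<rparr>) w \<and> (\<forall>c\<in>k. w c = v c)"
      using subfield_in_subring[OF k kB subfieldE(1)[OF sf]]
        finite_dimension_in_subring[OF k kB subfieldE(1)[OF sf] fin] v
      by (intro B.finite_extension_absolute_value) simp_all
    then show ?thesis
      using sf kB mem unfolding Q_def by blast
  qed
  have unique: "w x = w' x" if Q: "Q B w" "Q B' w'" and x: "x \<in> B" "x \<in> B'" for B w B' w' x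
  proof -
    note B = Q[unfolded Q_def]
    have xc: "x \<in> carrier R" using B(1) x(1) subfieldE(3) by blast
    define D where "D = simple_extension k x"
    have sf: "subfield D R"
      unfolding D_def using simple_extension_is_subfield[OF k xc] alg[OF xc] by blast
    note Dr = subfieldE(1)[OF sf]
    have DB: "D \<subseteq> B" "D \<subseteq> B'"
      unfolding D_def using simple_extension_subring_incl[OF subfieldE(1)] B x by blast+
    have kD: "k \<subseteq> D" and xD: "x \<in> D"
      unfolding D_def using simple_extension_incl[OF kr(1) xc] simple_extension_mem[OF subfieldE(1)[OF k] xc] by auto
    have abs: "absolute_value (R\<lparr>carrier := D\<rparr>) w" "absolute_value (R\<lparr>carrier := D\<rparr>) w'"
      using B DB absolute_value_subset[of "R\<lparr>carrier := B\<rparr>" w D] absolute_value_subset[of "R\<lparr>carrier := B'\<rparr>" w' D]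
      by simp_all
    interpret D: valued_field "R\<lparr>carrier := D\<rparr>" w
      using subfield_iff(2)[OF sf] abs(1) by (simp add: valued_field_def valued_field_axioms_def)
    have w: "w c = v c" "w' c = v c" if "c \<in> k" for c
      using B that by auto
    have "complete_subset (R\<lparr>carrier := D\<rparr>) w k"
      unfolding complete_subset_def
    proof (intro ballI impI)
      fix z assume z: "z \<in> cauchy_seqs (R\<lparr>carrier := D\<rparr>) w" "range z \<subseteq> k"
      have zk: "z n \<in> k" for n using z(2) by auto
      have d: "w (z m \<ominus>\<^bsub>R\<lparr>carrier := D\<rparr>\<^esub> b) = v (z m \<ominus> b)" if "b \<in> k" for m b
      proof -
        have "z m \<ominus> b \<in> k" using zk[of m] that kr(5,7) by (simp add: a_minus_def)
        then show ?thesis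
          using a_minus_subring[OF Dr subsetD[OF kD zk[of m]] subsetD[OF kD that]] w(1) by simp
      qed
      have "z \<in> cauchy_seqs R v"
        using z(1) d[OF zk] zk kr(1) unfolding cauchy_seqs_def by auto
      then obtain a where "a \<in> k" "(\<lambda>n. v (z n \<ominus> a)) \<longlonglongrightarrow> 0"
        using comp z(2) unfolding complete_subset_def by blast
      then show "\<exists>a\<in>k. (\<lambda>n. w (z n \<ominus>\<^bsub>R\<lparr>carrier := D\<rparr>\<^esub> a)) \<longlonglongrightarrow> 0"
        using d by auto
    qed
    moreover have "(D.algebraic over k) x"
      using alg[OF xc] algebraic_consistent[OF Dr] by simp
    ultimately show ?thesis
      using D.algebraic_abs_unique[OF subfield_in_subring[OF k kD Dr] _ abs(2), of x] w xD by simp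
  qed
  define w where "w x = (THE r. \<exists>B w'. Q B w' \<and> x \<in> B \<and> w' x = r)" for x
  have w: "w x = w' x" if "Q B w'" "x \<in> B" for B w' x
    unfolding w_def using that unique by (intro the_equality) blast+
  have pair: "\<exists>B w'. subfield B R \<and> absolute_value (R\<lparr>carrier := B\<rparr>) w' \<and> x \<in> B \<and> y \<in> B \<and> (\<forall>z\<in>B. w z = w' z)"
    if "x \<in> carrier R" "y \<in> carrier R" for x y
    using ex[OF that] w unfolding Q_def by blast
  have "absolute_value R w"
    unfolding absolute_value_def
  proof (intro conjI ballI)
    fix x y assume xy: "x \<in> carrier R" "y \<in> carrier R"
    obtain B w' where B: "subfield B R" "absolute_value (R\<lparr>carrier := B\<rparr>) w'" "x \<in> B" "y \<in> B" "\<forall>z\<in>B. w z = w' z"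
      using pair[OF xy] by blast
    note Br = subringE[OF subfieldE(1)[OF B(1)]]
    show "w (x \<otimes> y) = w x * w y" "w (x \<oplus> y) \<le> w x + w y"
      using B Br(6,7)[of x y] unfolding absolute_value_def by auto
  next
    fix x assume x: "x \<in> carrier R"
    obtain B w' where B: "subfield B R" "absolute_value (R\<lparr>carrier := B\<rparr>) w'" "x \<in> B" "\<forall>z\<in>B. w z = w' z"
      using pair[OF x x] by blast
    show "0 \<le> w x" "w x = 0 \<longleftrightarrow> x = \<zero>"
      using B unfolding absolute_value_def by auto
  qed
  moreover have "w c = v c" if "c \<in> k" for c
  proof -
    obtain B w' where B: "Q B w'" "c \<in> B" using ex[of c c] \<open>c \<in> k\<close> kr(1) by blast
    then show ?thesis using w[OF B] that unfolding Q_def by simp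
  qed
  ultimately show ?thesis by blast
qed

section \<open>Homomorphisms out of subfields\<close>

lemma poly_ring_consistent:
  assumes "ring S" "subring B S"
  shows "poly_ring (S\<lparr>carrier := B\<rparr>) = univ_poly S B"
  using ring.univ_poly_consistent[OF assms] by simp

locale subfield_hom = S: field S + A: field A for S (structure) and A (structure) +
  fixes B :: "'a set" and \<tau> :: "'a \<Rightarrow> 'c"
  assumes B: "subfield B S" and hom: "\<tau> \<in> ring_hom (S\<lparr>carrier := B\<rparr>) A"
begin

lemma Br: "subring B S"
  by (rule subfieldE(1)[OF B])

sublocale BF: field "S\<lparr>carrier := B\<rparr>"
  by (rule S.subfield_iff(2)[OF B])

sublocale H: ring_hom_ring "S\<lparr>carrier := B\<rparr>" A \<tau>
  by (rule ring_hom_ringI2[OF BF.ring_axioms A.ring_axioms hom])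

lemma \<tau>_closed: "c \<in> B \<Longrightarrow> \<tau> c \<in> carrier A"
  using H.hom_closed by simp

lemma \<tau>_eq_zero_iff: "c \<in> B \<Longrightarrow> \<tau> c = \<zero>\<^bsub>A\<^esub> \<longleftrightarrow> c = \<zero>\<^bsub>S\<^esub>"
  using H.hom_zero H.img_is_subfield(1)[OF BF.carrier_is_subfield] subringE(2)[OF Br]
  by (auto simp: inj_on_def)

lemma poly_set: "p \<in> carrier (B[X]\<^bsub>S\<^esub>) \<Longrightarrow> set p \<subseteq> B"
  using S.polynomial_incl[of B p] by (simp add: univ_poly_carrier)

lemma map_poly: "p \<in> carrier (B[X]\<^bsub>S\<^esub>) \<Longrightarrow> map \<tau> p \<in> carrier (poly_ring A)"
  using polynomial_hom[OF hom BF.field_axioms A.field_axioms, of p] poly_ring_consistent[OF S.ring_axioms Br] by simp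

lemma map_set: "p \<in> carrier (B[X]\<^bsub>S\<^esub>) \<Longrightarrow> set (map \<tau> p) \<subseteq> carrier A"
  using poly_set[of p] \<tau>_closed by auto

lemma map_mult:
  assumes p: "p \<in> carrier (B[X]\<^bsub>S\<^esub>)" "q \<in> carrier (B[X]\<^bsub>S\<^esub>)"
  shows "map \<tau> (p \<otimes>\<^bsub>B[X]\<^bsub>S\<^esub>\<^esub> q) = map \<tau> p \<otimes>\<^bsub>poly_ring A\<^esub> map \<tau> q"
proof -
  interpret P: domain "B[X]\<^bsub>S\<^esub>" by (rule S.univ_poly_is_domain[OF Br])
  have "A.normalize (map \<tau> (S.poly_mult p q)) = A.poly_mult (map \<tau> p) (map \<tau> q)"
    using H.poly_mult_hom'[of p q] poly_set p S.poly_mult_consistent[OF Br] by simp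
  moreover have "A.normalize (map \<tau> (S.poly_mult p q)) = map \<tau> (S.poly_mult p q)"
    using map_poly[OF P.m_closed[OF p]] A.normalize_polynomial by (simp add: univ_poly_mult univ_poly_carrier[symmetric])
  ultimately show ?thesis by (simp add: univ_poly_mult)
qed

lemma map_add:
  assumes p: "p \<in> carrier (B[X]\<^bsub>S\<^esub>)" "q \<in> carrier (B[X]\<^bsub>S\<^esub>)"
  shows "map \<tau> (p \<oplus>\<^bsub>B[X]\<^bsub>S\<^esub>\<^esub> q) = map \<tau> p \<oplus>\<^bsub>poly_ring A\<^esub> map \<tau> q"
proof -
  interpret P: domain "B[X]\<^bsub>S\<^esub>" by (rule S.univ_poly_is_domain[OF Br])
  have "A.normalize (map \<tau> (S.poly_add p q)) = A.poly_add (map \<tau> p) (map \<tau> q)"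
    using H.poly_add_hom'[of p q] poly_set p S.poly_add_consistent[OF Br] by simp
  moreover have "A.normalize (map \<tau> (S.poly_add p q)) = map \<tau> (S.poly_add p q)"
    using map_poly[OF P.a_closed[OF p]] A.normalize_polynomial by (simp add: univ_poly_add univ_poly_carrier[symmetric])
  ultimately show ?thesis by (simp add: univ_poly_add)
qed

lemma map_poly_hom: "map \<tau> \<in> ring_hom (B[X]\<^bsub>S\<^esub>) (poly_ring A)"
proof (rule ring_hom_memI)
  show "map \<tau> \<one>\<^bsub>B[X]\<^bsub>S\<^esub>\<^esub> = \<one>\<^bsub>poly_ring A\<^esub>"
    using H.hom_one by (simp add: univ_poly_one)
qed (use map_poly map_mult map_add in auto)

definition ev :: "'c \<Rightarrow> 'a list \<Rightarrow> 'c"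
  where "ev a p = A.eval (map \<tau> p) a"

lemma ev_hom: "a \<in> carrier A \<Longrightarrow> ev a \<in> ring_hom (B[X]\<^bsub>S\<^esub>) A"
  using ring_hom_trans[OF map_poly_hom A.eval_is_hom[OF A.carrier_is_subring]]
  by (simp add: ev_def[abs_def] comp_def)

end

subsection \<open>Extending a homomorphism to a simple extension\<close>

definition hom_extensions :: "('a, 'x) ring_scheme \<Rightarrow> ('c, 'y) ring_scheme \<Rightarrow> 'a set \<Rightarrow> ('a \<Rightarrow> 'c) \<Rightarrow> 'a set \<Rightarrow> ('a \<Rightarrow> 'c) set"
  where "hom_extensions S A B \<tau> D = {\<tau>' \<in> extensional D. \<tau>' \<in> ring_hom (S\<lparr>carrier := D\<rparr>) A \<and> (\<forall>c \<in> B. \<tau>' c = \<tau> c)}"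

context subfield_hom
begin

lemma hom_eval:
  assumes D: "subfield D S" "B \<subseteq> D" and \<tau>': "\<tau>' \<in> ring_hom (S\<lparr>carrier := D\<rparr>) A" "\<And>c. c \<in> B \<Longrightarrow> \<tau>' c = \<tau> c"
    and x: "x \<in> D" and p: "p \<in> carrier (B[X]\<^bsub>S\<^esub>)"
  shows "\<tau>' (S.eval p x) = ev (\<tau>' x) p"
proof -
  have Dr: "subring D S" by (rule subfieldE(1)[OF D(1)])
  interpret D: ring_hom_ring "S\<lparr>carrier := D\<rparr>" A \<tau>'
    by (rule ring_hom_ringI2[OF S.subring_is_ring[OF Dr] A.ring_axioms \<tau>'(1)])
  have "set p \<subseteq> D" using poly_set[OF p] D(2) by auto
  then have "\<tau>' (ring.eval (S\<lparr>carrier := D\<rparr>) p x) = A.eval (map \<tau>' p) (\<tau>' x)"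
    using D.eval_hom'[of x p] x by simp
  then have "\<tau>' (S.eval p x) = A.eval (map \<tau>' p) (\<tau>' x)"
    unfolding S.eval_consistent[OF Dr] .
  moreover have "map \<tau>' p = map \<tau> p" using poly_set[OF p] \<tau>'(2) by auto
  ultimately show ?thesis by (simp add: ev_def)
qed

lemma ev_eq_zero:
  assumes x: "x \<in> carrier S" "(S.algebraic over B) x" and a: "a \<in> carrier A" "ev a (S.Irr B x) = \<zero>\<^bsub>A\<^esub>"
    and p: "p \<in> carrier (B[X]\<^bsub>S\<^esub>)" "S.eval p x = \<zero>\<^bsub>S\<^esub>"
  shows "ev a p = \<zero>\<^bsub>A\<^esub>"
proof -
  note Irr = S.IrrE[OF B x]
  have "S.Irr B x divides\<^bsub>B[X]\<^bsub>S\<^esub>\<^esub> p"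
    using S.Irr_minimal[OF B x p] S.pdivides_iff_shell[OF B Irr(1) p(1)] by simp
  then obtain q where q: "q \<in> carrier (B[X]\<^bsub>S\<^esub>)" "p = S.Irr B x \<otimes>\<^bsub>B[X]\<^bsub>S\<^esub>\<^esub> q"
    unfolding factor_def by blast
  then show ?thesis
    using ring_hom_memE(1,2)[OF ev_hom[OF a(1)]] Irr(1) a(2) by simp
qed

text \<open>Elements of \<open>B(x)\<close> are values \<open>eval p x\<close>; the extension sends \<open>eval p x\<close> to \<open>ev a p\<close>. This does not depend on
\<open>p\<close>, since a polynomial that vanishes at \<open>x\<close> is a multiple of the minimal polynomial of \<open>x\<close>.\<close>

lemma simple_extension_hom:
  assumes x: "x \<in> carrier S" "(S.algebraic over B) x" and a: "a \<in> carrier A" "ev a (S.Irr B x) = \<zero>\<^bsub>A\<^esub>"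
  shows "\<exists>\<tau>' \<in> hom_extensions S A B \<tau> (S.simple_extension B x). \<tau>' x = a"
proof -
  let ?D = "S.simple_extension B x"
  interpret P: domain "B[X]\<^bsub>S\<^esub>" by (rule S.univ_poly_is_domain[OF Br])
  interpret ev: ring_hom_ring "B[X]\<^bsub>S\<^esub>" A "ev a"
    by (rule ring_hom_ringI2[OF P.ring_axioms A.ring_axioms ev_hom[OF a(1)]])
  interpret E: ring_hom_ring "B[X]\<^bsub>S\<^esub>" S "\<lambda>p. S.eval p x"
    by (rule S.eval_ring_hom[OF Br x(1)])
  have D: "?D = (\<lambda>p. S.eval p x) ` carrier (B[X]\<^bsub>S\<^esub>)"
    by (rule S.simple_extension_as_eval_img[OF subfieldE(3)[OF B] x(1)])
  define \<tau>' where "\<tau>' = (\<lambda>y\<in>?D. ev a (SOME p. p \<in> carrier (B[X]\<^bsub>S\<^esub>) \<and> S.eval p x = y))"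
  have eq: "ev a p = ev a q" if pq: "p \<in> carrier (B[X]\<^bsub>S\<^esub>)" "q \<in> carrier (B[X]\<^bsub>S\<^esub>)" "S.eval p x = S.eval q x" for p q
  proof -
    have "S.eval (p \<ominus>\<^bsub>B[X]\<^bsub>S\<^esub>\<^esub> q) x = \<zero>\<^bsub>S\<^esub>"
      using pq E.hom_closed[of q] E.hom_add[of p "\<ominus>\<^bsub>B[X]\<^bsub>S\<^esub>\<^esub> q"] E.hom_a_inv[of q] by (simp add: a_minus_def S.r_neg)
    then have "ev a (p \<ominus>\<^bsub>B[X]\<^bsub>S\<^esub>\<^esub> q) = \<zero>\<^bsub>A\<^esub>"
      using ev_eq_zero[OF x a] pq by simp
    then have "ev a p \<ominus>\<^bsub>A\<^esub> ev a q = \<zero>\<^bsub>A\<^esub>"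
      using pq by (simp add: a_minus_def)
    then show ?thesis
      using pq by simp
  qed
  have \<tau>': "\<tau>' (S.eval p x) = ev a p" if p: "p \<in> carrier (B[X]\<^bsub>S\<^esub>)" for p
  proof -
    let ?q = "SOME q. q \<in> carrier (B[X]\<^bsub>S\<^esub>) \<and> S.eval q x = S.eval p x"
    have "\<exists>q. q \<in> carrier (B[X]\<^bsub>S\<^esub>) \<and> S.eval q x = S.eval p x" using p by blast
    from someI_ex[OF this] have "ev a ?q = ev a p"
      by (intro eq p) blast+
    moreover have "S.eval p x \<in> ?D" unfolding D using p by blast
    ultimately show ?thesis
      unfolding \<tau>'_def by simp
  qed
  have "\<tau>' \<in> ring_hom (S\<lparr>carrier := ?D\<rparr>) A"
  proof (rule ring_hom_memI)
    fix y assume "y \<in> carrier (S\<lparr>carrier := ?D\<rparr>)"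
    then obtain p where p: "p \<in> carrier (B[X]\<^bsub>S\<^esub>)" "y = S.eval p x" using D by auto
    show "\<tau>' y \<in> carrier A" using \<tau>' p by simp
    fix z assume "z \<in> carrier (S\<lparr>carrier := ?D\<rparr>)"
    then obtain q where q: "q \<in> carrier (B[X]\<^bsub>S\<^esub>)" "z = S.eval q x" using D by auto
    have "y \<otimes>\<^bsub>S\<^esub> z = S.eval (p \<otimes>\<^bsub>B[X]\<^bsub>S\<^esub>\<^esub> q) x" "y \<oplus>\<^bsub>S\<^esub> z = S.eval (p \<oplus>\<^bsub>B[X]\<^bsub>S\<^esub>\<^esub> q) x"
      using p q by simp_all
    then show "\<tau>' (y \<otimes>\<^bsub>S\<lparr>carrier := ?D\<rparr>\<^esub> z) = \<tau>' y \<otimes>\<^bsub>A\<^esub> \<tau>' z" "\<tau>' (y \<oplus>\<^bsub>S\<lparr>carrier := ?D\<rparr>\<^esub> z) = \<tau>' y \<oplus>\<^bsub>A\<^esub> \<tau>' z"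
      using \<tau>'[OF P.m_closed[OF p(1) q(1)]] \<tau>'[OF P.a_closed[OF p(1) q(1)]] \<tau>'[OF p(1)] \<tau>'[OF q(1)] p q
      by simp_all
  next
    show "\<tau>' \<one>\<^bsub>S\<lparr>carrier := ?D\<rparr>\<^esub> = \<one>\<^bsub>A\<^esub>"
      using \<tau>'[OF P.one_closed] by simp
  qed
  moreover have "\<tau>' c = \<tau> c" if c: "c \<in> B" for c
  proof (cases "c = \<zero>\<^bsub>S\<^esub>")
    case True
    then show ?thesis using \<tau>'[OF P.zero_closed] c \<tau>_eq_zero_iff[of c] by simp
  next
    case False
    then have "[c] \<in> carrier (B[X]\<^bsub>S\<^esub>)" using c by (simp add: univ_poly_carrier[symmetric] polynomial_def)
    moreover have "S.eval [c] x = c" using c subfieldE(3)[OF B] x(1) by auto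
    moreover have "ev a [c] = \<tau> c" using \<tau>_closed[OF c] a(1) by (simp add: ev_def)
    ultimately show ?thesis using \<tau>'[of "[c]"] by simp
  qed
  moreover have "\<tau>' x = a"
    using \<tau>'[OF S.var_closed(1)[OF Br]] x(1) a(1) H.hom_one H.hom_zero by (simp add: S.eval_var ev_def var_def)
  moreover have "\<tau>' \<in> extensional ?D" by (simp add: \<tau>'_def)
  ultimately show ?thesis
    unfolding hom_extensions_def by blast
qed

lemma simple_extension_hom_bij:
  assumes x: "x \<in> carrier S" "(S.algebraic over B) x"
  shows "bij_betw (\<lambda>\<tau>'. \<tau>' x) (hom_extensions S A B \<tau> (S.simple_extension B x))
    {a \<in> carrier A. ev a (S.Irr B x) = \<zero>\<^bsub>A\<^esub>}"
proof -
  let ?D = "S.simple_extension B x"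
  have D: "subfield ?D S" using S.simple_extension_is_subfield[OF B x(1)] x(2) by simp
  have BD: "B \<subseteq> ?D" by (rule S.simple_extension_incl[OF subfieldE(3)[OF B] x(1)])
  have xD: "x \<in> ?D" by (rule S.simple_extension_mem[OF Br x(1)])
  have Deq: "?D = (\<lambda>p. S.eval p x) ` carrier (B[X]\<^bsub>S\<^esub>)"
    by (rule S.simple_extension_as_eval_img[OF subfieldE(3)[OF B] x(1)])
  have ev: "\<tau>' (S.eval p x) = ev (\<tau>' x) p"
    if "\<tau>' \<in> hom_extensions S A B \<tau> ?D" "p \<in> carrier (B[X]\<^bsub>S\<^esub>)" for \<tau>' p
    using hom_eval[OF D BD, of \<tau>' x p] that xD unfolding hom_extensions_def by simp
  have inj: "\<tau>1 = \<tau>2"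
    if t: "\<tau>1 \<in> hom_extensions S A B \<tau> ?D" "\<tau>2 \<in> hom_extensions S A B \<tau> ?D" "\<tau>1 x = \<tau>2 x" for \<tau>1 \<tau>2
  proof (rule extensionalityI[of _ ?D])
    fix y assume "y \<in> ?D"
    then obtain p where "p \<in> carrier (B[X]\<^bsub>S\<^esub>)" "y = S.eval p x" using Deq by auto
    then show "\<tau>1 y = \<tau>2 y" using ev[OF t(1)] ev[OF t(2)] t(3) by metis
  qed (use t in \<open>auto simp: hom_extensions_def\<close>)
  have root: "\<tau>' x \<in> carrier A \<and> ev (\<tau>' x) (S.Irr B x) = \<zero>\<^bsub>A\<^esub>" if t: "\<tau>' \<in> hom_extensions S A B \<tau> ?D" for \<tau>'
  proof -
    have h: "\<tau>' \<in> ring_hom (S\<lparr>carrier := ?D\<rparr>) A"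
      using t by (simp add: hom_extensions_def)
    have "\<tau>' \<zero>\<^bsub>S\<^esub> = \<zero>\<^bsub>A\<^esub>"
      using ring_hom_zero[OF h S.subring_is_ring[OF subfieldE(1)[OF D]] A.ring_axioms] by simp
    moreover have "\<tau>' x \<in> carrier A"
      using ring_hom_memE(1)[OF h, of x] xD by simp
    ultimately show ?thesis
      using ev[OF t S.IrrE(1)[OF B x]] S.IrrE(4)[OF B x] by simp
  qed
  show ?thesis
  proof (rule bij_betw_imageI)
    show "inj_on (\<lambda>\<tau>'. \<tau>' x) (hom_extensions S A B \<tau> ?D)"
      by (rule inj_onI) (rule inj)
    show "(\<lambda>\<tau>'. \<tau>' x) ` hom_extensions S A B \<tau> ?D = {a \<in> carrier A. ev a (S.Irr B x) = \<zero>\<^bsub>A\<^esub>}"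
    proof (intro equalityI subsetI)
      fix a assume "a \<in> {a \<in> carrier A. ev a (S.Irr B x) = \<zero>\<^bsub>A\<^esub>}"
      then show "a \<in> (\<lambda>\<tau>'. \<tau>' x) ` hom_extensions S A B \<tau> ?D"
        using simple_extension_hom[OF x, of a] by auto
    qed (use root in blast)
  qed
qed

end

subsection \<open>Counting extensions of homomorphisms\<close>

lemma (in algebraically_closed) card_roots:
  assumes p: "p \<in> carrier (poly_ring L)" "p \<noteq> []" and simple: "\<And>a. a \<in> carrier L \<Longrightarrow> alg_mult p a \<le> 1"
  shows "finite {a \<in> carrier L. eval p a = \<zero>}" "card {a \<in> carrier L. eval p a = \<zero>} = degree p"
proof -
  have set: "set_mset (roots p) = {a \<in> carrier L. eval p a = \<zero>}"
    using roots_mem_iff_is_root[OF p(1)] p(2) by (auto simp: is_root_def)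
  then show "finite {a \<in> carrier L. eval p a = \<zero>}"
    by (metis finite_set_mset)
  have "count (roots p) a = 1" if "a \<in># roots p" for a
  proof -
    have "0 < count (roots p) a" using that by simp
    moreover have "count (roots p) a \<le> 1"
      using simple[of a] that set alg_mult_eq_count_roots[OF p(1)] by auto
    ultimately show ?thesis by linarith
  qed
  then have "size (roots p) = card (set_mset (roots p))"
    by (simp add: size_multiset_overloaded_eq)
  then show "card {a \<in> carrier L. eval p a = \<zero>} = degree p"
    using roots_over_carrier[OF p(1)] set by (simp add: splitted_def)
qed

text \<open>A root of a polynomial over \<open>k\<close> that has only simple roots in \<open>A\<close>. This form of separability passes to every
intermediate field without any reference to derivatives, and it can be transported from \<open>L\<close>, where
separability is assumed, to the completions.\<close>

definition root_of_simple_rooted :: "('a, 'x) ring_scheme \<Rightarrow> ('c, 'y) ring_scheme \<Rightarrow> 'a set \<Rightarrow> ('a \<Rightarrow> 'c) \<Rightarrow> 'a \<Rightarrow> bool"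
  where "root_of_simple_rooted S A k \<sigma> x \<longleftrightarrow> (\<exists>p \<in> carrier (k[X]\<^bsub>S\<^esub>). p \<noteq> [] \<and> ring.eval S p x = \<zero>\<^bsub>S\<^esub> \<and>
    (\<forall>a \<in> carrier A. ring.alg_mult A (map \<sigma> p) a \<le> 1))"

text \<open>Extensions to \<open>B(x)\<close> correspond to the roots in \<open>A\<close> of the minimal polynomial of \<open>x\<close>. As a divisor of a
polynomial with simple roots it has simple roots, so it has as many as its degree. The coefficients may lie in
a smaller \<open>k\<close> on which \<open>\<tau>\<close> is known: this is what the induction along a tower needs.\<close>

lemma (in subfield_hom) card_simple_extension_hom:
  assumes A: "algebraically_closed A" and k: "subring k S" "k \<subseteq> B" "\<And>c. c \<in> k \<Longrightarrow> \<tau> c = \<sigma> c"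
    and x: "x \<in> carrier S" "root_of_simple_rooted S A k \<sigma> x"
  shows "(S.algebraic over B) x"
    and "finite (hom_extensions S A B \<tau> (S.simple_extension B x))"
    and "card (hom_extensions S A B \<tau> (S.simple_extension B x)) = S.dim B (S.simple_extension B x)"
proof -
  interpret Ac: algebraically_closed A by (rule A)
  obtain p where p: "p \<in> carrier (k[X]\<^bsub>S\<^esub>)" "p \<noteq> []" "S.eval p x = \<zero>\<^bsub>S\<^esub>"
    "\<And>a. a \<in> carrier A \<Longrightarrow> A.alg_mult (map \<sigma> p) a \<le> 1"
    using x(2) unfolding root_of_simple_rooted_def by blast
  have pk: "set p \<subseteq> k" using S.polynomial_incl[of k p] p(1) by (simp add: univ_poly_carrier)
  have pB: "p \<in> carrier (B[X]\<^bsub>S\<^esub>)"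
    using p(1) k(2) by (auto simp: univ_poly_carrier[symmetric] polynomial_def)
  have map: "map \<sigma> p = map \<tau> p" using pk k(3) by auto
  show alg: "(S.algebraic over B) x"
    using S.algebraicI[OF pB p(2,3)] .
  note Irr = S.IrrE[OF B x(1) alg]
  have Irr0: "S.Irr B x \<noteq> []" using Irr(1,2) S.pirreducibleE(1)[OF Br] by blast
  let ?P = "map \<tau> (S.Irr B x)"
  have "S.Irr B x divides\<^bsub>B[X]\<^bsub>S\<^esub>\<^esub> p"
    using S.Irr_minimal[OF B x(1) alg pB p(3)] S.pdivides_iff_shell[OF B Irr(1) pB] by simp
  then obtain q where q: "q \<in> carrier (B[X]\<^bsub>S\<^esub>)" "p = S.Irr B x \<otimes>\<^bsub>B[X]\<^bsub>S\<^esub>\<^esub> q"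
    unfolding factor_def by blast
  have "?P pdivides\<^bsub>A\<^esub> map \<tau> p"
    unfolding q(2) map_mult[OF Irr(1) q(1)] pdivides_def using map_poly[OF q(1)] by (rule dividesI[OF _ refl])
  then have "A.roots ?P \<subseteq># A.roots (map \<tau> p)"
    using A.pdivides_imp_roots_incl[OF map_poly[OF Irr(1)] map_poly[OF pB]] p(2) by simp
  then have "A.alg_mult ?P a \<le> 1" if "a \<in> carrier A" for a
    using p(4)[OF that] unfolding map A.alg_mult_eq_count_roots[OF map_poly[OF Irr(1)]]
      A.alg_mult_eq_count_roots[OF map_poly[OF pB]] by (meson le_trans mset_subset_eq_count)
  note cr = Ac.card_roots[OF map_poly[OF Irr(1)] _ this]
  have "finite {a \<in> carrier A. ev a (S.Irr B x) = \<zero>\<^bsub>A\<^esub>}"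
    "card {a \<in> carrier A. ev a (S.Irr B x) = \<zero>\<^bsub>A\<^esub>} = length (S.Irr B x) - 1"
    using cr Irr0 unfolding ev_def by simp_all
  then show "finite (hom_extensions S A B \<tau> (S.simple_extension B x))"
    "card (hom_extensions S A B \<tau> (S.simple_extension B x)) = S.dim B (S.simple_extension B x)"
    using bij_betw_finite[OF simple_extension_hom_bij[OF x(1) alg]]
      bij_betw_same_card[OF simple_extension_hom_bij[OF x(1) alg]] S.simple_extension_dim[OF B x(1) alg]
    by (simp_all add: over_def)
qed

text \<open>Induction along the tower: each extension to \<open>D\<close> has \<open>[D(x) : D]\<close> extensions to \<open>D(x)\<close>, and degrees multiply.\<close>

lemma (in subfield_hom) card_finite_extension_hom:
  assumes A: "algebraically_closed A"
    and "set xs \<subseteq> carrier S" "\<And>x. x \<in> set xs \<Longrightarrow> root_of_simple_rooted S A B \<tau> x"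
  shows "finite (hom_extensions S A B \<tau> (S.finite_extension B xs)) \<and>
    card (hom_extensions S A B \<tau> (S.finite_extension B xs)) = S.dim B (S.finite_extension B xs) \<and>
    subfield (S.finite_extension B xs) S \<and> S.finite_dimension B (S.finite_extension B xs)"
  using assms(2,3)
proof (induction xs)
  case Nil
  have "hom_extensions S A B \<tau> B = {restrict \<tau> B}"
  proof (intro equalityI subsetI)
    fix t assume "t \<in> hom_extensions S A B \<tau> B"
    then show "t \<in> {restrict \<tau> B}"
      by (auto simp: hom_extensions_def extensional_def restrict_def fun_eq_iff)
  next
    fix t assume "t \<in> {restrict \<tau> B}"
    then show "t \<in> hom_extensions S A B \<tau> B"
      using hom subringE(6,7)[OF Br] subringE(3)[OF Br] by (auto simp: hom_extensions_def ring_hom_def)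
  qed
  then show ?case
    using S.dimI[OF B S.dimension_one[OF B]] S.finite_dimensionI[OF S.dimension_one[OF B]] B by (simp add: over_def)
next
  case (Cons x xs)
  define D where "D = S.finite_extension B xs"
  have IH: "finite (hom_extensions S A B \<tau> D)" "card (hom_extensions S A B \<tau> D) = S.dim B D" "subfield D S" "S.finite_dimension B D"
    using Cons unfolding D_def by simp_all
  have BD: "B \<subseteq> D"
    unfolding D_def using S.finite_extension_incl[OF subfieldE(3)[OF B]] Cons.prems(1) by simp
  have x: "x \<in> carrier S" "root_of_simple_rooted S A B \<tau> x" using Cons.prems by auto
  let ?E = "S.simple_extension D x"
  have E: "S.finite_extension B (x # xs) = ?E" by (simp add: D_def)
  have DE: "D \<subseteq> ?E" by (rule S.simple_extension_incl[OF subfieldE(3)[OF IH(3)] x(1)])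
  have sh: "subfield_hom S A D t" if "t \<in> hom_extensions S A B \<tau> D" for t
    using that IH(3) S.field_axioms A.field_axioms
    by (simp add: hom_extensions_def subfield_hom_def subfield_hom_axioms_def)
  have one: "(S.algebraic over D) x" "finite (hom_extensions S A D t ?E)"
      "card (hom_extensions S A D t ?E) = S.dim D ?E" if t: "t \<in> hom_extensions S A B \<tau> D" for t
    using subfield_hom.card_simple_extension_hom[OF sh[OF t] A Br BD _ x, of] t
    unfolding hom_extensions_def by auto
  have alg: "(S.algebraic over D) x"
  proof -
    obtain p where p: "p \<in> carrier (B[X]\<^bsub>S\<^esub>)" "p \<noteq> []" "S.eval p x = \<zero>\<^bsub>S\<^esub>"
      using x(2) unfolding root_of_simple_rooted_def by blast
    show ?thesis
      using S.algebraic_mono[OF BD S.algebraicI[OF p]] .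
  qed
  have sfE: "subfield ?E S" using S.simple_extension_is_subfield[OF IH(3) x(1)] alg by simp
  have finE: "S.finite_dimension D ?E" using S.finite_dimension_simple_extension[OF IH(3) x(1)] alg by simp
  note tower = S.telescopic_base_dim[OF B IH(3,4) finE]
  have un: "hom_extensions S A B \<tau> ?E = (\<Union>t \<in> hom_extensions S A B \<tau> D. hom_extensions S A D t ?E)"
  proof (intro equalityI subsetI)
    fix s assume s: "s \<in> hom_extensions S A B \<tau> ?E"
    have "restrict s D \<in> ring_hom (S\<lparr>carrier := D\<rparr>) A"
      using s DE subringE(3,6,7)[OF subfieldE(1)[OF IH(3)]] unfolding hom_extensions_def ring_hom_def by (auto dest!: subsetD[OF DE])
    then have "restrict s D \<in> hom_extensions S A B \<tau> D"
      using s BD unfolding hom_extensions_def by auto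
    moreover have "s \<in> hom_extensions S A D (restrict s D) ?E"
      using s unfolding hom_extensions_def by auto
    ultimately show "s \<in> (\<Union>t \<in> hom_extensions S A B \<tau> D. hom_extensions S A D t ?E)" by blast
  next
    fix s assume "s \<in> (\<Union>t \<in> hom_extensions S A B \<tau> D. hom_extensions S A D t ?E)"
    then show "s \<in> hom_extensions S A B \<tau> ?E"
      using BD unfolding hom_extensions_def by auto
  qed
  have disj: "hom_extensions S A D t ?E \<inter> hom_extensions S A D t' ?E = {}"
    if t: "t \<in> hom_extensions S A B \<tau> D" "t' \<in> hom_extensions S A B \<tau> D" "t \<noteq> t'" for t t'
  proof -
    have "\<exists>y\<in>D. t y \<noteq> t' y"
      using t extensionalityI[of t D t'] unfolding hom_extensions_def by blast
    then show ?thesis unfolding hom_extensions_def by force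
  qed
  have "card (hom_extensions S A B \<tau> ?E) = (\<Sum>t \<in> hom_extensions S A B \<tau> D. card (hom_extensions S A D t ?E))"
    unfolding un using IH(1) one(2) disj by (intro card_UN_disjoint) auto
  also have "\<dots> = S.dim B ?E"
    using one(3) IH(2) tower(2) by (simp add: over_def)
  finally show ?case
    unfolding E using un IH(1) one(2) sfE tower(1) by simp
qed

section \<open>Separable polynomials have simple roots\<close>

text \<open>The coefficients of \<open>(t - a) q\<close>, for \<open>q = \<Sum> c\<^sub>i t\<^sup>i\<close>, are \<open>c\<^sub>i - a c\<^sub>i\<^sub>+\<^sub>1\<close> in degree \<open>i + 1\<close>. The value of its derivative at \<open>a\<close> is
\<open>\<Sum> (i + 1) (c\<^sub>i a\<^sup>i - c\<^sub>i\<^sub>+\<^sub>1 a\<^sup>i\<^sup>+\<^sup>1)\<close>, which telescopes to the value of \<open>q\<close> at \<open>a\<close>, up to a boundary term that vanishes beyond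
the degree. This avoids the product rule.\<close>

lemma (in cring) eval_deriv_telescope:
  assumes c: "\<And>i. c i \<in> carrier R" and a: "a \<in> carrier R"
  shows "eval (map (\<lambda>i. [Suc i] \<cdot> (c i \<oplus> (\<ominus> a) \<otimes> c (Suc i))) (rev [0..<n])) a
    = eval (map c (rev [0..<n])) a \<ominus> [n] \<cdot> (c n \<otimes> a [^] n)"
proof (induction n)
  case 0
  then show ?case by (simp add: a_minus_def)
next
  case (Suc n)
  let ?E = "eval (map c (rev [0..<n])) a" and ?z = "c n \<otimes> a [^] n" and ?w = "c (Suc n) \<otimes> a [^] Suc n"
  have E: "?E \<in> carrier R" using c a by (intro eval_in_carrier) auto
  have cc: "c n \<in> carrier R" "c (Suc n) \<in> carrier R" "a [^] n \<in> carrier R" using c a by auto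
  have "(p \<oplus> (\<ominus> a) \<otimes> q) \<otimes> r = p \<otimes> r \<oplus> \<ominus> (q \<otimes> (r \<otimes> a))"
    if "p \<in> carrier R" "q \<in> carrier R" "r \<in> carrier R" for p q r
    using that a by algebra
  from this[OF cc] have 1: "(c n \<oplus> (\<ominus> a) \<otimes> c (Suc n)) \<otimes> a [^] n = ?z \<oplus> \<ominus> ?w"
    by simp
  have zw: "?z \<in> carrier R" "?w \<in> carrier R" using cc a by simp_all
  have "[Suc n] \<cdot> (c n \<oplus> (\<ominus> a) \<otimes> c (Suc n)) \<otimes> a [^] n = [Suc n] \<cdot> (?z \<oplus> \<ominus> ?w)"
    using add_pow_ldistr[of "c n \<oplus> (\<ominus> a) \<otimes> c (Suc n)" "a [^] n" "Suc n"] cc a 1 by (simp only: a_closed m_closed a_inv_closed)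
  also have "\<dots> = [Suc n] \<cdot> ?z \<oplus> \<ominus> ([Suc n] \<cdot> ?w)"
    using add.nat_pow_distrib[OF zw(1) a_inv_closed[OF zw(2)], of "Suc n"] add.nat_pow_inv[OF zw(2), of "Suc n"] by simp
  also have "\<dots> = ([n] \<cdot> ?z \<oplus> ?z) \<oplus> \<ominus> ([Suc n] \<cdot> ?w)"
    by (simp only: add.nat_pow_Suc)
  finally have "eval (map (\<lambda>i. [Suc i] \<cdot> (c i \<oplus> (\<ominus> a) \<otimes> c (Suc i))) (rev [0..<Suc n])) a
      = (([n] \<cdot> ?z \<oplus> ?z) \<oplus> \<ominus> ([Suc n] \<cdot> ?w)) \<oplus> (?E \<ominus> [n] \<cdot> ?z)"
    using Suc.IH by simp
  also have "\<dots> = (?z \<oplus> ?E) \<ominus> [Suc n] \<cdot> ?w"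
  proof -
    have "((p \<oplus> z) \<oplus> \<ominus> w) \<oplus> (e \<ominus> p) = (z \<oplus> e) \<ominus> w"
      if "p \<in> carrier R" "z \<in> carrier R" "w \<in> carrier R" "e \<in> carrier R" for p z w e
      using that by algebra
    then show ?thesis using cc a E by (simp del: add.nat_pow_Suc nat_pow_Suc)
  qed
  finally show ?case using cc a E by simp
qed

lemma (in ring) eval_poly_deriv:
  assumes "set p \<subseteq> carrier R" "a \<in> carrier R"
  shows "eval (poly_deriv p) a = eval (map (\<lambda>i. [Suc i] \<cdot> coeff p (Suc i)) (rev [0..<degree p])) a"
  unfolding poly_deriv_def using assms coeff_in_carrier[OF assms(1)] by (intro eval_normalize) auto

text \<open>The product rule at a root: the derivative of \<open>(t - a) q\<close> takes the value of \<open>q\<close> at \<open>a\<close>.\<close>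

lemma (in domain) eval_deriv_linear_factor:
  assumes a: "a \<in> carrier R" and q: "q \<in> carrier (poly_ring R)" "q \<noteq> []"
  shows "eval (poly_deriv ([\<one>, \<ominus> a] \<otimes>\<^bsub>poly_ring R\<^esub> q)) a = eval q a"
proof -
  have qs: "set q \<subseteq> carrier R"
    using q(1) polynomial_incl by (simp add: univ_poly_carrier[symmetric])
  have lin: "polynomial (carrier R) [\<one>, \<ominus> a]" using a by (simp add: polynomial_def)
  define P where "P = [\<one>, \<ominus> a] \<otimes>\<^bsub>poly_ring R\<^esub> q"
  have P: "P = poly_mult [\<one>, \<ominus> a] q" by (simp add: P_def univ_poly_mult)
  have Ps: "set P \<subseteq> carrier R" unfolding P using a qs by (intro poly_mult_in_carrier) auto
  have deg: "degree P = length q"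
    using poly_mult_degree_eq[OF carrier_is_subring lin, of q] q by (simp add: P univ_poly_carrier[symmetric] Suc_leI)
  have c: "coeff P (Suc i) = coeff q i \<oplus> (\<ominus> a) \<otimes> coeff q (Suc i)" for i
  proof -
    have m: "map (\<lambda>b. \<one> \<otimes> b) q = q" using qs by (induction q) auto
    \<comment> \<open>With leading coefficients first, \<open>q @ [\<zero>]\<close> is \<open>q\<close> times the variable.\<close>
    have "P = poly_add (q @ [\<zero>]) (poly_mult [\<ominus> a] q)"
      unfolding P by (simp add: m)
    then have "coeff P (Suc i) = coeff (q @ [\<zero>]) (Suc i) \<oplus> coeff (poly_mult [\<ominus> a] q) (Suc i)"
      using poly_add_coeff[of "q @ [\<zero>]" "poly_mult [\<ominus> a] q"] qs a poly_mult_in_carrier[of "[\<ominus> a]" q] by simp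
    moreover have "coeff (q @ [\<zero>]) (Suc i) = coeff q i"
      by (simp add: append_coeff)
    moreover have "coeff (poly_mult [\<ominus> a] q) (Suc i) = (\<ominus> a) \<otimes> coeff q (Suc i)"
      unfolding poly_mult_const'(1)[OF qs a_inv_closed[OF a]] normalize_coeff[symmetric]
        scalar_coeff[OF a_inv_closed[OF a]] ..
    ultimately show ?thesis by simp
  qed
  have "eval (poly_deriv P) a = eval (map (coeff q) (rev [0..<length q])) a \<ominus> [length q] \<cdot> (coeff q (length q) \<otimes> a [^] length q)"
    using eval_poly_deriv[OF Ps a] eval_deriv_telescope[of "coeff q" a "length q"] qs a unfolding deg c by simp
  also have "\<dots> = eval q a"
    using coeff_length[of q "length q"] a qs eval_in_carrier[OF qs a] coeff_list[of q] by (simp add: a_minus_def)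
  finally show ?thesis by (simp add: P_def)
qed

lemma (in domain) poly_deriv_closed:
  assumes k: "subring k R" and p: "p \<in> carrier (k[X])"
  shows "poly_deriv p \<in> carrier (k[X])"
proof -
  have "set p \<subseteq> k" using p polynomial_incl by (simp add: univ_poly_carrier[symmetric])
  then have ck: "coeff p i \<in> k" for i
  proof -
    have "coeff p i \<in> set p \<union> {\<zero>}" using coeff_img(3)[of p] by (metis rangeI)
    then show ?thesis using \<open>set p \<subseteq> k\<close> subringE(2)[OF k] by auto
  qed
  have "[n] \<cdot> c \<in> k" if "c \<in> k" for n :: nat and c
    using that subringE(1,2,7)[OF k] by (induction n) auto
  then show ?thesis
    unfolding poly_deriv_def univ_poly_carrier[symmetric] using ck \<open>\<And>c n. c \<in> k \<Longrightarrow> [n] \<cdot> c \<in> k\<close>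
    by (intro normalize_gives_polynomial) (auto simp del: add.nat_pow_Suc)
qed

lemma (in domain) separable_bezout:
  assumes k: "subfield k R" and p: "separable_poly k p"
  obtains u w where "u \<in> carrier (k[X])" "w \<in> carrier (k[X])"
    "\<one>\<^bsub>k[X]\<^esub> = u \<otimes>\<^bsub>k[X]\<^esub> p \<oplus>\<^bsub>k[X]\<^esub> w \<otimes>\<^bsub>k[X]\<^esub> poly_deriv p"
proof -
  interpret P: principal_domain "k[X]" by (rule univ_poly_is_principal[OF k])
  have pc: "p \<in> carrier (k[X])" using p by (simp add: separable_poly_def)
  note dc = poly_deriv_closed[OF subfieldE(1)[OF k] pc]
  obtain d where d: "d \<in> carrier (k[X])" "PIdl\<^bsub>k[X]\<^esub> p <+>\<^bsub>k[X]\<^esub> PIdl\<^bsub>k[X]\<^esub> (poly_deriv p) = PIdl\<^bsub>k[X]\<^esub> d"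
    using P.exists_gen[OF P.add_ideals[OF P.cgenideal_ideal[OF pc] P.cgenideal_ideal[OF dc]]] by blast
  then have "d gcdof\<^bsub>k[X]\<^esub> p (poly_deriv p)"
    using P.ideal_sum_iff_gcd[OF pc dc d(1)] by simp
  then have "d \<in> Units (k[X])"
    using p d(1) unfolding separable_poly_def isgcd_def by blast
  then obtain y where "y \<in> carrier (k[X])" "y \<otimes>\<^bsub>k[X]\<^esub> d = \<one>\<^bsub>k[X]\<^esub>"
    using P.Units_l_inv_ex by blast
  then have "\<one>\<^bsub>k[X]\<^esub> \<in> PIdl\<^bsub>k[X]\<^esub> d"
    unfolding cgenideal_def by (intro CollectI exI[of _ y]) simp
  then have "\<one>\<^bsub>k[X]\<^esub> \<in> PIdl\<^bsub>k[X]\<^esub> p <+>\<^bsub>k[X]\<^esub> PIdl\<^bsub>k[X]\<^esub> (poly_deriv p)"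
    using d(2) by simp
  then show ?thesis
    using that unfolding set_add_def' cgenideal_def by blast
qed

text \<open>A multiple root \<open>a\<close> of the image of \<open>p\<close> is also a root of the image of the derivative. But over \<open>B\<close> there is a
Bezout relation \<open>1 = u p + w p'\<close>, whose image vanishes at \<open>a\<close>.\<close>

lemma (in subfield_hom) separable_simple_roots:
  assumes p: "S.separable_poly B p" "p \<noteq> []" and a: "a \<in> carrier A"
  shows "A.alg_mult (map \<tau> p) a \<le> 1"
proof (rule ccontr)
  interpret AP: domain "poly_ring A" by (rule A.univ_poly_is_domain[OF A.carrier_is_subring])
  interpret SP: domain "B[X]\<^bsub>S\<^esub>" by (rule S.univ_poly_is_domain[OF Br])
  assume "\<not> A.alg_mult (map \<tau> p) a \<le> 1"
  then have "2 \<le> A.alg_mult (map \<tau> p) a" by simp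
  have pc: "p \<in> carrier (B[X]\<^bsub>S\<^esub>)" using p(1) by (simp add: S.separable_poly_def)
  let ?l = "[\<one>\<^bsub>A\<^esub>, \<ominus>\<^bsub>A\<^esub> a]" and ?P = "map \<tau> p"
  have l: "?l \<in> carrier (poly_ring A)" using a by (simp add: univ_poly_carrier[symmetric] polynomial_def)
  have "(?l [^]\<^bsub>poly_ring A\<^esub> (2::nat)) pdivides\<^bsub>A\<^esub> ?P"
    using A.le_alg_mult_imp_pdivides[OF a map_poly[OF pc] \<open>2 \<le> A.alg_mult (map \<tau> p) a\<close>] .
  then obtain s where s: "s \<in> carrier (poly_ring A)" "?P = ?l [^]\<^bsub>poly_ring A\<^esub> (2::nat) \<otimes>\<^bsub>poly_ring A\<^esub> s"
    unfolding pdivides_def factor_def by blast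
  have P: "?P = ?l \<otimes>\<^bsub>poly_ring A\<^esub> (?l \<otimes>\<^bsub>poly_ring A\<^esub> s)"
    unfolding s(2) using l s(1) by (simp add: numeral_2_eq_2 AP.m_assoc)
  have ls: "?l \<otimes>\<^bsub>poly_ring A\<^esub> s \<in> carrier (poly_ring A)" using l s(1) by simp
  interpret E: ring_hom_ring "poly_ring A" A "\<lambda>p. A.eval p a"
    by (rule A.eval_ring_hom[OF A.carrier_is_subring a])
  have l0: "A.eval ?l a = \<zero>\<^bsub>A\<^esub>" using a by (simp add: A.r_neg)
  have ls0: "A.eval (?l \<otimes>\<^bsub>poly_ring A\<^esub> s) a = \<zero>\<^bsub>A\<^esub>"
    using E.hom_mult[OF l s(1)] l0 s(1) by simp
  have "?l \<otimes>\<^bsub>poly_ring A\<^esub> s \<noteq> []"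
  proof
    assume "?l \<otimes>\<^bsub>poly_ring A\<^esub> s = []"
    then have "?P = []" using P AP.r_null[OF l] by (simp add: univ_poly_zero)
    then show False using p(2) by simp
  qed
  then have dP: "A.eval (A.poly_deriv ?P) a = \<zero>\<^bsub>A\<^esub>"
    unfolding P using A.eval_deriv_linear_factor[OF a ls] ls0 by simp
  have P0: "ev a p = \<zero>\<^bsub>A\<^esub>"
    unfolding ev_def P using E.hom_mult[OF l ls] l0 ls by simp
  have dc: "S.poly_deriv p \<in> carrier (B[X]\<^bsub>S\<^esub>)"
    by (rule S.poly_deriv_closed[OF Br pc])
  have pB: "set p \<subseteq> B" by (rule poly_set[OF pc])
  have ck: "S.coeff p i \<in> B" for i
  proof -
    have "S.coeff p i \<in> set p \<union> {\<zero>\<^bsub>S\<^esub>}" using S.coeff_img(3)[of p] by (metis rangeI)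
    then show ?thesis using pB subringE(2)[OF Br] by auto
  qed
  have nk: "add_pow S n c \<in> B \<and> \<tau> (add_pow S n c) = add_pow A n (\<tau> c)" if "c \<in> B" for n :: nat and c
    using that subringE(1,2,7)[OF Br] \<tau>_closed \<tau>_eq_zero_iff[of "\<zero>\<^bsub>S\<^esub>"] H.hom_add[of _ c] by (induction n) auto
  let ?D = "map (\<lambda>i. add_pow S (Suc i) (S.coeff p (Suc i))) (rev [0..<length p - 1])"
  have m1: "map \<tau> ?D = map (\<lambda>i. add_pow A (Suc i) (A.coeff ?P (Suc i))) (rev [0..<length ?P - 1])"
  proof -
    have "\<tau> (S.coeff p i) = A.coeff ?P i" for i
      using H.coeff_hom'[of p i] pB S.coeff_consistent[OF Br] by simp
    then show ?thesis using ck nk by (simp del: S.add.nat_pow_Suc A.add.nat_pow_Suc)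
  qed
  have m2: "A.eval (map \<tau> ?D) a = A.eval (map \<tau> (S.normalize ?D)) a"
  proof -
    obtain n where n: "?D = replicate n \<zero>\<^bsub>S\<^esub> @ S.normalize ?D"
      using S.normalize_trick[of ?D] by blast
    have "map \<tau> ?D = replicate n \<zero>\<^bsub>A\<^esub> @ map \<tau> (S.normalize ?D)"
      by (subst n) (use \<tau>_eq_zero_iff[of "\<zero>\<^bsub>S\<^esub>"] subringE(2)[OF Br] in simp)
    moreover have "set (map \<tau> (S.normalize ?D)) \<subseteq> carrier A"
      using map_set[OF dc] by (simp add: S.poly_deriv_def)
    ultimately show ?thesis
      using A.eval_replicate[OF _ a] by simp
  qed
  have "ev a (S.poly_deriv p) = A.eval (map \<tau> ?D) a"
    by (simp only: ev_def S.poly_deriv_def m2)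
  also have "\<dots> = A.eval (A.poly_deriv ?P) a"
    by (simp only: m1 A.eval_poly_deriv[OF map_set[OF pc] a])
  finally have "ev a (S.poly_deriv p) = A.eval (A.poly_deriv ?P) a" .
  then have dP0: "ev a (S.poly_deriv p) = \<zero>\<^bsub>A\<^esub>" using dP by simp
  obtain u w where uw: "u \<in> carrier (B[X]\<^bsub>S\<^esub>)" "w \<in> carrier (B[X]\<^bsub>S\<^esub>)"
    "\<one>\<^bsub>B[X]\<^bsub>S\<^esub>\<^esub> = u \<otimes>\<^bsub>B[X]\<^bsub>S\<^esub>\<^esub> p \<oplus>\<^bsub>B[X]\<^bsub>S\<^esub>\<^esub> w \<otimes>\<^bsub>B[X]\<^bsub>S\<^esub>\<^esub> S.poly_deriv p"
    using S.separable_bezout[OF B p(1)] by blast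
  note evh = ring_hom_memE[OF ev_hom[OF a]]
  have "ev a \<one>\<^bsub>B[X]\<^bsub>S\<^esub>\<^esub> = ev a u \<otimes>\<^bsub>A\<^esub> ev a p \<oplus>\<^bsub>A\<^esub> ev a w \<otimes>\<^bsub>A\<^esub> ev a (S.poly_deriv p)"
    unfolding uw(3) using uw(1,2) pc dc by (simp add: evh)
  then show False
    using evh(1)[OF uw(1)] evh(1)[OF uw(2)] by (simp add: evh(4) P0 dP0)
qed

text \<open>The minimal polynomial over \<open>k\<close> may become reducible over \<open>k'\<close>, but it keeps its simple roots
in \<open>A\<close>. So it is a witness also for the image of \<open>x\<close> in a larger field.\<close>

lemma separable_imp_root_of_simple_rooted:
  assumes L: "field L" and S: "field S" and A: "field A"
    and k: "subfield k L" and x: "x \<in> carrier L" "ring.separable_element L k x"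
    and e: "e \<in> ring_hom L S" and k': "subfield k' S" "e ` k \<subseteq> k'" and \<sigma>: "\<sigma> \<in> ring_hom (S\<lparr>carrier := k'\<rparr>) A"
  shows "root_of_simple_rooted S A k' \<sigma> (e x)"
proof -
  interpret L: field L by (rule L)
  interpret S: field S by (rule S)
  interpret A: field A by (rule A)
  interpret e: ring_hom_ring L S e by (rule ring_hom_ringI2[OF L.ring_axioms S.ring_axioms e])
  have x': "(L.algebraic over k) x" "L.separable_poly k (L.Irr k x)"
    using x(2) by (auto simp: L.separable_element_def)
  note Irr = L.IrrE[OF k x(1) x'(1)]
  let ?p = "L.Irr k x"
  have p0: "?p \<noteq> []" using L.pirreducibleE(1)[OF subfieldE(1)[OF k] Irr(1,2)] .
  have pk: "set ?p \<subseteq> k" using Irr(1) L.polynomial_incl by (simp add: univ_poly_carrier[symmetric])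
  have kc: "k \<subseteq> carrier L" by (rule subfieldE(3)[OF k])
  have "\<sigma> \<circ> e \<in> ring_hom (L\<lparr>carrier := k\<rparr>) A"
    using ring_hom_memE[OF \<sigma>] k'(2) kc by (intro ring_hom_memI) (auto simp: image_subset_iff subset_iff)
  then have sh: "subfield_hom L A k (\<sigma> \<circ> e)"
    using L A k by (simp add: subfield_hom_def subfield_hom_axioms_def)
  have "map e ?p \<in> carrier ((e ` k)[X]\<^bsub>S\<^esub>)"
    by (rule e.subfield_polynomial_hom[OF k _ Irr(1)]) simp
  moreover have "set (map e ?p) \<subseteq> k'" using pk k'(2) by auto
  ultimately have "map e ?p \<in> carrier (k'[X]\<^bsub>S\<^esub>)"
    using p0 by (auto simp: univ_poly_carrier[symmetric] polynomial_def)
  moreover have "S.eval (map e ?p) (e x) = \<zero>\<^bsub>S\<^esub>"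
    using e.eval_hom[OF subfieldE(1)[OF k] x(1) Irr(1)] Irr(4) by simp
  moreover have "A.alg_mult (map \<sigma> (map e ?p)) a \<le> 1" if "a \<in> carrier A" for a
    using subfield_hom.separable_simple_roots[OF sh x'(2) p0 that] by simp
  ultimately show ?thesis
    unfolding root_of_simple_rooted_def using p0 by (intro bexI[of _ "map e ?p"]) auto
qed


section \<open>Homomorphisms into an algebraically closed field extend\<close>

text \<open>Zorn's lemma on partial extensions \<open>(D, t)\<close>; a maximal one is defined on all of \<open>S\<close>, because it extends to \<open>D(x)\<close> by a
root of the minimal polynomial of \<open>x\<close>.\<close>

lemma algebraic_extension_hom:
  fixes S :: "('a, 'x) ring_scheme" and A :: "('c, 'y) ring_scheme" and B :: "'a set" and \<tau> :: "'a \<Rightarrow> 'c"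
  assumes A: "algebraically_closed A" and sh: "subfield_hom S A B \<tau>"
    and alg: "\<And>x. x \<in> carrier S \<Longrightarrow> (ring.algebraic S over B) x"
  shows "\<exists>h \<in> ring_hom S A. \<forall>c \<in> B. h c = \<tau> c"
proof -
  interpret A: algebraically_closed A by (rule A)
  interpret S: field S using sh by (simp add: subfield_hom_def)
  have B: "subfield B S" "\<tau> \<in> ring_hom (S\<lparr>carrier := B\<rparr>) A"
    using sh by (auto simp: subfield_hom_def subfield_hom_axioms_def)
  define \<A> where "\<A> = {(D, t). subfield D S \<and> B \<subseteq> D \<and> t \<in> hom_extensions S A B \<tau> D}"
  define P :: "'a set \<times> ('a \<Rightarrow> 'c) \<Rightarrow> 'a set \<times> ('a \<Rightarrow> 'c) \<Rightarrow> bool"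
    where "P = (\<lambda>(D, t) (D', t'). D \<subseteq> D' \<and> (\<forall>x\<in>D. t x = t' x))"
  have po: "partial_order_on \<A> (relation_of P \<A>)"
  proof (rule partial_order_on_relation_ofI)
    show "P a a" for a by (simp add: P_def split: prod.split)
    show "P a c" if "P a b" "P b c" for a b c
      using that unfolding P_def by (auto split: prod.splits)
    show "a = b" if "a \<in> \<A>" "b \<in> \<A>" "P a b" "P b a" for a b
    proof -
      obtain D t D' t' where ab: "a = (D, t)" "b = (D', t')" by (cases a, cases b)
      have "D = D'" using that(3,4) unfolding ab P_def by auto
      moreover have "t = t'"
        by (rule extensionalityI[of t D]) (use that calculation in \<open>auto simp: ab P_def \<A>_def hom_extensions_def\<close>)
      ultimately show ?thesis by (simp add: ab)
    qed
  qed
  have "\<exists>m\<in>\<A>. \<forall>a\<in>\<A>. P m a \<longrightarrow> a = m"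
  proof (rule predicate_Zorn[OF po])
    fix C assume C: "C \<in> Chains (relation_of P \<A>)"
    have CA: "c \<in> \<A>" if "c \<in> C" for c
      using C that unfolding Chains_def relation_of_def by auto
    have chain: "P c c' \<or> P c' c" if "c \<in> C" "c' \<in> C" for c c'
      using C that unfolding Chains_def relation_of_def by auto
    show "\<exists>u\<in>\<A>. \<forall>a\<in>C. P a u"
    proof (cases "C = {}")
      case True
      have "restrict \<tau> B \<in> ring_hom (S\<lparr>carrier := B\<rparr>) A"
        using ring_hom_memE[OF B(2)] subringE(3,6,7)[OF subfieldE(1)[OF B(1)]] by (intro ring_hom_memI) auto
      then have "(B, restrict \<tau> B) \<in> \<A>"
        using B(1) by (simp add: \<A>_def hom_extensions_def)
      then show ?thesis using True by blast
    next
      case False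
      define U where "U = {x. \<exists>D s. (D, s) \<in> C \<and> x \<in> D}"
      define t where "t = (\<lambda>x\<in>U. SOME r. \<exists>D s. (D, s) \<in> C \<and> x \<in> D \<and> r = s x)"
      have mem: "subfield D S" "B \<subseteq> D" "s \<in> extensional D" "s \<in> ring_hom (S\<lparr>carrier := D\<rparr>) A" "\<forall>c\<in>B. s c = \<tau> c"
        if "(D, s) \<in> C" for D s
        using CA[OF that] by (simp_all add: \<A>_def hom_extensions_def)
      have chain': "D \<subseteq> D' \<and> (\<forall>x\<in>D. s x = s' x) \<or> D' \<subseteq> D \<and> (\<forall>x\<in>D'. s' x = s x)"
        if "(D, s) \<in> C" "(D', s') \<in> C" for D s D' s'
        using chain[OF that] by (simp add: P_def)
      have t: "t x = s x" if "(D, s) \<in> C" "x \<in> D" for D s x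
      proof -
        have xU: "x \<in> U" using that unfolding U_def by blast
        have "\<exists>r. \<exists>D s. (D, s) \<in> C \<and> x \<in> D \<and> r = s x" using that by blast
        from someI_ex[OF this] obtain D' s' where c: "(D', s') \<in> C" "x \<in> D'" "t x = s' x"
          using xU unfolding t_def by auto
        show ?thesis
          using chain'[OF c(1) that(1)] c that by auto
      qed
      have pair: "\<exists>D s. (D, s) \<in> C \<and> x \<in> D \<and> y \<in> D" if xy: "x \<in> U" "y \<in> U" for x y
      proof -
        obtain D s D' s' where c: "(D, s) \<in> C" "x \<in> D" "(D', s') \<in> C" "y \<in> D'"
          using xy unfolding U_def by blast
        show ?thesis using chain'[OF c(1,3)] c by blast
      qed
      have sub: "D \<subseteq> U" if "(D, s) \<in> C" for D s using that unfolding U_def by blast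
      have Uc: "U \<subseteq> carrier S" using subfieldE(3)[OF mem(1)] unfolding U_def by blast
      obtain D0 s0 where 0: "(D0, s0) \<in> C" using False by auto
      have one: "\<one>\<^bsub>S\<^esub> \<in> U" using subringE(3)[OF subfieldE(1)[OF mem(1)[OF 0]]] sub[OF 0] by blast
      have ops: "\<ominus>\<^bsub>S\<^esub> x \<in> U" "x \<otimes>\<^bsub>S\<^esub> y \<in> U" "x \<oplus>\<^bsub>S\<^esub> y \<in> U"
        "t (x \<otimes>\<^bsub>S\<^esub> y) = t x \<otimes>\<^bsub>A\<^esub> t y" "t (x \<oplus>\<^bsub>S\<^esub> y) = t x \<oplus>\<^bsub>A\<^esub> t y" "t x \<in> carrier A"
        "x \<noteq> \<zero>\<^bsub>S\<^esub> \<longrightarrow> inv\<^bsub>S\<^esub> x \<in> U"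
        if xy: "x \<in> U" "y \<in> U" for x y
      proof -
        obtain D s where D: "(D, s) \<in> C" "x \<in> D" "y \<in> D" using pair[OF xy] by blast
        note Dr = subringE[OF subfieldE(1)[OF mem(1)[OF D(1)]]]
        have c: "\<ominus>\<^bsub>S\<^esub> x \<in> D" "x \<otimes>\<^bsub>S\<^esub> y \<in> D" "x \<oplus>\<^bsub>S\<^esub> y \<in> D" using Dr(5-7) D by auto
        then show "\<ominus>\<^bsub>S\<^esub> x \<in> U" "x \<otimes>\<^bsub>S\<^esub> y \<in> U" "x \<oplus>\<^bsub>S\<^esub> y \<in> U" using sub[OF D(1)] by auto
        note h = ring_hom_memE[OF mem(4)[OF D(1)]]
        show "t (x \<otimes>\<^bsub>S\<^esub> y) = t x \<otimes>\<^bsub>A\<^esub> t y" "t (x \<oplus>\<^bsub>S\<^esub> y) = t x \<oplus>\<^bsub>A\<^esub> t y" "t x \<in> carrier A"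
          using h(1)[of x] h(2)[of x y] h(3)[of x y] D t[OF D(1)] c by simp_all
        show "x \<noteq> \<zero>\<^bsub>S\<^esub> \<longrightarrow> inv\<^bsub>S\<^esub> x \<in> U"
          using S.subfield_m_inv(1)[OF mem(1)[OF D(1)], of x] D sub[OF D(1)] by auto
      qed
      have "subfield U S"
      proof (rule S.subfieldI')
        show "subring U S"
          by (rule S.subringI[OF Uc one]) (use ops in auto)
        show "inv\<^bsub>S\<^esub> x \<in> U" if "x \<in> U - {\<zero>\<^bsub>S\<^esub>}" for x using ops(7)[of x x] that by auto
      qed
      moreover have "t \<in> ring_hom (S\<lparr>carrier := U\<rparr>) A"
      proof (rule ring_hom_memI)
        show "t \<one>\<^bsub>S\<lparr>carrier := U\<rparr>\<^esub> = \<one>\<^bsub>A\<^esub>"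
          using t[OF 0, of "\<one>\<^bsub>S\<^esub>"] subringE(3)[OF subfieldE(1)[OF mem(1)[OF 0]]] ring_hom_memE(4)[OF mem(4)[OF 0]] by simp
      qed (use ops in auto)
      moreover have "t c = \<tau> c" "c \<in> U" if "c \<in> B" for c
        using t[OF 0, of c] mem(2,5)[OF 0] that sub[OF 0] by auto
      ultimately have "(U, t) \<in> \<A>"
        by (auto simp: \<A>_def hom_extensions_def t_def)
      moreover have "P c (U, t)" if "c \<in> C" for c
        using that t sub by (cases c) (auto simp: P_def)
      ultimately show ?thesis by blast
    qed
  qed
  then obtain D t where m: "(D, t) \<in> \<A>" and max: "\<And>a. \<lbrakk>a \<in> \<A>; P (D, t) a\<rbrakk> \<Longrightarrow> a = (D, t)"
    by (metis surj_pair)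
  have D: "subfield D S" "B \<subseteq> D" "t \<in> ring_hom (S\<lparr>carrier := D\<rparr>) A" "\<forall>c\<in>B. t c = \<tau> c"
    using m by (auto simp: \<A>_def hom_extensions_def)
  have sht: "subfield_hom S A D t"
    using D S.field_axioms A.field_axioms by (simp add: subfield_hom_def subfield_hom_axioms_def)
  have "carrier S \<subseteq> D"
  proof
    fix x assume x: "x \<in> carrier S"
    have xa: "(S.algebraic over D) x" using S.algebraic_mono[OF D(2) alg[OF x]] .
    note Irr = S.IrrE[OF D(1) x xa]
    have P: "map t (S.Irr D x) \<in> carrier (poly_ring A)"
      by (rule subfield_hom.map_poly[OF sht Irr(1)])
    have "length (map t (S.Irr D x)) - 1 \<ge> 1"
      using S.pirreducible_degree[OF D(1) Irr(1,2)] by simp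
    then have "A.roots (map t (S.Irr D x)) \<noteq> {#}"
      using A.roots_over_carrier[OF P] by (auto simp: A.splitted_def)
    then obtain a where "a \<in># A.roots (map t (S.Irr D x))" by auto
    then have a: "a \<in> carrier A" "A.eval (map t (S.Irr D x)) a = \<zero>\<^bsub>A\<^esub>"
      using A.roots_mem_iff_is_root[OF P] by (auto simp: A.is_root_def)
    obtain t' where t': "t' \<in> hom_extensions S A D t (S.simple_extension D x)"
      using subfield_hom.simple_extension_hom[OF sht x xa a(1)] a(2) by (auto simp: subfield_hom.ev_def[OF sht])
    have incl: "D \<subseteq> S.simple_extension D x" by (rule S.simple_extension_incl[OF subfieldE(3)[OF D(1)] x])
    have "(S.simple_extension D x, t') \<in> \<A>"
      using S.simple_extension_is_subfield[OF D(1) x] xa t' incl D by (auto simp: \<A>_def hom_extensions_def)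
    moreover have "P (D, t) (S.simple_extension D x, t')"
      using t' incl by (auto simp: P_def hom_extensions_def)
    ultimately have "S.simple_extension D x = D" using max by blast
    then show "x \<in> D" using S.simple_extension_mem[OF subfieldE(1)[OF D(1)] x] by simp
  qed
  then have "D = carrier S" using subfieldE(3)[OF D(1)] by auto
  then show ?thesis using D by auto
qed

text \<open>An endomorphism of \<open>A\<close> over \<open>k\<close> is surjective: it permutes the finite set of roots of each polynomial
over \<open>k\<close>.\<close>

lemma algebraic_closure_automorphism:
  assumes A: "algebraic_closure A k" and sh: "subfield_hom A A B \<tau>" and kB: "k \<subseteq> B" "\<And>c. c \<in> k \<Longrightarrow> \<tau> c = c"
  shows "\<exists>\<sigma> \<in> ring_iso A A. \<forall>c \<in> B. \<sigma> c = \<tau> c"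
proof -
  interpret A: algebraic_closure A k by (rule A)
  have k: "subfield k A" by (rule A.subfield_axioms)
  obtain h where h: "h \<in> ring_hom A A" "\<forall>c \<in> B. h c = \<tau> c"
    using algebraic_extension_hom[OF A.algebraically_closed_axioms sh] A.algebraic_mono[OF kB(1)] A.algebraic_extension by blast
  interpret h: ring_hom_ring A A h by (rule ring_hom_ringI2[OF A.ring_axioms A.ring_axioms h(1)])
  have inj: "inj_on h (carrier A)"
    using h.img_is_subfield(1)[OF A.carrier_is_subfield] by simp
  have "y \<in> h ` carrier A" if y: "y \<in> carrier A" for y
  proof -
    obtain p where p: "p \<in> carrier (k[X]\<^bsub>A\<^esub>)" "p \<noteq> []" "A.eval p y = \<zero>\<^bsub>A\<^esub>"
      using A.algebraicE[OF subfieldE(1)[OF k] y A.algebraic_extension[OF y]] by blast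
    let ?Z = "{a. A.is_root p a}"
    have pk: "set p \<subseteq> k" using p(1) A.polynomial_incl by (simp add: univ_poly_carrier[symmetric])
    have hp: "map h p = p" using pk kB h(2) by (intro map_idI) (metis subsetD)
    have "A.eval p (h z) = \<zero>\<^bsub>A\<^esub>" if "z \<in> carrier A" "A.eval p z = \<zero>\<^bsub>A\<^esub>" for z
      using h.eval_hom[OF subfieldE(1)[OF k] that(1) p(1)] hp that(2) h.hom_zero by simp
    then have "h ` ?Z \<subseteq> ?Z"
      by (auto simp: A.is_root_def)
    moreover have "finite ?Z"
      using A.finite_number_of_roots[OF A.carrier_polynomial_shell[OF subfieldE(1)[OF k] p(1)]] .
    moreover have "inj_on h ?Z"
      using inj by (rule inj_on_subset) (auto simp: A.is_root_def)
    ultimately have "h ` ?Z = ?Z" by (intro endo_inj_surj)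
    moreover have "y \<in> ?Z" using y p by (simp add: A.is_root_def)
    ultimately show ?thesis by (auto simp: A.is_root_def)
  qed
  then have "h \<in> ring_iso A A"
    using h(1) inj by (auto simp: ring_iso_def bij_betw_def)
  then show ?thesis using h(2) by blast
qed

section \<open>The tensor product\<close>

locale tensor_product = L: cring L + M: cring M
  for K :: "('k, 'z) ring_scheme" and L :: "('l, 'x) ring_scheme" and M :: "('m, 'y) ring_scheme" +
  fixes f :: "'k \<Rightarrow> 'l" and g :: "'k \<Rightarrow> 'm"
  assumes f_closed: "c \<in> carrier K \<Longrightarrow> f c \<in> carrier L" and g_closed: "c \<in> carrier K \<Longrightarrow> g c \<in> carrier M"
begin

abbreviation "PR \<equiv> pair_ring L M"
abbreviation "N \<equiv> tensor_ideal K L M f g"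
abbreviation "T \<equiv> tensor_ring K L M f g"
abbreviation "rels \<equiv> tensor_rels K L M f g"
abbreviation "tens \<equiv> tensor K L M f g"
abbreviation "LM \<equiv> carrier L \<times> carrier M"

lemma pair_ring_simps [simp]:
  "carrier PR = {c. Poly_Mapping.keys c \<subseteq> LM}" "\<one>\<^bsub>PR\<^esub> = frag_of (\<one>\<^bsub>L\<^esub>, \<one>\<^bsub>M\<^esub>)" "\<zero>\<^bsub>PR\<^esub> = 0"
  "c \<oplus>\<^bsub>PR\<^esub> d = c + d"
  by (simp_all add: pair_ring_def)

lemma mult_of [simp]: "frag_of (a, b) \<otimes>\<^bsub>PR\<^esub> frag_of (a', b') = frag_of (a \<otimes>\<^bsub>L\<^esub> a', b \<otimes>\<^bsub>M\<^esub> b')"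
  by (simp add: pair_ring_def)

lemma mult_diff_left: "(c - c') \<otimes>\<^bsub>PR\<^esub> d = c \<otimes>\<^bsub>PR\<^esub> d - c' \<otimes>\<^bsub>PR\<^esub> d"
  and mult_zero_left: "0 \<otimes>\<^bsub>PR\<^esub> d = 0"
  by (simp_all add: pair_ring_def frag_extend_diff)

lemma mult_diff_right: "c \<otimes>\<^bsub>PR\<^esub> (d - d') = c \<otimes>\<^bsub>PR\<^esub> d - c \<otimes>\<^bsub>PR\<^esub> d'"
  and mult_zero_right: "c \<otimes>\<^bsub>PR\<^esub> 0 = 0"
proof -
  have "frag_extend (\<lambda>x. F x - G x) c = frag_extend F c - frag_extend G c"
    for F G :: "'l \<times> 'm \<Rightarrow> 'l \<times> 'm \<Rightarrow>\<^sub>0 int"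
    using subset_UNIV by (induction c rule: frag_induction) (simp_all add: frag_extend_diff)
  then show "c \<otimes>\<^bsub>PR\<^esub> (d - d') = c \<otimes>\<^bsub>PR\<^esub> d - c \<otimes>\<^bsub>PR\<^esub> d'"
    by (simp add: pair_ring_def frag_extend_diff case_prod_unfold)
  show "c \<otimes>\<^bsub>PR\<^esub> 0 = 0"
    by (simp add: pair_ring_def frag_extend_eq_0 case_prod_unfold)
qed

lemma mult_add_left: "(c + c') \<otimes>\<^bsub>PR\<^esub> d = c \<otimes>\<^bsub>PR\<^esub> d + c' \<otimes>\<^bsub>PR\<^esub> d"
  using mult_diff_left[of c "0 - c'" d] mult_diff_left[of 0 c' d] by (simp add: mult_zero_left)

lemma keys_diff_closed: "\<lbrakk>Poly_Mapping.keys x \<subseteq> S; Poly_Mapping.keys y \<subseteq> S\<rbrakk> \<Longrightarrow> Poly_Mapping.keys (x - y) \<subseteq> S"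
  using keys_diff[of x y] by blast

lemma keys_add_closed: "\<lbrakk>Poly_Mapping.keys x \<subseteq> S; Poly_Mapping.keys y \<subseteq> S\<rbrakk> \<Longrightarrow> Poly_Mapping.keys (x + y) \<subseteq> S"
  using keys_add[of x y] by blast

lemma pair_induct [consumes 1, case_names zero diff gen]:
  assumes "Poly_Mapping.keys c \<subseteq> LM" "Q 0"
    "\<And>x y. \<lbrakk>Poly_Mapping.keys x \<subseteq> LM; Poly_Mapping.keys y \<subseteq> LM; Q x; Q y\<rbrakk> \<Longrightarrow> Q (x - y)"
    "\<And>a b. \<lbrakk>a \<in> carrier L; b \<in> carrier M\<rbrakk> \<Longrightarrow> Q (frag_of (a, b))"
  shows "Q c"
  by (rule free_Abelian_group_induct[OF assms(1)]) (use assms(2-4) in auto)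

lemma pair_mult_closed:
  assumes "Poly_Mapping.keys c \<subseteq> LM" "Poly_Mapping.keys d \<subseteq> LM"
  shows "Poly_Mapping.keys (c \<otimes>\<^bsub>PR\<^esub> d) \<subseteq> LM"
  using assms(1)
proof (induction c rule: pair_induct)
  case (gen a b)
  note x = TrueI gen
  show ?case
    using assms(2)
  proof (induction d rule: pair_induct)
    case (gen a' b')
    then show ?case using x by auto
  qed (simp_all add: mult_zero_right mult_diff_right keys_diff_closed)
qed (simp_all add: mult_zero_left mult_diff_left keys_diff_closed)

lemma pair_mult_comm:
  assumes "Poly_Mapping.keys c \<subseteq> LM" "Poly_Mapping.keys d \<subseteq> LM"
  shows "c \<otimes>\<^bsub>PR\<^esub> d = d \<otimes>\<^bsub>PR\<^esub> c"
  using assms(1)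
proof (induction c rule: pair_induct)
  case (gen a b)
  note x = TrueI gen
  show ?case
    using assms(2)
  proof (induction d rule: pair_induct)
    case (gen a' b')
    then show ?case using x by (simp add: L.m_comm M.m_comm)
  qed (simp_all add: mult_zero_left mult_zero_right mult_diff_left mult_diff_right)
qed (simp_all add: mult_zero_left mult_zero_right mult_diff_left mult_diff_right)

lemma pair_mult_assoc:
  assumes "Poly_Mapping.keys c \<subseteq> LM" "Poly_Mapping.keys d \<subseteq> LM" "Poly_Mapping.keys e \<subseteq> LM"
  shows "(c \<otimes>\<^bsub>PR\<^esub> d) \<otimes>\<^bsub>PR\<^esub> e = c \<otimes>\<^bsub>PR\<^esub> (d \<otimes>\<^bsub>PR\<^esub> e)"
  using assms(1)
proof (induction c rule: pair_induct)
  case (gen a b)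
  note x = TrueI gen
  show ?case
    using assms(2)
  proof (induction d rule: pair_induct)
    case (gen a' b')
    note y = TrueI gen
    show ?case
      using assms(3)
    proof (induction e rule: pair_induct)
      case (gen c d)
      then show ?case using x y by (simp add: L.m_assoc M.m_assoc)
    qed (simp_all add: mult_zero_left mult_zero_right mult_diff_left mult_diff_right)
  qed (simp_all add: mult_zero_left mult_zero_right mult_diff_left mult_diff_right)
qed (simp_all add: mult_zero_left mult_zero_right mult_diff_left mult_diff_right)

lemma pair_mult_one:
  assumes "Poly_Mapping.keys c \<subseteq> LM" shows "frag_of (\<one>\<^bsub>L\<^esub>, \<one>\<^bsub>M\<^esub>) \<otimes>\<^bsub>PR\<^esub> c = c"
  using assms
proof (induction c rule: pair_induct)
  case (gen a b)
  then show ?case by simp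
qed (simp_all add: mult_zero_right mult_diff_right)

lemma pair_cring: "cring PR"
proof (rule cringI)
  show "abelian_group PR"
  proof (rule abelian_groupI)
    fix x assume "x \<in> carrier PR"
    then show "\<exists>y \<in> carrier PR. y \<oplus>\<^bsub>PR\<^esub> x = \<zero>\<^bsub>PR\<^esub>"
      by (intro bexI[of _ "- x"]) auto
  qed (auto simp: keys_add_closed add_ac)
  show "comm_monoid PR"
  proof (rule comm_monoidI)
    show "x \<otimes>\<^bsub>PR\<^esub> y = y \<otimes>\<^bsub>PR\<^esub> x" if "x \<in> carrier PR" "y \<in> carrier PR" for x y
      using pair_mult_comm that by simp
  qed (simp_all add: pair_mult_closed pair_mult_assoc pair_mult_one del: mult_of)
qed (simp add: mult_add_left)

sublocale P: cring PR
  by (rule pair_cring)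

lemma P_minus: "Poly_Mapping.keys c \<subseteq> LM \<Longrightarrow> \<ominus>\<^bsub>PR\<^esub> c = - c"
  by (rule P.minus_equality) auto

lemma rels_closed: "rels \<subseteq> carrier PR"
proof
  fix r assume "r \<in> rels"
  then show "r \<in> carrier PR"
    by cases (simp_all add: keys_diff_closed f_closed g_closed)
qed

lemma N_subgroup: "subgroup N (add_monoid PR)"
  unfolding tensor_ideal_def using P.add.generate_is_subgroup[of rels] rels_closed by simp

lemma rels_N: "r \<in> rels \<Longrightarrow> r \<in> N"
  unfolding tensor_ideal_def by (rule generate.incl)

lemma N_diff: "\<lbrakk>x \<in> N; y \<in> N\<rbrakk> \<Longrightarrow> x - y \<in> N"
proof -
  assume xy: "x \<in> N" "y \<in> N"
  have c: "Poly_Mapping.keys y \<subseteq> LM" using subgroup.subset[OF N_subgroup] xy(2) by auto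
  have "\<ominus>\<^bsub>PR\<^esub> y \<in> N" using subgroup.m_inv_closed[OF N_subgroup xy(2)] by (simp add: a_inv_def)
  then have "- y \<in> N" using P_minus[OF c] by simp
  then show ?thesis using subgroup.m_closed[OF N_subgroup xy(1)] by fastforce
qed

lemma N_zero: "0 \<in> N"
  using subgroup.one_closed[OF N_subgroup] by simp

lemma rels_mult_of:
  assumes "r \<in> rels" "c \<in> carrier L" "d \<in> carrier M"
  shows "frag_of (c, d) \<otimes>\<^bsub>PR\<^esub> r \<in> rels"
  using assms(1)
proof cases
  case (add_left a a' b)
  then show ?thesis
    using tensor_rels.add_left[of "c \<otimes>\<^bsub>L\<^esub> a" L "c \<otimes>\<^bsub>L\<^esub> a'" "d \<otimes>\<^bsub>M\<^esub> b" M K f g] assms(2,3)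
    by (simp add: mult_diff_right L.r_distr)
next
  case (add_right a b b')
  then show ?thesis
    using tensor_rels.add_right[of "c \<otimes>\<^bsub>L\<^esub> a" L "d \<otimes>\<^bsub>M\<^esub> b" M "d \<otimes>\<^bsub>M\<^esub> b'" K f g] assms(2,3)
    by (simp add: mult_diff_right M.r_distr)
next
  case (balanced k a b)
  then show ?thesis
    using tensor_rels.balanced[of k K "c \<otimes>\<^bsub>L\<^esub> a" L "d \<otimes>\<^bsub>M\<^esub> b" M f g] assms(2,3) f_closed[of k] g_closed[of k]
    by (simp add: mult_diff_right L.m_lcomm M.m_lcomm)
qed

text \<open>The relations are mapped to relations by multiplication with a generator \<open>frag_of (c, d)\<close>, and generators span
the pair ring additively.\<close>

lemma N_ideal: "ideal N PR"
proof (rule idealI)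
  show "ring PR" by (rule P.ring_axioms)
  show "subgroup N (add_monoid PR)" by (rule N_subgroup)
  have mult_gen: "frag_of (c, d) \<otimes>\<^bsub>PR\<^esub> x \<in> N" if cd: "c \<in> carrier L" "d \<in> carrier M" and x: "x \<in> N" for c d x
    using x unfolding tensor_ideal_def
  proof (induction x rule: generate.induct)
    case one
    have "\<one>\<^bsub>add_monoid PR\<^esub> = 0" by simp
    then show ?case
      unfolding tensor_ideal_def[symmetric] using N_zero mult_zero_right[of "frag_of (c, d)"] by metis
  next
    case (incl r)
    show ?case
      unfolding tensor_ideal_def[symmetric] by (rule rels_N[OF rels_mult_of[OF incl cd]])
  next
    case (inv r)
    have "Poly_Mapping.keys r \<subseteq> LM" using rels_closed inv by auto
    then have eq: "inv\<^bsub>add_monoid PR\<^esub> r = 0 - r" using P_minus by (simp add: a_inv_def)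
    show ?case
      unfolding tensor_ideal_def[symmetric] eq mult_diff_right mult_zero_right
      by (rule N_diff[OF N_zero rels_N[OF rels_mult_of[OF inv cd]]])
  next
    case (eng x y)
    note IH = eng(3,4)[folded tensor_ideal_def]
    have eq: "x \<otimes>\<^bsub>add_monoid PR\<^esub> y = x - (0 - y)" by simp
    show ?case
      unfolding tensor_ideal_def[symmetric] eq mult_diff_right mult_zero_right
      by (rule N_diff[OF IH(1) N_diff[OF N_zero IH(2)]])
  qed
  have Nc: "Poly_Mapping.keys x \<subseteq> LM" if "x \<in> N" for x
    using subgroup.subset[OF N_subgroup] that by auto
  have left: "r \<otimes>\<^bsub>PR\<^esub> x \<in> N" if x: "x \<in> N" and r: "Poly_Mapping.keys r \<subseteq> LM" for x r
    using r
  proof (induction r rule: pair_induct)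
    case (gen a b)
    then show ?case using mult_gen[OF _ _ x] by simp
  qed (simp_all add: mult_zero_left mult_diff_left N_zero N_diff)
  show "r \<otimes>\<^bsub>PR\<^esub> x \<in> N" if "x \<in> N" "r \<in> carrier PR" for x r
    using left that by simp
  show "x \<otimes>\<^bsub>PR\<^esub> r \<in> N" if "x \<in> N" "r \<in> carrier PR" for x r
    using left[OF that(1), of r] pair_mult_comm[OF Nc[OF that(1)], of r] that(2) by simp
qed

sublocale N: ideal N PR
  by (rule N_ideal)

lemma T_cring: "cring T"
  unfolding tensor_ring_def by (rule N.quotient_is_cring[OF pair_cring])

abbreviation "cs c \<equiv> N +>\<^bsub>PR\<^esub> c"

lemma cs_hom: "(\<lambda>c. cs c) \<in> ring_hom PR T"
  unfolding tensor_ring_def by (rule N.rcos_ring_hom)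

lemma cs_surj: "t \<in> carrier T \<Longrightarrow> \<exists>c. Poly_Mapping.keys c \<subseteq> LM \<and> t = cs c"
  by (auto simp: tensor_ring_def FactRing_def A_RCOSETS_def')

lemma cs_eq_iff:
  assumes "Poly_Mapping.keys c \<subseteq> LM" "Poly_Mapping.keys d \<subseteq> LM"
  shows "cs c = cs d \<longleftrightarrow> c - d \<in> N"
  using P.quotient_eq_iff_same_a_r_cos[OF N_ideal, of c d] assms P_minus[of d] by (simp add: a_minus_def)

lemma tens_eq: "tens a b = cs (frag_of (a, b))"
  by (simp add: tensor_def)

lemma tens_closed: "\<lbrakk>a \<in> carrier L; b \<in> carrier M\<rbrakk> \<Longrightarrow> tens a b \<in> carrier T"
  using ring_hom_memE(1)[OF cs_hom, of "frag_of (a, b)"] by (simp add: tens_eq)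

lemma tens_mult: "\<lbrakk>a \<in> carrier L; b \<in> carrier M; a' \<in> carrier L; b' \<in> carrier M\<rbrakk> \<Longrightarrow>
    tens a b \<otimes>\<^bsub>T\<^esub> tens a' b' = tens (a \<otimes>\<^bsub>L\<^esub> a') (b \<otimes>\<^bsub>M\<^esub> b')"
  using ring_hom_memE(2)[OF cs_hom, of "frag_of (a, b)" "frag_of (a', b')"] by (simp add: tens_eq)

lemma tens_one: "\<one>\<^bsub>T\<^esub> = tens \<one>\<^bsub>L\<^esub> \<one>\<^bsub>M\<^esub>"
  using ring_hom_memE(4)[OF cs_hom] by (simp add: tens_eq)

lemma tens_add_left:
  assumes "a \<in> carrier L" "a' \<in> carrier L" "b \<in> carrier M"
  shows "tens (a \<oplus>\<^bsub>L\<^esub> a') b = tens a b \<oplus>\<^bsub>T\<^esub> tens a' b"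
proof -
  have k: "Poly_Mapping.keys (frag_of (a, b) + frag_of (a', b)) \<subseteq> LM"
    using assms by (intro keys_add_closed) auto
  have "tens a b \<oplus>\<^bsub>T\<^esub> tens a' b = cs (frag_of (a, b) + frag_of (a', b))"
    using ring_hom_memE(3)[OF cs_hom, of "frag_of (a, b)" "frag_of (a', b)"] assms by (simp add: tens_eq)
  also have "\<dots> = tens (a \<oplus>\<^bsub>L\<^esub> a') b"
    unfolding tens_eq using cs_eq_iff[OF _ k, of "frag_of (a \<oplus>\<^bsub>L\<^esub> a', b)"]
      rels_N[OF tensor_rels.add_left[OF assms]] assms by (simp add: diff_diff_add)
  finally show ?thesis ..
qed

lemma tens_add_right:
  assumes "a \<in> carrier L" "b \<in> carrier M" "b' \<in> carrier M"
  shows "tens a (b \<oplus>\<^bsub>M\<^esub> b') = tens a b \<oplus>\<^bsub>T\<^esub> tens a b'"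
proof -
  have k: "Poly_Mapping.keys (frag_of (a, b) + frag_of (a, b')) \<subseteq> LM"
    using assms by (intro keys_add_closed) auto
  have "tens a b \<oplus>\<^bsub>T\<^esub> tens a b' = cs (frag_of (a, b) + frag_of (a, b'))"
    using ring_hom_memE(3)[OF cs_hom, of "frag_of (a, b)" "frag_of (a, b')"] assms by (simp add: tens_eq)
  also have "\<dots> = tens a (b \<oplus>\<^bsub>M\<^esub> b')"
    unfolding tens_eq using cs_eq_iff[OF _ k, of "frag_of (a, b \<oplus>\<^bsub>M\<^esub> b')"]
      rels_N[OF tensor_rels.add_right[OF assms]] assms by (simp add: diff_diff_add)
  finally show ?thesis ..
qed

lemma tens_balanced:
  assumes "k \<in> carrier K" shows "tens (f k) \<one>\<^bsub>M\<^esub> = tens \<one>\<^bsub>L\<^esub> (g k)"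
  unfolding tens_eq using cs_eq_iff[of "frag_of (f k, \<one>\<^bsub>M\<^esub>)" "frag_of (\<one>\<^bsub>L\<^esub>, g k)"]
    rels_N[OF tensor_rels.balanced[OF assms L.one_closed M.one_closed, of f g]] f_closed[OF assms] g_closed[OF assms] by simp

text \<open>Subtraction suffices as the additive step, because it yields zero, negatives and sums.\<close>

lemma T_induct [consumes 1, case_names tensor diff]:
  assumes t: "t \<in> carrier T" and tens: "\<And>a b. \<lbrakk>a \<in> carrier L; b \<in> carrier M\<rbrakk> \<Longrightarrow> Q (tens a b)"
    and diff_step: "\<And>s t. \<lbrakk>s \<in> carrier T; t \<in> carrier T; Q s; Q t\<rbrakk> \<Longrightarrow> Q (s \<ominus>\<^bsub>T\<^esub> t)"
  shows "Q t"
proof -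
  interpret T: cring T by (rule T_cring)
  interpret c: ring_hom_ring PR T "\<lambda>c. cs c"
    by (rule ring_hom_ringI2[OF P.ring_axioms T.ring_axioms cs_hom])
  have "Q (cs c)" if "Poly_Mapping.keys c \<subseteq> LM" for c
    using that
  proof (induction c rule: pair_induct)
    case zero
    have t1: "tens \<one>\<^bsub>L\<^esub> \<one>\<^bsub>M\<^esub> \<in> carrier T" by (simp add: tens_closed)
    have "cs 0 = \<zero>\<^bsub>T\<^esub>" using c.hom_zero by simp
    also have "\<dots> = tens \<one>\<^bsub>L\<^esub> \<one>\<^bsub>M\<^esub> \<ominus>\<^bsub>T\<^esub> tens \<one>\<^bsub>L\<^esub> \<one>\<^bsub>M\<^esub>" using t1 by (simp add: a_minus_def T.r_neg)
    finally show ?case using diff_step[OF t1 t1] tens by simp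
  next
    case (diff x y)
    have "cs (x - y) = cs x \<ominus>\<^bsub>T\<^esub> cs y"
      using diff c.hom_add[of x "- y"] c.hom_a_inv[of y] P_minus[of y] by (simp add: a_minus_def)
    then show ?case using diff diff_step[of "cs x" "cs y"] by simp
  next
    case (gen a b)
    then show ?case using tens by (simp add: tens_eq)
  qed
  then show ?thesis using cs_surj[OF t] by blast
qed

lemma T_hom_eq:
  assumes A: "ring A" and h: "h \<in> ring_hom T A" "h' \<in> ring_hom T A"
    and eq: "\<And>a b. \<lbrakk>a \<in> carrier L; b \<in> carrier M\<rbrakk> \<Longrightarrow> h (tens a b) = h' (tens a b)" and t: "t \<in> carrier T"
  shows "h t = h' t"
proof -
  interpret T: cring T by (rule T_cring)
  interpret h: ring_hom_ring T A h by (rule ring_hom_ringI2[OF T.ring_axioms A h(1)])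
  interpret h': ring_hom_ring T A h' by (rule ring_hom_ringI2[OF T.ring_axioms A h(2)])
  show ?thesis
    using t by (induction t rule: T_induct) (simp_all add: eq a_minus_def)
qed

text \<open>The additive extension of \<open>(a, b) \<mapsto> \<beta> a \<cdot> \<eta> b\<close> to the free abelian group is multiplicative and kills the
relations.\<close>

lemma tensor_universal:
  assumes A: "cring A" and \<beta>: "\<beta> \<in> ring_hom L A" and \<eta>: "\<eta> \<in> ring_hom M A"
    and bal: "\<And>k. k \<in> carrier K \<Longrightarrow> \<beta> (f k) = \<eta> (g k)"
  shows "\<exists>h \<in> ring_hom T A. \<forall>a \<in> carrier L. \<forall>b \<in> carrier M. h (tens a b) = \<beta> a \<otimes>\<^bsub>A\<^esub> \<eta> b"
proof -
  interpret A: cring A by (rule A)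
  note bm = ring_hom_memE[OF \<beta>] and em = ring_hom_memE[OF \<eta>]
  have "comm_group (add_monoid A)" by (rule A.a_comm_group)
  moreover have "(\<lambda>(a, b). \<beta> a \<otimes>\<^bsub>A\<^esub> \<eta> b) ` LM \<subseteq> carrier (add_monoid A)"
    using bm(1) em(1) by auto
  ultimately obtain h where h: "h \<in> hom (free_Abelian_group LM) (add_monoid A)"
      "\<And>x. x \<in> LM \<Longrightarrow> h (frag_of x) = (\<lambda>(a, b). \<beta> a \<otimes>\<^bsub>A\<^esub> \<eta> b) x"
    using comm_group.free_Abelian_group_universal by blast
  have hc: "h c \<in> carrier A" if "Poly_Mapping.keys c \<subseteq> LM" for c
    using h(1) that by (auto simp: hom_def)
  have hadd: "h (c + d) = h c \<oplus>\<^bsub>A\<^esub> h d" if "Poly_Mapping.keys c \<subseteq> LM" "Poly_Mapping.keys d \<subseteq> LM" for c d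
    using h(1) that by (auto simp: hom_def)
  have h0: "h 0 = \<zero>\<^bsub>A\<^esub>"
    using hadd[of 0 0] hc[of 0] by simp
  have hdiff: "h (c - d) = h c \<ominus>\<^bsub>A\<^esub> h d" if cd: "Poly_Mapping.keys c \<subseteq> LM" "Poly_Mapping.keys d \<subseteq> LM" for c d
  proof -
    have k: "Poly_Mapping.keys (c - d) \<subseteq> LM" by (rule keys_diff_closed[OF cd])
    have "h c = h (c - d) \<oplus>\<^bsub>A\<^esub> h d" using hadd[OF k cd(2)] by simp
    moreover have "x = y \<oplus>\<^bsub>A\<^esub> z \<Longrightarrow> y = x \<ominus>\<^bsub>A\<^esub> z" if "x \<in> carrier A" "y \<in> carrier A" "z \<in> carrier A" for x y z
      using that by (simp add: a_minus_def A.a_assoc A.r_neg)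
    ultimately show ?thesis using hc k cd by blast
  qed
  have hof: "h (frag_of (a, b)) = \<beta> a \<otimes>\<^bsub>A\<^esub> \<eta> b" if "a \<in> carrier L" "b \<in> carrier M" for a b
    using h(2)[of "(a, b)"] that by simp
  have hmult: "h (c \<otimes>\<^bsub>PR\<^esub> d) = h c \<otimes>\<^bsub>A\<^esub> h d" if c: "Poly_Mapping.keys c \<subseteq> LM" and d: "Poly_Mapping.keys d \<subseteq> LM" for c d
    using c
  proof (induction c rule: pair_induct)
    case zero
    then show ?case using hc[OF d] h0 by (simp add: mult_zero_left)
  next
    case (diff x y)
    have "h ((x - y) \<otimes>\<^bsub>PR\<^esub> d) = h (x \<otimes>\<^bsub>PR\<^esub> d) \<ominus>\<^bsub>A\<^esub> h (y \<otimes>\<^bsub>PR\<^esub> d)"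
      unfolding mult_diff_left by (intro hdiff pair_mult_closed diff d)
    also have "\<dots> = (h x \<ominus>\<^bsub>A\<^esub> h y) \<otimes>\<^bsub>A\<^esub> h d"
      using diff hc[OF diff(1)] hc[OF diff(2)] hc[OF d] by (simp add: a_minus_def A.l_distr A.l_minus)
    finally show ?case using hdiff[OF diff(1,2)] by simp
  next
    case (gen a b)
    note x = TrueI gen
    have xk: "Poly_Mapping.keys (frag_of (a, b)) \<subseteq> LM" using x by simp
    show ?case
      using d
    proof (induction d rule: pair_induct)
      case zero
      then show ?case using hc[OF xk] h0 by (simp add: mult_zero_right)
    next
      case (diff y z)
      have "h (frag_of (a, b) \<otimes>\<^bsub>PR\<^esub> (y - z)) = h (frag_of (a, b) \<otimes>\<^bsub>PR\<^esub> y) \<ominus>\<^bsub>A\<^esub> h (frag_of (a, b) \<otimes>\<^bsub>PR\<^esub> z)"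
        unfolding mult_diff_right by (intro hdiff pair_mult_closed diff xk)
      also have "\<dots> = h (frag_of (a, b)) \<otimes>\<^bsub>A\<^esub> (h y \<ominus>\<^bsub>A\<^esub> h z)"
        using diff hc[OF diff(1)] hc[OF diff(2)] hc[OF xk] by (simp add: a_minus_def A.r_distr A.r_minus)
      finally show ?case using hdiff[OF diff(1,2)] by simp
    next
      case (gen a' b')
      note y = TrueI gen
      show ?case
        using x y bm(1)[OF x(2)] bm(1)[OF y(2)] em(1)[OF x(3)] em(1)[OF y(3)]
        by (simp add: hof bm(2) em(2) A.m_ac)
    qed
  qed
  have h_rel: "h r = \<zero>\<^bsub>A\<^esub>" if "r \<in> rels" for r
    using that
  proof cases
    case (add_left a a' b)
    have "h r = (\<beta> a \<oplus>\<^bsub>A\<^esub> \<beta> a') \<otimes>\<^bsub>A\<^esub> \<eta> b \<ominus>\<^bsub>A\<^esub> \<beta> a \<otimes>\<^bsub>A\<^esub> \<eta> b \<ominus>\<^bsub>A\<^esub> \<beta> a' \<otimes>\<^bsub>A\<^esub> \<eta> b"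
      unfolding add_left(1) using add_left
      by (subst hdiff, intro keys_diff_closed, simp_all, subst hdiff, simp_all add: hof bm(3))
    also have "\<dots> = \<zero>\<^bsub>A\<^esub>"
      using bm(1)[OF add_left(2)] bm(1)[OF add_left(3)] em(1)[OF add_left(4)] by algebra
    finally show ?thesis .
  next
    case (add_right a b b')
    have "h r = \<beta> a \<otimes>\<^bsub>A\<^esub> (\<eta> b \<oplus>\<^bsub>A\<^esub> \<eta> b') \<ominus>\<^bsub>A\<^esub> \<beta> a \<otimes>\<^bsub>A\<^esub> \<eta> b \<ominus>\<^bsub>A\<^esub> \<beta> a \<otimes>\<^bsub>A\<^esub> \<eta> b'"
      unfolding add_right(1) using add_right
      by (subst hdiff, intro keys_diff_closed, simp_all, subst hdiff, simp_all add: hof em(3))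
    also have "\<dots> = \<zero>\<^bsub>A\<^esub>"
      using bm(1)[OF add_right(2)] em(1)[OF add_right(3)] em(1)[OF add_right(4)] by algebra
    finally show ?thesis .
  next
    case (balanced k a b)
    have "h r = (\<beta> (f k) \<otimes>\<^bsub>A\<^esub> \<beta> a) \<otimes>\<^bsub>A\<^esub> \<eta> b \<ominus>\<^bsub>A\<^esub> \<beta> a \<otimes>\<^bsub>A\<^esub> (\<eta> (g k) \<otimes>\<^bsub>A\<^esub> \<eta> b)"
      unfolding balanced(1) using balanced f_closed g_closed
      by (subst hdiff) (simp_all add: hof bm(2) em(2))
    also have "\<dots> = \<zero>\<^bsub>A\<^esub>"
      using bm(1)[OF balanced(3)] em(1)[OF balanced(4)] em(1)[OF g_closed[OF balanced(2)]]
      by (simp add: bal[OF balanced(2)] A.m_ac a_minus_def A.r_neg)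
    finally show ?thesis .
  qed
  have h_N: "h x = \<zero>\<^bsub>A\<^esub>" if "x \<in> N" for x
    using that unfolding tensor_ideal_def
  proof (induction x rule: generate.induct)
    case (inv r)
    have "Poly_Mapping.keys r \<subseteq> LM" using rels_closed inv by auto
    then have "h (inv\<^bsub>add_monoid PR\<^esub> r) = h 0 \<ominus>\<^bsub>A\<^esub> h r"
      using P_minus hdiff[of 0 r] by (simp add: a_inv_def)
    then show ?case using h0 h_rel[OF inv] by (simp add: a_minus_def)
  next
    case (eng x y)
    have "Poly_Mapping.keys x \<subseteq> LM" "Poly_Mapping.keys y \<subseteq> LM"
      using eng(1,2) subgroup.subset[OF N_subgroup] by (auto simp: tensor_ideal_def)
    then show ?case using hadd eng by simp
  qed (simp_all add: h0 h_rel)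
  define H where "H t = h (SOME c. Poly_Mapping.keys c \<subseteq> LM \<and> t = cs c)" for t
  have H: "H (cs c) = h c" if c: "Poly_Mapping.keys c \<subseteq> LM" for c
  proof -
    define d where "d = (SOME d. Poly_Mapping.keys d \<subseteq> LM \<and> cs c = cs d)"
    have "\<exists>d. Poly_Mapping.keys d \<subseteq> LM \<and> cs c = cs d" using c by blast
    from someI_ex[OF this] have d: "Poly_Mapping.keys d \<subseteq> LM" "cs c = cs d" unfolding d_def by blast+
    then have "c - d \<in> N" using cs_eq_iff[OF c] by blast
    then have "h c \<ominus>\<^bsub>A\<^esub> h d = \<zero>\<^bsub>A\<^esub>" using h_N hdiff[OF c d(1)] by simp
    then have "h c = h d" using hc[OF c] hc[OF d(1)] by simp
    then show ?thesis by (simp add: H_def d_def)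
  qed
  have "H \<in> ring_hom T A"
  proof (rule ring_hom_memI)
    fix s t assume "s \<in> carrier T"
    then obtain c where c: "Poly_Mapping.keys c \<subseteq> LM" "s = cs c" using cs_surj by blast
    then show "H s \<in> carrier A" using H hc by simp
    assume "t \<in> carrier T"
    then obtain d where d: "Poly_Mapping.keys d \<subseteq> LM" "t = cs d" using cs_surj by blast
    show "H (s \<otimes>\<^bsub>T\<^esub> t) = H s \<otimes>\<^bsub>A\<^esub> H t"
      using ring_hom_memE(2)[OF cs_hom, of c d, symmetric] c d H[OF pair_mult_closed[OF c(1) d(1)]] H[OF c(1)] H[OF d(1)]
        hmult[OF c(1) d(1)] by simp
    show "H (s \<oplus>\<^bsub>T\<^esub> t) = H s \<oplus>\<^bsub>A\<^esub> H t"
      using ring_hom_memE(3)[OF cs_hom, of c d, symmetric] c d H[OF keys_add_closed[OF c(1) d(1)]] H[OF c(1)] H[OF d(1)]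
        hadd[OF c(1) d(1)] by simp
  next
    show "H \<one>\<^bsub>T\<^esub> = \<one>\<^bsub>A\<^esub>"
      using H[of "frag_of (\<one>\<^bsub>L\<^esub>, \<one>\<^bsub>M\<^esub>)"] bm(4) em(4) by (simp add: tens_one tens_eq hof)
  qed
  moreover have "H (tens a b) = \<beta> a \<otimes>\<^bsub>A\<^esub> \<eta> b" if "a \<in> carrier L" "b \<in> carrier M" for a b
    using H[of "frag_of (a, b)"] that by (simp add: tens_eq hof)
  ultimately show ?thesis by blast
qed

end

section \<open>Homomorphisms out of a finite product of rings\<close>

lemma RDirProd_list_Cons_ops:
  assumes "a \<in> carrier R" "b \<in> carrier R" "as \<in> carrier (RDirProd_list Rs)" "bs \<in> carrier (RDirProd_list Rs)"
  shows "(a # as) \<otimes>\<^bsub>RDirProd_list (R # Rs)\<^esub> (b # bs) = (a \<otimes>\<^bsub>R\<^esub> b) # (as \<otimes>\<^bsub>RDirProd_list Rs\<^esub> bs)"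
    and "(a # as) \<oplus>\<^bsub>RDirProd_list (R # Rs)\<^esub> (b # bs) = (a \<oplus>\<^bsub>R\<^esub> b) # (as \<oplus>\<^bsub>RDirProd_list Rs\<^esub> bs)"
    and "\<one>\<^bsub>RDirProd_list (R # Rs)\<^esub> = \<one>\<^bsub>R\<^esub> # \<one>\<^bsub>RDirProd_list Rs\<^esub>"
    and "a # as \<in> carrier (RDirProd_list (R # Rs))"
proof -
  note h = ring_hom_memE[OF RDirProd_list_hom1[of R Rs]]
  have c: "(a, as) \<in> carrier (RDirProd R (RDirProd_list Rs))" "(b, bs) \<in> carrier (RDirProd R (RDirProd_list Rs))"
    using assms by (simp_all add: RDirProd_carrier)
  show "(a # as) \<otimes>\<^bsub>RDirProd_list (R # Rs)\<^esub> (b # bs) = (a \<otimes>\<^bsub>R\<^esub> b) # (as \<otimes>\<^bsub>RDirProd_list Rs\<^esub> bs)"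
    using h(2)[OF c] by (simp add: RDirProd_def DirProd_def monoid.defs)
  show "(a # as) \<oplus>\<^bsub>RDirProd_list (R # Rs)\<^esub> (b # bs) = (a \<oplus>\<^bsub>R\<^esub> b) # (as \<oplus>\<^bsub>RDirProd_list Rs\<^esub> bs)"
    using h(3)[OF c] by (simp add: RDirProd_def DirProd_def monoid.defs)
  show "\<one>\<^bsub>RDirProd_list (R # Rs)\<^esub> = \<one>\<^bsub>R\<^esub> # \<one>\<^bsub>RDirProd_list Rs\<^esub>"
    using h(4) by (simp add: RDirProd_def DirProd_def monoid.defs)
  show "a # as \<in> carrier (RDirProd_list (R # Rs))"
    using h(1)[OF c(1)] by simp
qed

lemma RDirProd_list_proj_hom:
  "i < length Rs \<Longrightarrow> (\<lambda>xs. xs ! i) \<in> ring_hom (RDirProd_list Rs) (Rs ! i)"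
proof (induction Rs arbitrary: i)
  case (Cons R Rs)
  have mem: "\<exists>a as. a \<in> carrier R \<and> as \<in> carrier (RDirProd_list Rs) \<and> xs = a # as"
    if "xs \<in> carrier (RDirProd_list (R # Rs))" for xs
    using that unfolding RDirProd_list_carrier by auto
  show ?case
  proof (cases i)
    case 0
    show ?thesis
    proof (rule ring_hom_memI)
      fix xs assume "xs \<in> carrier (RDirProd_list (R # Rs))"
      then obtain a as where x: "a \<in> carrier R" "as \<in> carrier (RDirProd_list Rs)" "xs = a # as" using mem by blast
      show "xs ! i \<in> carrier ((R # Rs) ! i)" using x 0 by simp
      fix ys assume "ys \<in> carrier (RDirProd_list (R # Rs))"
      then obtain b bs where y: "b \<in> carrier R" "bs \<in> carrier (RDirProd_list Rs)" "ys = b # bs" using mem by blast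
      show "(xs \<otimes>\<^bsub>RDirProd_list (R # Rs)\<^esub> ys) ! i = xs ! i \<otimes>\<^bsub>(R # Rs) ! i\<^esub> ys ! i"
        "(xs \<oplus>\<^bsub>RDirProd_list (R # Rs)\<^esub> ys) ! i = xs ! i \<oplus>\<^bsub>(R # Rs) ! i\<^esub> ys ! i"
        using RDirProd_list_Cons_ops(1,2)[OF x(1) y(1) x(2) y(2)] x(3) y(3) 0 by simp_all
    next
      show "\<one>\<^bsub>RDirProd_list (R # Rs)\<^esub> ! i = \<one>\<^bsub>(R # Rs) ! i\<^esub>"
        using 0 by (simp add: RDirProd_list_one)
    qed
  next
    case (Suc j)
    then have "j < length Rs" using Cons.prems by simp
    note h = ring_hom_memE[OF Cons.IH[OF this]]
    show ?thesis
    proof (rule ring_hom_memI)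
      fix xs assume "xs \<in> carrier (RDirProd_list (R # Rs))"
      then obtain a as where x: "a \<in> carrier R" "as \<in> carrier (RDirProd_list Rs)" "xs = a # as" using mem by blast
      show "xs ! i \<in> carrier ((R # Rs) ! i)" using x Suc h(1)[OF x(2)] by simp
      fix ys assume "ys \<in> carrier (RDirProd_list (R # Rs))"
      then obtain b bs where y: "b \<in> carrier R" "bs \<in> carrier (RDirProd_list Rs)" "ys = b # bs" using mem by blast
      show "(xs \<otimes>\<^bsub>RDirProd_list (R # Rs)\<^esub> ys) ! i = xs ! i \<otimes>\<^bsub>(R # Rs) ! i\<^esub> ys ! i"
        "(xs \<oplus>\<^bsub>RDirProd_list (R # Rs)\<^esub> ys) ! i = xs ! i \<oplus>\<^bsub>(R # Rs) ! i\<^esub> ys ! i"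
        using RDirProd_list_Cons_ops(1,2)[OF x(1) y(1) x(2) y(2)] x(3) y(3) Suc h(2,3)[OF x(2) y(2)] by simp_all
    next
      show "\<one>\<^bsub>RDirProd_list (R # Rs)\<^esub> ! i = \<one>\<^bsub>(R # Rs) ! i\<^esub>"
        using Suc h(4) by (simp add: RDirProd_list_one)
    qed
  qed
qed simp

text \<open>The images of the orthogonal idempotents \<open>(1, 0)\<close> and \<open>(0, 1)\<close> have product zero and sum one, so in a domain one
of them is zero and the other is one. This splits off the first factor.\<close>

lemma hom_from_product_factors:
  assumes "domain A" "\<And>i. i < length Rs \<Longrightarrow> ring (Rs ! i)" "\<psi> \<in> ring_hom (RDirProd_list Rs) A"
  shows "\<exists>i < length Rs. \<exists>\<gamma> \<in> ring_hom (Rs ! i) A. \<forall>xs \<in> carrier (RDirProd_list Rs). \<psi> xs = \<gamma> (xs ! i)"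
  using assms(2,3)
proof (induction Rs arbitrary: \<psi>)
  interpret A: domain A by (rule assms(1))
  case Nil
  have "\<psi> [] = \<zero>\<^bsub>A\<^esub>"
    using ring_hom_zero[OF Nil(2) RDirProd_list_is_ring[OF Nil(1)] A.ring_axioms]
    unfolding RDirProd_list_zero by simp
  moreover have "\<psi> [] = \<one>\<^bsub>A\<^esub>"
    using ring_hom_one[OF Nil(2)] unfolding RDirProd_list_one by simp
  ultimately show ?case by simp
next
  interpret A: domain A by (rule assms(1))
  case (Cons R Rs)
  have rR: "ring R" using Cons.prems(1)[of 0] by simp
  have rRs: "ring (Rs ! i)" if "i < length Rs" for i using Cons.prems(1)[of "Suc i"] that by simp
  interpret R: ring R by (rule rR)
  interpret Q: ring "RDirProd_list Rs" by (rule RDirProd_list_is_ring) (rule rRs)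
  interpret P: ring "RDirProd_list (R # Rs)" by (rule RDirProd_list_is_ring) (rule Cons.prems(1))
  let ?P = "RDirProd_list (R # Rs)" and ?Q = "RDirProd_list Rs"
  note \<psi> = ring_hom_memE[OF Cons.prems(2)]
  note ops = RDirProd_list_Cons_ops
  let ?e = "\<one>\<^bsub>R\<^esub> # \<zero>\<^bsub>?Q\<^esub>" and ?e' = "\<zero>\<^bsub>R\<^esub> # \<one>\<^bsub>?Q\<^esub>"
  have ec: "?e \<in> carrier ?P" "?e' \<in> carrier ?P" 
    by (rule ops(4)[OF R.one_closed R.one_closed Q.zero_closed Q.zero_closed],
        rule ops(4)[OF R.zero_closed R.zero_closed Q.one_closed Q.one_closed])
  have \<psi>0: "\<psi> (\<zero>\<^bsub>R\<^esub> # \<zero>\<^bsub>?Q\<^esub>) = \<zero>\<^bsub>A\<^esub>"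
    using ring_hom_zero[OF Cons.prems(2) P.ring_axioms A.ring_axioms] RDirProd_list_zero'[of R Rs] by simp
  have "?e \<otimes>\<^bsub>?P\<^esub> ?e' = \<zero>\<^bsub>R\<^esub> # \<zero>\<^bsub>?Q\<^esub>" "?e \<oplus>\<^bsub>?P\<^esub> ?e' = \<one>\<^bsub>?P\<^esub>"
    using ops(3)[OF R.one_closed R.one_closed Q.one_closed Q.one_closed] by (simp_all add: ops(1,2))
  then have prod: "\<psi> ?e \<otimes>\<^bsub>A\<^esub> \<psi> ?e' = \<zero>\<^bsub>A\<^esub>" and sum: "\<psi> ?e \<oplus>\<^bsub>A\<^esub> \<psi> ?e' = \<one>\<^bsub>A\<^esub>"
    using \<psi>(2)[OF ec] \<psi>(3)[OF ec] \<psi>(4) \<psi>0 by simp_all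
  have mem: "\<exists>a as. a \<in> carrier R \<and> as \<in> carrier ?Q \<and> xs = a # as"
    if "xs \<in> carrier ?P" for xs
    using that unfolding RDirProd_list_carrier by auto
  show ?case
  proof (cases "\<psi> ?e' = \<zero>\<^bsub>A\<^esub>")
    case True
    then have e1: "\<psi> ?e = \<one>\<^bsub>A\<^esub>" using sum \<psi>(1)[OF ec(1)] by simp
    define \<gamma> where "\<gamma> a = \<psi> (a # \<zero>\<^bsub>?Q\<^esub>)" for a
    have "\<gamma> \<in> ring_hom R A"
    proof (rule ring_hom_memI)
      fix a b assume ab: "a \<in> carrier R"
      show "\<gamma> a \<in> carrier A" unfolding \<gamma>_def by (rule \<psi>(1)) (rule ops(4)[OF ab ab Q.zero_closed Q.zero_closed])
      assume b: "b \<in> carrier R"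
      note c = ops(4)[OF ab ab Q.zero_closed Q.zero_closed] ops(4)[OF b b Q.zero_closed Q.zero_closed]
      show "\<gamma> (a \<otimes>\<^bsub>R\<^esub> b) = \<gamma> a \<otimes>\<^bsub>A\<^esub> \<gamma> b" "\<gamma> (a \<oplus>\<^bsub>R\<^esub> b) = \<gamma> a \<oplus>\<^bsub>A\<^esub> \<gamma> b"
        unfolding \<gamma>_def \<psi>(2)[OF c, symmetric] \<psi>(3)[OF c, symmetric] using ab b by (simp_all add: ops)
    qed (simp add: \<gamma>_def e1)
    moreover have "\<psi> xs = \<gamma> (xs ! 0)" if xs: "xs \<in> carrier ?P" for xs
    proof -
      obtain a as where x: "a \<in> carrier R" "as \<in> carrier ?Q" "xs = a # as" using mem[OF xs] by blast
      have "xs \<otimes>\<^bsub>?P\<^esub> ?e = a # \<zero>\<^bsub>?Q\<^esub>" using x by (simp add: ops)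
      then have "\<gamma> (xs ! 0) = \<psi> xs \<otimes>\<^bsub>A\<^esub> \<psi> ?e" using \<psi>(2)[OF xs ec(1)] x by (simp add: \<gamma>_def)
      then show ?thesis using e1 \<psi>(1)[OF xs] by simp
    qed
    ultimately show ?thesis by (intro exI[of _ 0]) auto
  next
    case False
    then have e0: "\<psi> ?e = \<zero>\<^bsub>A\<^esub>"
      using prod A.integral \<psi>(1)[OF ec(1)] \<psi>(1)[OF ec(2)] by blast
    then have e1: "\<psi> ?e' = \<one>\<^bsub>A\<^esub>" using sum \<psi>(1)[OF ec(2)] by simp
    define \<psi>' where "\<psi>' as = \<psi> (\<zero>\<^bsub>R\<^esub> # as)" for as
    have "\<psi>' \<in> ring_hom ?Q A"
    proof (rule ring_hom_memI)
      fix a b assume ab: "a \<in> carrier ?Q"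
      show "\<psi>' a \<in> carrier A" unfolding \<psi>'_def by (rule \<psi>(1)) (rule ops(4)[OF R.zero_closed R.zero_closed ab ab])
      assume b: "b \<in> carrier ?Q"
      note c = ops(4)[OF R.zero_closed R.zero_closed ab ab] ops(4)[OF R.zero_closed R.zero_closed b b]
      show "\<psi>' (a \<otimes>\<^bsub>?Q\<^esub> b) = \<psi>' a \<otimes>\<^bsub>A\<^esub> \<psi>' b" "\<psi>' (a \<oplus>\<^bsub>?Q\<^esub> b) = \<psi>' a \<oplus>\<^bsub>A\<^esub> \<psi>' b"
        unfolding \<psi>'_def \<psi>(2)[OF c, symmetric] \<psi>(3)[OF c, symmetric] using ab b by (simp_all add: ops)
    qed (simp add: \<psi>'_def e1)
    then obtain i \<gamma> where i: "i < length Rs" "\<gamma> \<in> ring_hom (Rs ! i) A" "\<And>as. as \<in> carrier ?Q \<Longrightarrow> \<psi>' as = \<gamma> (as ! i)"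
      using Cons.IH[OF rRs] by blast
    have "\<psi> xs = \<gamma> (xs ! Suc i)" if xs: "xs \<in> carrier ?P" for xs
    proof -
      obtain a as where x: "a \<in> carrier R" "as \<in> carrier ?Q" "xs = a # as" using mem[OF xs] by blast
      have "xs \<otimes>\<^bsub>?P\<^esub> ?e' = \<zero>\<^bsub>R\<^esub> # as" using x by (simp add: ops)
      then have "\<psi>' as = \<psi> xs \<otimes>\<^bsub>A\<^esub> \<psi> ?e'" using \<psi>(2)[OF xs ec(2)] x by (simp add: \<psi>'_def)
      then show ?thesis using e1 \<psi>(1)[OF xs] i(3)[OF x(2)] x(3) by simp
    qed
    then show ?thesis using i(1,2) by (intro exI[of _ "Suc i"]) auto
  qed
qed

section \<open>The factors of the tensor product\<close>

locale tensor_decomposition = tensor_product K L M f g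
  for K :: "('k, 'z) ring_scheme" and L :: "('l, 'x) ring_scheme" and M :: "('m, 'y) ring_scheme" and f g +
  fixes Fs :: "('f, 'w) ring_scheme list" and \<phi> :: "(('l \<times> 'm) \<Rightarrow>\<^sub>0 int) set \<Rightarrow> 'f list"
  assumes factor_field: "i < length Fs \<Longrightarrow> field (Fs ! i)"
    and iso: "\<phi> \<in> ring_iso (tensor_ring K L M f g) (RDirProd_list Fs)"
begin

abbreviation "p \<equiv> left_emb K L M f g \<phi>"
abbreviation "q \<equiv> right_emb K L M f g \<phi>"

lemma factor_ring: "i < length Fs \<Longrightarrow> ring (Fs ! i)"
  using factor_field field.is_ring by blast

lemma \<phi>_hom: "\<phi> \<in> ring_hom T (RDirProd_list Fs)" and \<phi>_bij: "bij_betw \<phi> (carrier T) (carrier (RDirProd_list Fs))"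
  using iso by (auto simp: ring_iso_def)

lemma proj_hom: "i < length Fs \<Longrightarrow> (\<lambda>t. \<phi> t ! i) \<in> ring_hom T (Fs ! i)"
  using ring_hom_trans[OF \<phi>_hom RDirProd_list_proj_hom] by (simp add: comp_def)

lemma proj_surj:
  assumes i: "i < length Fs" and x: "x \<in> carrier (Fs ! i)"
  shows "\<exists>t \<in> carrier T. \<phi> t ! i = x"
proof -
  let ?xs = "(map (\<lambda>R. \<zero>\<^bsub>R\<^esub>) Fs)[i := x]"
  have "?xs \<in> carrier (RDirProd_list Fs)"
    using x i ring.ring_simprules(2)[OF factor_ring] by (intro RDirProd_list_carrier_memI) (auto simp: nth_list_update)
  then obtain t where "t \<in> carrier T" "\<phi> t = ?xs"
    using \<phi>_bij unfolding bij_betw_def by (metis imageE)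
  then show ?thesis using i by (intro bexI[of _ t]) auto
qed

lemma p_hom: "i < length Fs \<Longrightarrow> p i \<in> ring_hom L (Fs ! i)"
proof -
  assume "i < length Fs"
  note h = ring_hom_memE[OF proj_hom[OF this]]
  show ?thesis
    by (rule ring_hom_memI)
      (use h tens_closed tens_mult[of _ "\<one>\<^bsub>M\<^esub>" _ "\<one>\<^bsub>M\<^esub>"] tens_add_left tens_one in \<open>simp_all add: left_emb_def flip: h(2,3)\<close>)
qed

lemma q_hom: "i < length Fs \<Longrightarrow> q i \<in> ring_hom M (Fs ! i)"
proof -
  assume "i < length Fs"
  note h = ring_hom_memE[OF proj_hom[OF this]]
  show ?thesis
    by (rule ring_hom_memI)
      (use h tens_closed tens_mult[of "\<one>\<^bsub>L\<^esub>" _ "\<one>\<^bsub>L\<^esub>" _] tens_add_right tens_one in \<open>simp_all add: right_emb_def flip: h(2,3)\<close>)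
qed

lemma p_f_eq_q_g: "c \<in> carrier K \<Longrightarrow> p i (f c) = q i (g c)"
  by (simp add: left_emb_def right_emb_def tens_balanced)

lemma \<phi>_tens:
  assumes i: "i < length Fs" and "a \<in> carrier L" "b \<in> carrier M"
  shows "\<phi> (tens a b) ! i = p i a \<otimes>\<^bsub>Fs ! i\<^esub> q i b"
proof -
  have "tens a b = tens a \<one>\<^bsub>M\<^esub> \<otimes>\<^bsub>T\<^esub> tens \<one>\<^bsub>L\<^esub> b"
    using assms by (simp add: tens_mult)
  then show ?thesis
    using ring_hom_memE(2)[OF proj_hom[OF i], of "tens a \<one>\<^bsub>M\<^esub>" "tens \<one>\<^bsub>L\<^esub> b"] assms
    by (simp add: left_emb_def right_emb_def tens_closed)
qed

text \<open>The tensor product is generated by pure tensors and surjects onto each factor.\<close>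

lemma factor_generated:
  assumes i: "i < length Fs" and V: "subring V (Fs ! i)" "p i ` carrier L \<subseteq> V" "q i ` carrier M \<subseteq> V"
  shows "carrier (Fs ! i) \<subseteq> V"
proof
  interpret F: field "Fs ! i" by (rule factor_field[OF i])
  interpret T: cring T by (rule T_cring)
  interpret pr: ring_hom_ring T "Fs ! i" "\<lambda>t. \<phi> t ! i"
    by (rule ring_hom_ringI2[OF T.ring_axioms F.ring_axioms proj_hom[OF i]])
  note Vr = subringE[OF V(1)]
  fix x assume "x \<in> carrier (Fs ! i)"
  then obtain t where t: "t \<in> carrier T" "\<phi> t ! i = x" using proj_surj[OF i] by blast
  have "\<phi> t ! i \<in> V" using t(1)
  proof (induction t rule: T_induct)
    case (tensor a b)
    then show ?case using V(2,3) Vr(6) by (auto simp: \<phi>_tens[OF i])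
  next
    case (diff s t)
    then have "\<phi> (s \<ominus>\<^bsub>T\<^esub> t) ! i = \<phi> s ! i \<oplus>\<^bsub>Fs ! i\<^esub> \<ominus>\<^bsub>Fs ! i\<^esub> (\<phi> t ! i)"
      by (simp add: a_minus_def)
    then show ?case using diff Vr(5,7) by simp
  qed
  then show "x \<in> V" using t(2) by simp
qed

lemma factor_hom_eq:
  assumes i: "i < length Fs" and A: "ring A" and h: "\<gamma> \<in> ring_hom (Fs ! i) A" "\<gamma>' \<in> ring_hom (Fs ! i) A"
    and eq: "\<And>a. a \<in> carrier L \<Longrightarrow> \<gamma> (p i a) = \<gamma>' (p i a)" "\<And>b. b \<in> carrier M \<Longrightarrow> \<gamma> (q i b) = \<gamma>' (q i b)"
    and x: "x \<in> carrier (Fs ! i)"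
  shows "\<gamma> x = \<gamma>' x"
proof -
  obtain t where t: "t \<in> carrier T" "\<phi> t ! i = x" using proj_surj[OF i x] by blast
  have "(\<lambda>t. \<gamma> (\<phi> t ! i)) t = (\<lambda>t. \<gamma>' (\<phi> t ! i)) t"
  proof (rule T_hom_eq[OF A _ _ _ t(1)])
    show "(\<lambda>t. \<gamma> (\<phi> t ! i)) \<in> ring_hom T A" "(\<lambda>t. \<gamma>' (\<phi> t ! i)) \<in> ring_hom T A"
      using ring_hom_trans[OF proj_hom[OF i] h(1)] ring_hom_trans[OF proj_hom[OF i] h(2)] by (simp_all add: comp_def)
    show "\<gamma> (\<phi> (tens a b) ! i) = \<gamma>' (\<phi> (tens a b) ! i)" if ab: "a \<in> carrier L" "b \<in> carrier M" for a b
      using ring_hom_memE(2)[OF h(1)] ring_hom_memE(2)[OF h(2)] ring_hom_memE(1)[OF p_hom[OF i] ab(1)]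
        ring_hom_memE(1)[OF q_hom[OF i] ab(2)] by (simp add: \<phi>_tens[OF i ab] eq ab)
  qed
  then show ?thesis using t(2) by simp
qed

lemma factors_through_some:
  assumes A: "domain A" and \<beta>: "\<beta> \<in> ring_hom L A" and \<eta>: "\<eta> \<in> ring_hom M A"
    and bal: "\<And>k. k \<in> carrier K \<Longrightarrow> \<beta> (f k) = \<eta> (g k)"
  shows "\<exists>i < length Fs. \<exists>\<gamma> \<in> ring_hom (Fs ! i) A.
    (\<forall>a \<in> carrier L. \<gamma> (p i a) = \<beta> a) \<and> (\<forall>b \<in> carrier M. \<gamma> (q i b) = \<eta> b)"
proof -
  interpret A: domain A by (rule A)
  obtain h where h: "h \<in> ring_hom T A" "\<And>a b. \<lbrakk>a \<in> carrier L; b \<in> carrier M\<rbrakk> \<Longrightarrow> h (tens a b) = \<beta> a \<otimes>\<^bsub>A\<^esub> \<eta> b"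
    using tensor_universal[OF A.cring_axioms \<beta> \<eta> bal] by blast
  define \<psi> where "\<psi> = inv_into (carrier T) \<phi>"
  have \<psi>: "\<psi> \<in> ring_iso (RDirProd_list Fs) T"
    unfolding \<psi>_def using T_cring iso by (intro ring_iso_set_sym cring.axioms(1))
  have "h \<circ> \<psi> \<in> ring_hom (RDirProd_list Fs) A"
    using ring_hom_trans[OF _ h(1)] \<psi> by (auto simp: ring_iso_def)
  then obtain i \<gamma> where i: "i < length Fs" "\<gamma> \<in> ring_hom (Fs ! i) A"
      "\<And>xs. xs \<in> carrier (RDirProd_list Fs) \<Longrightarrow> h (\<psi> xs) = \<gamma> (xs ! i)"
    using hom_from_product_factors[OF A factor_ring, of "h \<circ> \<psi>"] by auto
  have *: "\<gamma> (\<phi> t ! i) = h t" if "t \<in> carrier T" for t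
    using i(3)[OF bij_betwE[OF \<phi>_bij, rule_format, OF that]] \<phi>_bij that
    by (simp add: \<psi>_def bij_betw_def)
  have "\<gamma> (p i a) = \<beta> a" if "a \<in> carrier L" for a
    using *[OF tens_closed[OF that M.one_closed]] h(2)[OF that M.one_closed] ring_hom_memE(1)[OF \<beta> that] ring_hom_memE(4)[OF \<eta>]
    by (simp add: left_emb_def)
  moreover have "\<gamma> (q i b) = \<eta> b" if "b \<in> carrier M" for b
    using *[OF tens_closed[OF L.one_closed that]] h(2)[OF L.one_closed that] ring_hom_memE(1)[OF \<eta> that] ring_hom_memE(4)[OF \<beta>]
    by (simp add: right_emb_def)
  ultimately show ?thesis using i(1,2) by blast
qed

text \<open>A homomorphism through the \<open>i\<close>-th factor sends the \<open>i\<close>-th idempotent to one, a homomorphism through another factor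
sends it to zero.\<close>

lemma factors_through_unique:
  assumes A: "domain A" and i: "i < length Fs" "j < length Fs"
    and h: "\<gamma> \<in> ring_hom (Fs ! i) A" "\<gamma>' \<in> ring_hom (Fs ! j) A"
    and eq: "\<And>a. a \<in> carrier L \<Longrightarrow> \<gamma> (p i a) = \<gamma>' (p j a)" "\<And>b. b \<in> carrier M \<Longrightarrow> \<gamma> (q i b) = \<gamma>' (q j b)"
  shows "i = j"
proof (rule ccontr)
  interpret A: domain A by (rule A)
  assume neq: "i \<noteq> j"
  let ?xs = "(map (\<lambda>R. \<zero>\<^bsub>R\<^esub>) Fs)[i := \<one>\<^bsub>Fs ! i\<^esub>]"
  have "?xs \<in> carrier (RDirProd_list Fs)"
    using i ring.ring_simprules(2,6)[OF factor_ring] by (intro RDirProd_list_carrier_memI) (auto simp: nth_list_update)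
  then obtain t where t: "t \<in> carrier T" "\<phi> t = ?xs"
    using \<phi>_bij unfolding bij_betw_def by (metis imageE)
  have "(\<lambda>t. \<gamma> (\<phi> t ! i)) t = (\<lambda>t. \<gamma>' (\<phi> t ! j)) t"
  proof (rule T_hom_eq[OF A.ring_axioms _ _ _ t(1)])
    show "(\<lambda>t. \<gamma> (\<phi> t ! i)) \<in> ring_hom T A" "(\<lambda>t. \<gamma>' (\<phi> t ! j)) \<in> ring_hom T A"
      using ring_hom_trans[OF proj_hom[OF i(1)] h(1)] ring_hom_trans[OF proj_hom[OF i(2)] h(2)] by (simp_all add: comp_def)
    show "\<gamma> (\<phi> (tens a b) ! i) = \<gamma>' (\<phi> (tens a b) ! j)" if ab: "a \<in> carrier L" "b \<in> carrier M" for a b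
      using ring_hom_memE(2)[OF h(1)] ring_hom_memE(2)[OF h(2)]
        ring_hom_memE(1)[OF p_hom[OF i(1)] ab(1)] ring_hom_memE(1)[OF q_hom[OF i(1)] ab(2)]
        ring_hom_memE(1)[OF p_hom[OF i(2)] ab(1)] ring_hom_memE(1)[OF q_hom[OF i(2)] ab(2)]
      by (simp add: \<phi>_tens i ab eq)
  qed
  then have "\<gamma> \<one>\<^bsub>Fs ! i\<^esub> = \<gamma>' \<zero>\<^bsub>Fs ! j\<^esub>" using t(2) i neq by simp
  then show False
    using ring_hom_one[OF h(1)] ring_hom_zero[OF h(2) factor_ring[OF i(2)] A.ring_axioms] by simp
qed

text \<open>The homomorphism \<open>h\<close> on the tensor product is determined by \<open>\<gamma>\<close>, so it can be eliminated: what remains is that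
\<open>\<gamma>\<close> restricts to \<open>\<beta>\<close> on \<open>L\<close> and to \<open>\<iota>\<close> on \<open>M\<close>.\<close>

lemma corresponds_iff:
  assumes A: "cring A" and i: "i < length Fs" and \<beta>: "(\<lambda>a. \<beta> (completion_embed L vL a)) \<in> ring_hom L A"
    and \<eta>: "(\<lambda>b. \<iota> (completion_embed M vM b)) \<in> ring_hom M A"
    and bal: "\<And>k. k \<in> carrier K \<Longrightarrow> \<beta> (completion_embed L vL (f k)) = \<iota> (completion_embed M vM (g k))"
  shows "corresponds K L M f g vL vM Fs \<phi> A \<iota> \<beta> i \<nu> \<longleftrightarrow>
    (\<exists>\<gamma> \<in> ring_hom (Fs ! i) A. (\<forall>a \<in> carrier L. \<gamma> (p i a) = \<beta> (completion_embed L vL a)) \<and>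
      (\<forall>b \<in> carrier M. \<gamma> (q i b) = \<iota> (completion_embed M vM b)) \<and>
      \<nu> = (\<lambda>x \<in> carrier (Fs ! i). closure_abs M vM A \<iota> (\<gamma> x)))"
proof
  interpret A: cring A by (rule A)
  assume "corresponds K L M f g vL vM Fs \<phi> A \<iota> \<beta> i \<nu>"
  then obtain h \<gamma> where h: "h \<in> ring_hom T A"
      "\<And>a b. \<lbrakk>a \<in> carrier L; b \<in> carrier M\<rbrakk> \<Longrightarrow> h (tens a b) = \<beta> (completion_embed L vL a) \<otimes>\<^bsub>A\<^esub> \<iota> (completion_embed M vM b)"
      "\<gamma> \<in> ring_hom (Fs ! i) A" "\<And>t. t \<in> carrier T \<Longrightarrow> h t = \<gamma> (\<phi> t ! i)"
      "\<nu> = (\<lambda>x \<in> carrier (Fs ! i). closure_abs M vM A \<iota> (\<gamma> x))"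
    unfolding corresponds_def by blast
  have "\<gamma> (p i a) = \<beta> (completion_embed L vL a)" if "a \<in> carrier L" for a
    using h(4)[OF tens_closed[OF that M.one_closed]] h(2)[OF that M.one_closed] ring_hom_memE(1)[OF \<beta> that] ring_hom_memE(4)[OF \<eta>]
    by (simp add: left_emb_def)
  moreover have "\<gamma> (q i b) = \<iota> (completion_embed M vM b)" if "b \<in> carrier M" for b
    using h(4)[OF tens_closed[OF L.one_closed that]] h(2)[OF L.one_closed that] ring_hom_memE(1)[OF \<eta> that] ring_hom_memE(4)[OF \<beta>]
    by (simp add: right_emb_def)
  ultimately show "\<exists>\<gamma> \<in> ring_hom (Fs ! i) A. (\<forall>a \<in> carrier L. \<gamma> (p i a) = \<beta> (completion_embed L vL a)) \<and>
      (\<forall>b \<in> carrier M. \<gamma> (q i b) = \<iota> (completion_embed M vM b)) \<and>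
      \<nu> = (\<lambda>x \<in> carrier (Fs ! i). closure_abs M vM A \<iota> (\<gamma> x))"
    using h(3,5) by blast
next
  assume "\<exists>\<gamma> \<in> ring_hom (Fs ! i) A. (\<forall>a \<in> carrier L. \<gamma> (p i a) = \<beta> (completion_embed L vL a)) \<and>
      (\<forall>b \<in> carrier M. \<gamma> (q i b) = \<iota> (completion_embed M vM b)) \<and>
      \<nu> = (\<lambda>x \<in> carrier (Fs ! i). closure_abs M vM A \<iota> (\<gamma> x))"
  then obtain \<gamma> where \<gamma>: "\<gamma> \<in> ring_hom (Fs ! i) A" "\<And>a. a \<in> carrier L \<Longrightarrow> \<gamma> (p i a) = \<beta> (completion_embed L vL a)"
      "\<And>b. b \<in> carrier M \<Longrightarrow> \<gamma> (q i b) = \<iota> (completion_embed M vM b)"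
      "\<nu> = (\<lambda>x \<in> carrier (Fs ! i). closure_abs M vM A \<iota> (\<gamma> x))"
    by blast
  have "(\<lambda>t. \<gamma> (\<phi> t ! i)) \<in> ring_hom T A"
    using ring_hom_trans[OF proj_hom[OF i] \<gamma>(1)] by (simp add: comp_def)
  moreover have "\<gamma> (\<phi> (tens a b) ! i) = \<beta> (completion_embed L vL a) \<otimes>\<^bsub>A\<^esub> \<iota> (completion_embed M vM b)"
    if ab: "a \<in> carrier L" "b \<in> carrier M" for a b
    using ring_hom_memE(2)[OF \<gamma>(1)] ring_hom_memE(1)[OF p_hom[OF i] ab(1)] ring_hom_memE(1)[OF q_hom[OF i] ab(2)]
    by (simp add: \<phi>_tens[OF i ab] \<gamma> ab)
  ultimately show "corresponds K L M f g vL vM Fs \<phi> A \<iota> \<beta> i \<nu>"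
    unfolding corresponds_def using \<gamma>(1,4) by blast
qed

end

section \<open>Isometries of algebraic extensions\<close>

lemma absolute_value_pullback:
  assumes "field R" "field S" "h \<in> ring_hom R S" "absolute_value S w"
  shows "absolute_value R (\<lambda>x. w (h x))"
proof -
  interpret R: field R by fact
  interpret S: valued_field S w using assms(2,4) by (simp add: valued_field_def valued_field_axioms_def)
  interpret h: ring_hom_ring R S h by (rule ring_hom_ringI2[OF R.ring_axioms S.ring_axioms assms(3)])
  have "inj_on h (carrier R)" using h.img_is_subfield(1)[OF R.carrier_is_subfield] by simp
  then have "h x = \<zero>\<^bsub>S\<^esub> \<longleftrightarrow> x = \<zero>\<^bsub>R\<^esub>" if "x \<in> carrier R" for x
    using that h.hom_zero R.zero_closed unfolding inj_on_def by metis
  then show ?thesis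
    unfolding absolute_value_def using S.v_add by simp
qed

lemma complete_image:
  assumes "ring R" "ring S" "h \<in> ring_hom R S" and iso: "\<And>x. x \<in> carrier R \<Longrightarrow> w (h x) = v x"
    and comp: "complete_subset R v (carrier R)"
  shows "complete_subset S w (h ` carrier R)"
  unfolding complete_subset_def
proof (intro ballI impI)
  interpret h: ring_hom_ring R S h by (rule ring_hom_ringI2[OF assms(1-3)])
  fix x assume x: "x \<in> cauchy_seqs S w" "range x \<subseteq> h ` carrier R"
  then have "\<exists>y. y \<in> carrier R \<and> x n = h y" for n by auto
  then obtain y where y: "y n \<in> carrier R" "x n = h (y n)" for n by metis
  have d: "w (x m \<ominus>\<^bsub>S\<^esub> h b) = v (y m \<ominus>\<^bsub>R\<^esub> b)" if "b \<in> carrier R" for m b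
    using iso[of "y m \<ominus>\<^bsub>R\<^esub> b"] y(1)[of m] that by (simp add: y(2) a_minus_def)
  have "y \<in> cauchy_seqs R v"
    using x(1) d[OF y(1)] y(1) unfolding cauchy_seqs_def by (simp add: y(2))
  then obtain a where a: "a \<in> carrier R" "(\<lambda>n. v (y n \<ominus>\<^bsub>R\<^esub> a)) \<longlonglongrightarrow> 0"
    using comp y(1) unfolding complete_subset_def by (metis image_subsetI)
  then show "\<exists>l \<in> h ` carrier R. (\<lambda>n. w (x n \<ominus>\<^bsub>S\<^esub> l)) \<longlonglongrightarrow> 0"
    using d by auto
qed

text \<open>Pull the absolute value of \<open>S\<close> back to \<open>R\<close> and use that extensions from the complete subfield \<open>k\<close> are unique.\<close>

lemma algebraic_isometry:
  assumes R: "valued_field R v" and S: "valued_field S w" and k: "subfield k R" "complete_subset R v k"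
    and alg: "\<And>x. x \<in> carrier R \<Longrightarrow> (ring.algebraic R over k) x"
    and h: "h \<in> ring_hom R S" "\<And>c. c \<in> k \<Longrightarrow> w (h c) = v c" and x: "x \<in> carrier R"
  shows "w (h x) = v x"
proof -
  interpret R: valued_field R v by (rule R)
  interpret S: valued_field S w by (rule S)
  show ?thesis
    using R.algebraic_abs_unique[OF k absolute_value_pullback[OF R.field_axioms S.field_axioms h(1) S.abs_v] _ x alg[OF x]] h(2)
    by simp
qed

lemma image_subfield:
  assumes "field R" "field S" "h \<in> ring_hom R S"
  shows "subfield (h ` carrier R) S" "inj_on h (carrier R)"
proof -
  interpret R: field R by fact
  interpret S: field S by fact
  interpret h: ring_hom_ring R S h by (rule ring_hom_ringI2[OF R.ring_axioms S.ring_axioms assms(3)])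
  show "subfield (h ` carrier R) S" "inj_on h (carrier R)"
    using h.img_is_subfield[OF R.carrier_is_subfield] by simp_all
qed

lemma inv_into_hom:
  assumes "field R" "field S" "h \<in> ring_hom R S"
  shows "inv_into (carrier R) h \<in> ring_hom (S\<lparr>carrier := h ` carrier R\<rparr>) R"
proof -
  interpret R: field R by fact
  interpret S: field S by fact
  interpret h: ring_hom_ring R S h by (rule ring_hom_ringI2[OF R.ring_axioms S.ring_axioms assms(3)])
  show ?thesis
    using h.inv_ring_hom[OF image_subfield(2)[OF assms] R.carrier_is_subring] by (rule ring_hom_ring.homh)
qed

subsection \<open>The absolute value of the algebraic closure\<close>

text \<open>The definite description in \<open>closure_abs\<close> is justified by existence and uniqueness for the algebraic extension
\<open>A\<close> of the complete subfield \<open>\<iota>(Mh)\<close>, to which the absolute value of \<open>Mh\<close> is transported.\<close>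

lemma closure_abs:
  assumes M: "valued_field M vM" and \<iota>: "\<iota> \<in> ring_hom (field_completion M vM) A"
    and A: "algebraic_closure A (\<iota> ` carrier (field_completion M vM))"
  shows "absolute_value A (closure_abs M vM A \<iota>)"
    and "\<And>x. x \<in> carrier (field_completion M vM) \<Longrightarrow> closure_abs M vM A \<iota> (\<iota> x) = completion_abs M vM x"
    and "\<And>w x. \<lbrakk>absolute_value A w; \<And>y. y \<in> carrier (field_completion M vM) \<Longrightarrow> w (\<iota> y) = completion_abs M vM y;
      x \<in> carrier A\<rbrakk> \<Longrightarrow> w x = closure_abs M vM A \<iota> x"
    and "complete_subset A (closure_abs M vM A \<iota>) (\<iota> ` carrier (field_completion M vM))"
proof -
  interpret M: valued_field M vM by (rule M)
  interpret Mh: valued_field M.Rh M.vh by (rule M.completion_valued_field)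
  interpret A: algebraic_closure A "\<iota> ` carrier M.Rh" by (rule A)
  let ?k = "\<iota> ` carrier M.Rh"
  have k: "subfield ?k A" by (rule A.subfield_axioms)
  have inj: "inj_on \<iota> (carrier M.Rh)" by (rule image_subfield(2)[OF Mh.field_axioms A.field_axioms \<iota>])
  define v0 where "v0 y = M.vh (inv_into (carrier M.Rh) \<iota> y)" for y
  have v0: "v0 (\<iota> x) = M.vh x" if "x \<in> carrier M.Rh" for x
    using that inj by (simp add: v0_def)
  have av0: "absolute_value (A\<lparr>carrier := ?k\<rparr>) v0"
    unfolding v0_def
    by (rule absolute_value_pullback[OF A.subfield_iff(2)[OF k] Mh.field_axioms
        inv_into_hom[OF Mh.field_axioms A.field_axioms \<iota>] Mh.abs_v])
  have complete: "complete_subset A w ?k" if "\<And>x. x \<in> carrier M.Rh \<Longrightarrow> w (\<iota> x) = M.vh x" for w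
    by (rule complete_image[OF Mh.ring_axioms A.ring_axioms \<iota> that M.completion_complete])
  have unique: "w x = w' x" if w: "absolute_value A w" "\<And>x. x \<in> carrier M.Rh \<Longrightarrow> w (\<iota> x) = M.vh x"
      and w': "absolute_value A w'" "\<And>x. x \<in> carrier M.Rh \<Longrightarrow> w' (\<iota> x) = M.vh x" and x: "x \<in> carrier A" for w w' x
  proof -
    interpret W: valued_field A w' using w'(1) A.field_axioms by (simp add: valued_field_def valued_field_axioms_def)
    have eq: "w c = w' c" if "c \<in> ?k" for c
    proof -
      obtain y where "y \<in> carrier M.Rh" "c = \<iota> y" using \<open>c \<in> ?k\<close> by blast
      then show ?thesis using w(2)[of y] w'(2)[of y] by metis
    qed
    show ?thesis
      by (rule W.algebraic_abs_unique[OF k complete[OF w'(2)] w(1) eq x A.algebraic_extension[OF x]])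
  qed
  obtain w where w: "absolute_value A w" "\<And>c. c \<in> ?k \<Longrightarrow> w c = v0 c"
    using A.algebraic_absolute_value[OF k av0 complete[OF v0] A.algebraic_extension] by metis
  let ?P = "\<lambda>w. w \<in> extensional (carrier A) \<and> absolute_value A w \<and> (\<forall>x \<in> carrier M.Rh. w (\<iota> x) = M.vh x)"
  have \<iota>c: "\<iota> x \<in> carrier A" if "x \<in> carrier M.Rh" for x using ring_hom_memE(1)[OF \<iota> that] .
  have "absolute_value A (restrict w (carrier A))"
    using w(1) unfolding absolute_value_def by simp
  moreover have "restrict w (carrier A) (\<iota> x) = M.vh x" if "x \<in> carrier M.Rh" for x
    using w(2)[OF imageI[OF that]] v0[OF that] \<iota>c[OF that] by (metis restrict_apply')
  ultimately have "?P (restrict w (carrier A))"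
    using restrict_extensional by blast
  moreover have "w = w'" if "?P w" "?P w'" for w w'
  proof (rule extensionalityI)
    show "w \<in> extensional (carrier A)" "w' \<in> extensional (carrier A)" using that by blast+
    show "w x = w' x" if "x \<in> carrier A" for x
      using \<open>?P w\<close> \<open>?P w'\<close> unique[OF _ _ _ _ that, of w w'] by blast
  qed
  ultimately have "\<exists>!w. ?P w" by blast
  from theI'[OF this] have P: "?P (closure_abs M vM A \<iota>)"
    unfolding closure_abs_def .
  then show "absolute_value A (closure_abs M vM A \<iota>)" by blast
  show eq: "closure_abs M vM A \<iota> (\<iota> x) = M.vh x" if "x \<in> carrier M.Rh" for x
    using P that by blast
  show "w x = closure_abs M vM A \<iota> x"
    if "absolute_value A w" "\<And>y. y \<in> carrier M.Rh \<Longrightarrow> w (\<iota> y) = M.vh y" "x \<in> carrier A" for w x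
    using unique[of w "closure_abs M vM A \<iota>" x] P that by blast
  show "complete_subset A (closure_abs M vM A \<iota>) ?k"
    by (rule complete[OF eq])
qed

subsection \<open>Finite extensions of complete fields\<close>

lemma combine_hom_mem:
  assumes "ring L" "ring S" "e \<in> ring_hom L S" "subring B S"
    and "set Ks \<subseteq> carrier L" "set Us \<subseteq> carrier L" "e ` set Ks \<subseteq> B" "e ` set Us \<subseteq> B"
  shows "e (ring.combine L Ks Us) \<in> B"
proof -
  interpret L: ring L by fact
  interpret S: ring S by fact
  interpret e: ring_hom_ring L S e by (rule ring_hom_ringI2[OF assms(1-3)])
  note Br = subringE[OF assms(4)]
  show ?thesis
    using assms(5-8)
  proof (induction Ks Us rule: L.combine.induct)
    case (1 c Ks u Us)
    then show ?case using Br(6)[of "e c" "e u"] Br(7) by simp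
  qed (use Br(2) in simp_all)
qed

text \<open>The left-hand side is finite over the complete \<open>k\<close>, hence complete, hence closed; it contains the dense image of \<open>R\<close>.\<close>

lemma (in valued_field) completion_generated:
  assumes k: "subfield k Rh" "complete_subset Rh vh k" and us: "set us \<subseteq> carrier R"
    and alg: "\<And>u. u \<in> set us \<Longrightarrow> (ring.algebraic Rh over k) (emb u)"
    and gen: "emb ` carrier R \<subseteq> ring.finite_extension Rh k (map emb us)"
  shows "ring.finite_extension Rh k (map emb us) = carrier Rh"
proof -
  interpret H: valued_field Rh vh by (rule completion_valued_field)
  let ?B = "H.finite_extension k (map emb us)"
  have usc: "set (map emb us) \<subseteq> carrier Rh" using us by auto
  have fin: "H.finite_dimension k ?B"
    using H.finite_extension_finite_dimension(1)[OF k(1) usc] alg by auto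
  then obtain n where "H.dimension n k ?B" by auto
  then have comp: "complete_subset Rh vh ?B"
    using H.finite_dimension_bounded[OF k] by blast
  have "U \<in> ?B" if U: "U \<in> carrier Rh" for U
  proof -
    obtain x where x: "x \<in> cauchy_seqs R v" "U = cls x" using cls_surj[OF U] by blast
    have xB: "emb (x n) \<in> ?B" and xc: "emb (x n) \<in> carrier Rh" for n
      using gen cauchy_closed[OF x(1)] by auto
    have lim: "(\<lambda>n. vh (emb (x n) \<ominus>\<^bsub>Rh\<^esub> U)) \<longlonglongrightarrow> 0"
      using emb_tendsto[OF x(1)] x(2) by simp
    have cau: "(\<lambda>n. emb (x n)) \<in> cauchy_seqs Rh vh"
      by (rule H.convergent_imp_cauchy[OF _ U lim]) (use xc in simp)
    have "range (\<lambda>n. emb (x n)) \<subseteq> ?B" using xB by (rule image_subsetI)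
    from comp[unfolded complete_subset_def, rule_format, OF cau this]
    obtain l where l: "l \<in> ?B" "(\<lambda>n. vh (emb (x n) \<ominus>\<^bsub>Rh\<^esub> l)) \<longlonglongrightarrow> 0"
      by (rule bexE)
    have lc: "l \<in> carrier Rh"
      using l(1) H.finite_extension_in_carrier[OF subfieldE(3)[OF k(1)] usc] by blast
    have "U = l"
      by (rule H.limit_unique[of "\<lambda>n. emb (x n)", OF _ U lc lim l(2)]) (use xc in simp)
    then show ?thesis using l(1) by simp
  qed
  moreover have "?B \<subseteq> carrier Rh"
    by (rule H.finite_extension_in_carrier[OF subfieldE(3)[OF k(1)] usc])
  ultimately show ?thesis by blast
qed

lemma alg_embs_count:
  assumes R: "field R" and S: "field S" and A: "algebraically_closed A"
    and j: "j \<in> ring_hom R S" and \<eta>: "\<eta> \<in> ring_hom R A" and us: "set us \<subseteq> carrier S"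
    and simple: "\<And>u. u \<in> set us \<Longrightarrow> root_of_simple_rooted S A (j ` carrier R) (\<eta> \<circ> inv_into (carrier R) j) u"
    and gen: "ring.finite_extension S (j ` carrier R) us = carrier S"
  shows "finite (alg_embs R S A j \<eta>)" "card (alg_embs R S A j \<eta>) = ext_degree R S j" "finite_ext R S j"
proof -
  interpret A: algebraically_closed A by (rule A)
  interpret S: field S by (rule S)
  let ?k = "j ` carrier R" and ?\<sigma> = "\<eta> \<circ> inv_into (carrier R) j"
  have inj: "inj_on j (carrier R)" by (rule image_subfield(2)[OF R S j])
  have "?\<sigma> \<in> ring_hom (S\<lparr>carrier := ?k\<rparr>) A"
    by (rule ring_hom_trans[OF inv_into_hom[OF R S j] \<eta>])
  then have "subfield_hom S A ?k ?\<sigma>"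
    using image_subfield(1)[OF R S j] S A.field_axioms by (simp add: subfield_hom_def subfield_hom_axioms_def)
  note count = subfield_hom.card_finite_extension_hom[OF this A us simple, unfolded gen]
  have "alg_embs R S A j \<eta> = hom_extensions S A ?k ?\<sigma> (carrier S)"
    using inj by (auto simp: alg_embs_def hom_extensions_def)
  then show "finite (alg_embs R S A j \<eta>)" "card (alg_embs R S A j \<eta>) = ext_degree R S j" "finite_ext R S j"
    using count by (simp_all add: ext_degree_def finite_ext_def)
qed

lemma restrict_ring_hom:
  assumes "ring R" "h \<in> ring_hom R S" shows "restrict h (carrier R) \<in> ring_hom R S"
proof -
  interpret R: ring R by fact
  show ?thesis
    using assms(2) by (auto simp: ring_hom_def)
qed

text \<open>If \<open>F\<close> is generated by the image of \<open>L\<close> and by elements that \<open>h\<close> maps into \<open>k\<close>, then \<open>h\<close> maps \<open>F\<close> into the extension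
of \<open>k\<close> by the images of a basis of \<open>L\<close> over \<open>k0\<close>. The hypothesis \<open>gen\<close> is phrased with subrings \<open>V\<close> so that it
covers \<open>F = L\<close> as well as the factors of the tensor product. The result is used for \<open>h\<close> the
embedding into the completion of \<open>F\<close>, and for homomorphisms from \<open>F\<close> to the algebraic closure.\<close>

lemma image_in_finite_extension:
  assumes L: "field L" and k0: "subfield k0 L" "ring.finite_dimension L k0 (carrier L)"
    and F: "ring F" and S: "field S" and e: "e \<in> ring_hom L F" and h: "h \<in> ring_hom F S"
    and k: "subfield k S" "\<And>c. c \<in> k0 \<Longrightarrow> h (e c) \<in> k"
    and gen: "\<And>V. \<lbrakk>subring V F; e ` carrier L \<subseteq> V; {x \<in> carrier F. h x \<in> k} \<subseteq> V\<rbrakk> \<Longrightarrow> carrier F \<subseteq> V"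
  obtains us where "set us \<subseteq> carrier L" "h ` carrier F \<subseteq> ring.finite_extension S k (map (\<lambda>u. h (e u)) us)"
proof -
  interpret L: field L by (rule L)
  interpret F: ring F by (rule F)
  interpret S: field S by (rule S)
  interpret h: ring_hom_ring F S h by (rule ring_hom_ringI2[OF F.ring_axioms S.ring_axioms h])
  obtain n where "L.dimension n k0 (carrier L)" using k0(2) by auto
  then obtain us where us: "set us \<subseteq> carrier L" "L.Span k0 us = carrier L"
    using L.exists_base[OF k0(1)] by blast
  let ?xs = "map (\<lambda>u. h (e u)) us" and ?B = "S.finite_extension k (map (\<lambda>u. h (e u)) us)"
  have xs: "set ?xs \<subseteq> carrier S"
    using us(1) ring_hom_memE(1)[OF e] ring_hom_memE(1)[OF h] by auto
  have B: "subring ?B S" by (rule S.finite_extension_is_subring[OF subfieldE(1)[OF k(1)] xs])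
  have kB: "k \<subseteq> ?B" by (rule S.finite_extension_incl[OF subfieldE(3)[OF k(1)] xs])
  have xB: "set ?xs \<subseteq> ?B" by (rule S.finite_extension_mem[OF subfieldE(1)[OF k(1)] xs])
  note Br = subringE[OF B]
  let ?V = "{x \<in> carrier F. h x \<in> ?B}"
  have he: "(\<lambda>a. h (e a)) \<in> ring_hom L S" using ring_hom_trans[OF e h] by (simp add: comp_def)
  have "carrier F \<subseteq> ?V"
  proof (rule gen)
    show "subring ?V F"
      by (rule F.subringI) (use Br(2,3,5,6,7) in auto)
    show "e ` carrier L \<subseteq> ?V"
    proof
      fix y assume "y \<in> e ` carrier L"
      then obtain a where a: "a \<in> carrier L" "y = e a" by blast
      then have "a \<in> L.Span k0 us" using us(2) by simp
      then obtain Ks where Ks: "set Ks \<subseteq> k0" "a = L.combine Ks us"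
        using L.Span_mem_iff_length_version[OF k0(1) us(1)] by blast
      have "h (e (L.combine Ks us)) \<in> ?B"
        by (rule combine_hom_mem[OF L.ring_axioms S.ring_axioms he B])
          (use Ks(1) us(1) k(2) kB xB subfieldE(3)[OF k0(1)] in auto)
      then show "y \<in> ?V" using a Ks(2) ring_hom_memE(1)[OF e a(1)] by simp
    qed
    show "{x \<in> carrier F. h x \<in> k} \<subseteq> ?V" using kB by blast
  qed
  then show thesis using us(1) by (intro that[of us]) auto
qed

text \<open>The common form of the two counts, with base \<open>C\<close> the completion of \<open>K\<close> for \<open>F = L\<close>, and the completion of \<open>M\<close> for
\<open>F\<close> a factor of the tensor product. The completion of \<open>F\<close> is generated over \<open>C\<close> by a basis of \<open>L\<close>, whose elements
are roots of polynomials with simple roots.\<close>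

lemma completion_embeddings:
  assumes F: "valued_field F v" and C: "valued_field C vC" "complete_subset C vC (carrier C)"
    and j: "j \<in> ring_hom C (field_completion F v)" "\<And>c. c \<in> carrier C \<Longrightarrow> completion_abs F v (j c) = vC c"
    and L: "field L" "subfield k0 L" "ring.finite_dimension L k0 (carrier L)"
      "\<And>x. x \<in> carrier L \<Longrightarrow> ring.separable_element L k0 x"
    and e: "e \<in> ring_hom L F" "\<And>c. c \<in> k0 \<Longrightarrow> completion_embed F v (e c) \<in> j ` carrier C"
    and gen: "\<And>V. \<lbrakk>subring V F; e ` carrier L \<subseteq> V; {x \<in> carrier F. completion_embed F v x \<in> j ` carrier C} \<subseteq> V\<rbrakk>
      \<Longrightarrow> carrier F \<subseteq> V"
    and A: "algebraically_closed A" and \<eta>: "\<eta> \<in> ring_hom C A"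
  shows "finite (alg_embs C (field_completion F v) A j \<eta>)" (is ?fin)
    and "card (alg_embs C (field_completion F v) A j \<eta>) = ext_degree C (field_completion F v) j" (is ?card)
    and "finite_ext C (field_completion F v) j" (is ?ext)
    and "alg_embs C (field_completion F v) A j \<eta> \<noteq> {}" (is ?ne)
    and "\<And>x. x \<in> carrier (field_completion F v) \<Longrightarrow> (ring.algebraic (field_completion F v) over (j ` carrier C)) x" (is "\<And>x. _ \<Longrightarrow> ?alg x")
proof -
  interpret F: valued_field F v by (rule F)
  interpret H: valued_field F.Rh F.vh by (rule F.completion_valued_field)
  interpret C: valued_field C vC by (rule C(1))
  interpret A: algebraically_closed A by (rule A)
  let ?k = "j ` carrier C" and ?\<sigma> = "\<eta> \<circ> inv_into (carrier C) j"
  have k: "subfield ?k F.Rh" by (rule image_subfield(1)[OF C.field_axioms H.field_axioms j(1)])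
  have inj: "inj_on j (carrier C)" by (rule image_subfield(2)[OF C.field_axioms H.field_axioms j(1)])
  have comp: "complete_subset F.Rh F.vh ?k"
    by (rule complete_image[OF C.ring_axioms H.ring_axioms j C(2)])
  have \<sigma>: "?\<sigma> \<in> ring_hom (F.Rh\<lparr>carrier := ?k\<rparr>) A"
    by (rule ring_hom_trans[OF inv_into_hom[OF C.field_axioms H.field_axioms j(1)] \<eta>])
  obtain us where us: "set us \<subseteq> carrier L" "F.emb ` carrier F \<subseteq> H.finite_extension ?k (map (\<lambda>u. F.emb (e u)) us)"
    using image_in_finite_extension[OF L(1-3) F.ring_axioms H.field_axioms e(1) F.emb_hom k e(2) gen] by blast
  define xs where "xs = map e us"
  have xs: "set xs \<subseteq> carrier F" using us(1) ring_hom_memE(1)[OF e(1)] by (auto simp: xs_def)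
  have gen': "F.emb ` carrier F \<subseteq> H.finite_extension ?k (map F.emb xs)"
    using us(2) by (simp add: xs_def comp_def)
  have ee: "(\<lambda>a. F.emb (e a)) \<in> ring_hom L F.Rh" using ring_hom_trans[OF e(1) F.emb_hom] by (simp add: comp_def)
  have simple: "root_of_simple_rooted F.Rh A ?k ?\<sigma> (F.emb x)" if x: "x \<in> set xs" for x
  proof -
    obtain u where u: "u \<in> set us" "x = e u" using x by (auto simp: xs_def)
    have uL: "u \<in> carrier L" using u us(1) by blast
    have sub: "(\<lambda>a. F.emb (e a)) ` k0 \<subseteq> ?k" using e(2) by (rule image_subsetI)
    show ?thesis
      using separable_imp_root_of_simple_rooted[OF L(1) H.field_axioms A.field_axioms L(2) uL L(4)[OF uL] ee k sub \<sigma>]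
      unfolding u(2) .
  qed
  have alg: "(H.algebraic over ?k) (F.emb x)" if x: "x \<in> set xs" for x
  proof -
    obtain p where p: "p \<in> carrier (?k[X]\<^bsub>F.Rh\<^esub>)" "p \<noteq> []" "H.eval p (F.emb x) = \<zero>\<^bsub>F.Rh\<^esub>"
      using simple[OF x] unfolding root_of_simple_rooted_def by blast
    show ?thesis by (rule H.algebraicI[OF p])
  qed
  have all: "H.finite_extension ?k (map F.emb xs) = carrier F.Rh"
    by (rule F.completion_generated[OF k comp xs alg gen'])
  have xs': "set (map F.emb xs) \<subseteq> carrier F.Rh" using xs by auto
  have simple': "root_of_simple_rooted F.Rh A ?k ?\<sigma> y" if "y \<in> set (map F.emb xs)" for y
    using that simple by auto
  note count = alg_embs_count[OF C.field_axioms H.field_axioms A j(1) \<eta> xs' simple' all]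
  show ?fin by (rule count(1))
  show ?card by (rule count(2))
  show ?ext by (rule count(3))
  have fd: "H.finite_dimension ?k (carrier F.Rh)" by (rule count(3)[unfolded finite_ext_def])
  show algk: "?alg x" if "x \<in> carrier F.Rh" for x
    by (rule H.finite_dimension_imp_algebraic[OF k H.carrier_is_subring fd that])
  have "subfield_hom F.Rh A ?k ?\<sigma>"
    using k \<sigma> H.field_axioms A.field_axioms by (simp add: subfield_hom_def subfield_hom_axioms_def)
  then obtain h where h: "h \<in> ring_hom F.Rh A" "\<forall>c \<in> ?k. h c = ?\<sigma> c"
    using algebraic_extension_hom[OF A _ algk] by blast
  have "restrict h (carrier F.Rh) \<in> alg_embs C F.Rh A j \<eta>"
    using restrict_ring_hom[OF H.ring_axioms h(1)] h(2) inj ring_hom_memE(1)[OF j(1)] by (simp add: alg_embs_def)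
  then show ?ne by blast
qed

text \<open>Finite extensions of \<open>k\<close> inside \<open>S\<close> are complete, although \<open>S\<close> itself, such as an algebraic closure, need
not be.\<close>

lemma complete_finite_extension:
  assumes S: "valued_field S w" and k: "subfield k S" "complete_subset S w k"
    and alg: "\<And>x. x \<in> carrier S \<Longrightarrow> (ring.algebraic S over k) x" and xs: "set xs \<subseteq> carrier S"
  shows "valued_field (S\<lparr>carrier := ring.finite_extension S k xs\<rparr>) w" (is ?val)
    and "complete_subset (S\<lparr>carrier := ring.finite_extension S k xs\<rparr>) w (ring.finite_extension S k xs)" (is ?comp)
proof -
  interpret S: valued_field S w by (rule S)
  let ?B = "S.finite_extension k xs"
  have alg': "(S.algebraic over k) x" if "x \<in> set xs" for x using alg that xs by blast
  have B: "subfield ?B S" by (rule S.finite_extension_is_subfield[OF k(1) xs alg'])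
  show ?val
    using S.subfield_iff(2)[OF B] absolute_value_subset[OF S.abs_v subfieldE(3)[OF B]]
    by (simp add: valued_field_def valued_field_axioms_def)
  have "S.finite_dimension k ?B"
    by (rule S.finite_extension_finite_dimension(1)[OF k(1) xs alg'])
  then obtain n where "S.dimension n k ?B" by auto
  then have comp: "complete_subset S w ?B" using S.finite_dimension_bounded[OF k] by blast
  note m = S.a_minus_subring[OF subfieldE(1)[OF B]]
  show ?comp
    unfolding complete_subset_def
  proof (intro ballI impI)
    fix x assume x: "x \<in> cauchy_seqs (S\<lparr>carrier := ?B\<rparr>) w" "range x \<subseteq> ?B"
    have xB: "x n \<in> ?B" for n using x(2) by blast
    have "x n \<in> carrier S" for n using xB subfieldE(3)[OF B] by blast
    then have "x \<in> cauchy_seqs S w"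
      using x(1) m[OF xB xB] unfolding cauchy_seqs_def by simp
    from comp[unfolded complete_subset_def, rule_format, OF this x(2)]
    obtain a where a: "a \<in> ?B" "(\<lambda>n. w (x n \<ominus>\<^bsub>S\<^esub> a)) \<longlonglongrightarrow> 0" by (rule bexE)
    then show "\<exists>a\<in>?B. (\<lambda>n. w (x n \<ominus>\<^bsub>S\<lparr>carrier := ?B\<rparr>\<^esub> a)) \<longlonglongrightarrow> 0"
      using m[OF xB a(1)] by (intro bexI[of _ a]) simp_all
  qed
qed

lemma quotient_by_partition:
  assumes ne: "\<And>x. x \<in> P \<Longrightarrow> \<Phi> x \<noteq> {}" and sub: "\<And>x. x \<in> P \<Longrightarrow> \<Phi> x \<subseteq> E"
    and cover: "\<And>b. b \<in> E \<Longrightarrow> \<exists>x \<in> P. b \<in> \<Phi> x"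
    and disj: "\<And>x y b. \<lbrakk>x \<in> P; y \<in> P; b \<in> \<Phi> x; b \<in> \<Phi> y\<rbrakk> \<Longrightarrow> x = y"
    and r: "\<And>b b'. (b, b') \<in> r \<longleftrightarrow> (\<exists>x \<in> P. b \<in> \<Phi> x \<and> b' \<in> \<Phi> x)"
  shows "equiv E r" "bij_betw \<Phi> P (E // r)" "\<And>x b. \<lbrakk>x \<in> P; b \<in> \<Phi> x\<rbrakk> \<Longrightarrow> r `` {b} = \<Phi> x"
proof -
  show cls: "r `` {b} = \<Phi> x" if "x \<in> P" "b \<in> \<Phi> x" for x b
    using that r disj by blast
  show "equiv E r"
  proof (rule equivI)
    show "r \<subseteq> E \<times> E"
    proof (rule subrelI)
      fix b b' assume "(b, b') \<in> r"
      then show "(b, b') \<in> E \<times> E" using r sub by blast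
    qed
    show "refl_on E r" using r cover by (meson refl_onI)
    show "sym r" using r by (meson symI)
    show "trans r"
    proof (rule transI)
      fix b b' b'' assume "(b, b') \<in> r" "(b', b'') \<in> r"
      then obtain x y where "x \<in> P" "b \<in> \<Phi> x" "b' \<in> \<Phi> x" "y \<in> P" "b' \<in> \<Phi> y" "b'' \<in> \<Phi> y"
        unfolding r by blast
      then show "(b, b'') \<in> r" using disj[of x y b'] unfolding r by blast
    qed
  qed
  show "bij_betw \<Phi> P (E // r)"
  proof (rule bij_betw_imageI)
    show "inj_on \<Phi> P"
    proof (rule inj_onI)
      fix x y assume xy: "x \<in> P" "y \<in> P" "\<Phi> x = \<Phi> y"
      then obtain b where "b \<in> \<Phi> x" using ne by blast
      then show "x = y" using disj xy by blast
    qed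
    show "\<Phi> ` P = E // r"
    proof (intro equalityI subsetI)
      fix Z assume "Z \<in> \<Phi> ` P"
      then obtain x where x: "x \<in> P" "Z = \<Phi> x" by blast
      then obtain b where b: "b \<in> \<Phi> x" using ne by blast
      then have "Z = r `` {b}" using cls[OF x(1) b] x(2) by simp
      then show "Z \<in> E // r" using b sub[OF x(1)] by (blast intro: quotientI)
    next
      fix Z assume "Z \<in> E // r"
      then obtain b where b: "b \<in> E" "Z = r `` {b}" by (rule quotientE)
      obtain x where x: "x \<in> P" "b \<in> \<Phi> x" using cover[OF b(1)] by blast
      then have "Z = \<Phi> x" using cls[OF x] b(2) by simp
      then show "Z \<in> \<Phi> ` P" using x(1) by blast
    qed
  qed
qed

section \<open>Absolute values on the factors and embeddings into the algebraic closure\<close>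

locale valued_tensor_decomposition = tensor_decomposition K L M f g Fs \<phi> +
    KK: valued_field K vK + LL: valued_field L vL + MM: valued_field M vM +
    A: algebraic_closure A "\<iota> ` carrier (field_completion M vM)"
  for K :: "('k, 'z) ring_scheme" and L :: "('l, 'x) ring_scheme" and M :: "('m, 'y) ring_scheme" and f g
    and Fs :: "('f, 'w) ring_scheme list" and \<phi> and vK vL vM
    and A :: "('a, 'v) ring_scheme" and \<iota> +
  assumes f_hom: "f \<in> ring_hom K L" and g_hom: "g \<in> ring_hom K M"
    and finite: "finite_ext K L f" and separable: "separable_ext K L f"
    and vL_f: "x \<in> carrier K \<Longrightarrow> vL (f x) = vK x" and vM_g: "x \<in> carrier K \<Longrightarrow> vM (g x) = vK x"
    and \<iota>_hom: "\<iota> \<in> ring_hom (field_completion M vM) A"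
begin

abbreviation "V i \<equiv> ext_abs L vL M vM (Fs ! i) (p i) (q i)"
abbreviation "KL \<equiv> completion_map K vK L vL f"
abbreviation "KM \<equiv> completion_map K vK M vM g"
abbreviation "LF i \<nu> \<equiv> completion_map L vL (Fs ! i) \<nu> (p i)"
abbreviation "MF i \<nu> \<equiv> completion_map M vM (Fs ! i) \<nu> (q i)"
abbreviation "Fh i \<nu> \<equiv> field_completion (Fs ! i) \<nu>"
abbreviation "w \<equiv> closure_abs M vM A \<iota>"
abbreviation "E \<equiv> alg_embs KK.Rh LL.Rh A KL (\<iota> \<circ> KM)"
abbreviation "D i \<nu> \<equiv> alg_embs MM.Rh (Fh i \<nu>) A (MF i \<nu>) \<iota>"
abbreviation "G \<equiv> alg_auts MM.Rh A \<iota>"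
abbreviation "pull i \<gamma> \<equiv> \<lambda>x \<in> carrier (Fs ! i). w (\<gamma> x)"

lemma Kh: "valued_field KK.Rh KK.vh" and Lh: "valued_field LL.Rh LL.vh" and Mh: "valued_field MM.Rh MM.vh"
  by (rule KK.completion_valued_field LL.completion_valued_field MM.completion_valued_field)+

lemma KL: "KL \<in> ring_hom KK.Rh LL.Rh" "\<And>U. U \<in> carrier KK.Rh \<Longrightarrow> LL.vh (KL U) = KK.vh U"
    "\<And>a. a \<in> carrier K \<Longrightarrow> KL (KK.emb a) = LL.emb (f a)"
  by (rule completion_map_isometry[OF KK.valued_field_axioms LL.valued_field_axioms f_hom vL_f]; assumption)+

lemma KM: "KM \<in> ring_hom KK.Rh MM.Rh" "\<And>U. U \<in> carrier KK.Rh \<Longrightarrow> MM.vh (KM U) = KK.vh U"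
    "\<And>a. a \<in> carrier K \<Longrightarrow> KM (KK.emb a) = MM.emb (g a)"
  by (rule completion_map_isometry[OF KK.valued_field_axioms MM.valued_field_axioms g_hom vM_g]; assumption)+

lemmas w = closure_abs[OF MM.valued_field_axioms \<iota>_hom A.algebraic_closure_axioms]

lemma A_valued: "valued_field A w"
  using w(1) A.field_axioms by (simp add: valued_field_def valued_field_axioms_def)

lemma base_subfield: "subfield (f ` carrier K) L"
  by (rule image_subfield(1)[OF KK.field_axioms LL.field_axioms f_hom])

lemma \<iota>KM_hom: "\<iota> \<circ> KM \<in> ring_hom KK.Rh A"
  by (rule ring_hom_trans[OF KM(1) \<iota>_hom])

lemma \<iota>_emb_hom: "(\<lambda>b. \<iota> (MM.emb b)) \<in> ring_hom M A"
  using ring_hom_trans[OF MM.emb_hom \<iota>_hom] by (simp add: comp_def)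

lemma L_finite_separable: "ring.finite_dimension L (f ` carrier K) (carrier L)"
  "\<And>x. x \<in> carrier L \<Longrightarrow> ring.separable_element L (f ` carrier K) x"
  using finite separable unfolding finite_ext_def separable_ext_def by blast+

lemma Lh_embeddings:
  shows "finite E" and "card E = ext_degree KK.Rh LL.Rh KL" and "finite_ext KK.Rh LL.Rh KL"
    and "\<And>x. x \<in> carrier LL.Rh \<Longrightarrow> (ring.algebraic LL.Rh over (KL ` carrier KK.Rh)) x"
proof -
  have e: "id \<in> ring_hom L L" by (rule ring_hom_memI) auto
  have ek: "LL.emb (id c) \<in> KL ` carrier KK.Rh" if c: "c \<in> f ` carrier K" for c
  proof -
    obtain x where "x \<in> carrier K" "c = f x" using c by blast
    then show ?thesis using KL(3)[of x] by (intro image_eqI[of _ _ "KK.emb x"]) simp_all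
  qed
  have gen: "carrier L \<subseteq> W" if "id ` carrier L \<subseteq> W" for W using that by simp
  note * = completion_embeddings[OF LL.valued_field_axioms Kh KK.completion_complete KL(1,2)
      LL.field_axioms base_subfield L_finite_separable e ek gen A.algebraically_closed_axioms \<iota>KM_hom]
  show "finite E" by (rule *(1); assumption)
  show "card E = ext_degree KK.Rh LL.Rh KL" by (rule *(2); assumption)
  show "finite_ext KK.Rh LL.Rh KL" by (rule *(3); assumption)
  show "(ring.algebraic LL.Rh over (KL ` carrier KK.Rh)) x" if "x \<in> carrier LL.Rh" for x by (rule *(5); (assumption | rule that))
qed

lemma E_memD:
  assumes "\<beta> \<in> E"
  shows "\<beta> \<in> extensional (carrier LL.Rh)" "\<beta> \<in> ring_hom LL.Rh A" "\<And>x. x \<in> carrier KK.Rh \<Longrightarrow> \<beta> (KL x) = \<iota> (KM x)"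
  using assms by (auto simp: alg_embs_def)

text \<open>The elements of \<open>E\<close> are only known to be homomorphisms of algebras; they respect absolute values because \<open>Lh\<close> is
algebraic over the complete field \<open>Kh\<close>.\<close>

lemma E_isometric:
  assumes \<beta>: "\<beta> \<in> E" and U: "U \<in> carrier LL.Rh"
  shows "w (\<beta> U) = LL.vh U"
proof (rule algebraic_isometry[OF Lh A_valued _ _ Lh_embeddings(4) E_memD(2)[OF \<beta>] _ U])
  interpret Kh: valued_field KK.Rh KK.vh by (rule Kh)
  interpret Lh: valued_field LL.Rh LL.vh by (rule Lh)
  show "subfield (KL ` carrier KK.Rh) LL.Rh"
    by (rule image_subfield(1)[OF Kh.field_axioms Lh.field_axioms KL(1)])
  show "complete_subset LL.Rh LL.vh (KL ` carrier KK.Rh)"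
    by (rule complete_image[OF Kh.ring_axioms Lh.ring_axioms KL(1,2) KK.completion_complete])
  fix c assume "c \<in> KL ` carrier KK.Rh"
  then obtain x where x: "x \<in> carrier KK.Rh" "c = KL x" by blast
  show "w (\<beta> c) = LL.vh c"
    unfolding x(2) E_memD(3)[OF \<beta> x(1)] w(2)[OF ring_hom_memE(1)[OF KM(1) x(1)]] KM(2)[OF x(1)] KL(2)[OF x(1)] ..
qed

lemma E_emb_hom: "\<beta> \<in> E \<Longrightarrow> (\<lambda>a. \<beta> (LL.emb a)) \<in> ring_hom L A"
  using ring_hom_trans[OF LL.emb_hom E_memD(2)] by (simp add: comp_def)

lemma E_balanced: "\<lbrakk>\<beta> \<in> E; c \<in> carrier K\<rbrakk> \<Longrightarrow> \<beta> (LL.emb (f c)) = \<iota> (MM.emb (g c))"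
  using E_memD(3)[of \<beta> "KK.emb c"] KL(3)[of c] KM(3)[of c] by simp

text \<open>The condition on the map \<open>\<gamma>\<close> in the canonical correspondence, with the tensor product eliminated.\<close>

definition factors :: "((nat \<Rightarrow> 'l) set \<Rightarrow> 'a) \<Rightarrow> nat \<Rightarrow> ('f \<Rightarrow> 'a) \<Rightarrow> bool"
  where "factors \<beta> i \<gamma> \<longleftrightarrow> \<gamma> \<in> ring_hom (Fs ! i) A \<and> (\<forall>a \<in> carrier L. \<gamma> (p i a) = \<beta> (LL.emb a)) \<and>
    (\<forall>b \<in> carrier M. \<gamma> (q i b) = \<iota> (MM.emb b))"

lemma corresponds_iff_factors:
  assumes "\<beta> \<in> E" "i < length Fs"
  shows "corresponds K L M f g vL vM Fs \<phi> A \<iota> \<beta> i \<nu> \<longleftrightarrow> (\<exists>\<gamma>. factors \<beta> i \<gamma> \<and> \<nu> = pull i \<gamma>)"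
proof -
  have "corresponds K L M f g vL vM Fs \<phi> A \<iota> \<beta> i \<nu> \<longleftrightarrow>
    (\<exists>\<gamma> \<in> ring_hom (Fs ! i) A. (\<forall>a \<in> carrier L. \<gamma> (p i a) = \<beta> (LL.emb a)) \<and>
      (\<forall>b \<in> carrier M. \<gamma> (q i b) = \<iota> (MM.emb b)) \<and> \<nu> = pull i \<gamma>)"
    by (rule corresponds_iff[OF A.cring_axioms assms(2) E_emb_hom[OF assms(1)] \<iota>_emb_hom E_balanced[OF assms(1)]])
  then show ?thesis unfolding factors_def by blast
qed

lemma factors_exists: "\<beta> \<in> E \<Longrightarrow> \<exists>i < length Fs. \<exists>\<gamma>. factors \<beta> i \<gamma>"
  using factors_through_some[OF A.domain_axioms E_emb_hom[of \<beta>] \<iota>_emb_hom E_balanced[of \<beta>]]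
  unfolding factors_def by blast

lemma factors_unique:
  assumes ij: "i < length Fs" "j < length Fs" and \<gamma>: "factors \<beta> i \<gamma>" "factors \<beta> j \<gamma>'"
  shows "i = j" "x \<in> carrier (Fs ! i) \<Longrightarrow> \<gamma> x = \<gamma>' x"
proof -
  note \<gamma>' = \<gamma>[unfolded factors_def]
  show ij': "i = j"
    by (rule factors_through_unique[OF A.domain_axioms ij, of \<gamma> \<gamma>']) (use \<gamma>' in simp_all)
  show "\<gamma> x = \<gamma>' x" if "x \<in> carrier (Fs ! i)"
    by (rule factor_hom_eq[OF ij(1) A.ring_axioms _ _ _ _ that]) (use \<gamma>' ij' in simp_all)
qed

lemma pull_in_V:
  assumes \<beta>: "\<beta> \<in> E" and i: "i < length Fs" and \<gamma>: "factors \<beta> i \<gamma>"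
  shows "pull i \<gamma> \<in> V i"
proof -
  note \<gamma>' = \<gamma>[unfolded factors_def]
  have \<gamma>h: "\<gamma> \<in> ring_hom (Fs ! i) A" using \<gamma>' by blast
  interpret F: field "Fs ! i" by (rule factor_field[OF i])
  have "absolute_value (Fs ! i) (\<lambda>x. w (\<gamma> x))"
    by (rule absolute_value_pullback[OF F.field_axioms A.field_axioms \<gamma>h w(1)])
  then have 1: "absolute_value (Fs ! i) (pull i \<gamma>)" unfolding absolute_value_def by simp
  have 2: "pull i \<gamma> (p i a) = vL a" if a: "a \<in> carrier L" for a
    using ring_hom_memE(1)[OF p_hom[OF i] a] \<gamma>' a E_isometric[OF \<beta> LL.emb_closed[OF a]] by simp
  have 3: "pull i \<gamma> (q i b) = vM b" if b: "b \<in> carrier M" for b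
    using ring_hom_memE(1)[OF q_hom[OF i] b] \<gamma>' b w(2)[OF MM.emb_closed[OF b]] by simp
  show ?thesis unfolding ext_abs_def using 1 2 3 restrict_extensional by blast
qed

context
  fixes i \<nu> assumes i: "i < length Fs" and \<nu>: "\<nu> \<in> V i"
begin

lemma V_memD: "absolute_value (Fs ! i) \<nu>" "\<nu> \<in> extensional (carrier (Fs ! i))"
  "\<And>a. a \<in> carrier L \<Longrightarrow> \<nu> (p i a) = vL a" "\<And>b. b \<in> carrier M \<Longrightarrow> \<nu> (q i b) = vM b"
  using \<nu> unfolding ext_abs_def by blast+

lemma F_valued: "valued_field (Fs ! i) \<nu>"
  using factor_field[OF i] V_memD(1) by (simp add: valued_field_def valued_field_axioms_def)

lemma Fh_valued: "valued_field (Fh i \<nu>) (completion_abs (Fs ! i) \<nu>)"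
  by (rule valued_field.completion_valued_field[OF F_valued])

lemma LF: "LF i \<nu> \<in> ring_hom LL.Rh (Fh i \<nu>)"
    "\<And>U. U \<in> carrier LL.Rh \<Longrightarrow> completion_abs (Fs ! i) \<nu> (LF i \<nu> U) = LL.vh U"
    "\<And>a. a \<in> carrier L \<Longrightarrow> LF i \<nu> (LL.emb a) = completion_embed (Fs ! i) \<nu> (p i a)"
  by (rule completion_map_isometry[OF LL.valued_field_axioms F_valued p_hom[OF i] V_memD(3)]; assumption)+

lemma MF: "MF i \<nu> \<in> ring_hom MM.Rh (Fh i \<nu>)"
    "\<And>U. U \<in> carrier MM.Rh \<Longrightarrow> completion_abs (Fs ! i) \<nu> (MF i \<nu> U) = MM.vh U"
    "\<And>b. b \<in> carrier M \<Longrightarrow> MF i \<nu> (MM.emb b) = completion_embed (Fs ! i) \<nu> (q i b)"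
  by (rule completion_map_isometry[OF MM.valued_field_axioms F_valued q_hom[OF i] V_memD(4)]; assumption)+

text \<open>The square of completions over \<open>K \<rightarrow> L \<rightarrow> F\<^sub>i\<close> and \<open>K \<rightarrow> M \<rightarrow> F\<^sub>i\<close> commutes, since it does so on the dense subfield \<open>K\<close>.\<close>

lemma LF_KL:
  assumes U: "U \<in> carrier KK.Rh"
  shows "LF i \<nu> (KL U) = MF i \<nu> (KM U)"
proof -
  have "(LF i \<nu> \<circ> KL) U = (MF i \<nu> \<circ> KM) U"
  proof (rule KK.isometry_unique[OF Fh_valued ring_hom_trans[OF KL(1) LF(1)] ring_hom_trans[OF KM(1) MF(1)] _ _ _ U])
    show "completion_abs (Fs ! i) \<nu> ((LF i \<nu> \<circ> KL) U) = KK.vh U" if "U \<in> carrier KK.Rh" for U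
      using LF(2)[OF ring_hom_memE(1)[OF KL(1) that]] KL(2)[OF that] by simp
    show "completion_abs (Fs ! i) \<nu> ((MF i \<nu> \<circ> KM) U) = KK.vh U" if "U \<in> carrier KK.Rh" for U
      using MF(2)[OF ring_hom_memE(1)[OF KM(1) that]] KM(2)[OF that] by simp
    show "(LF i \<nu> \<circ> KL) (KK.emb a) = (MF i \<nu> \<circ> KM) (KK.emb a)" if "a \<in> carrier K" for a
      using KL(3)[OF that] KM(3)[OF that] LF(3)[OF f_closed[OF that]] MF(3)[OF g_closed[OF that]] p_f_eq_q_g[OF that]
      by simp
  qed
  then show ?thesis by simp
qed

lemma Fh_embeddings:
  shows "finite (D i \<nu>)" and "card (D i \<nu>) = ext_degree MM.Rh (Fh i \<nu>) (MF i \<nu>)"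
    and "finite_ext MM.Rh (Fh i \<nu>) (MF i \<nu>)" and "D i \<nu> \<noteq> {}"
    and "\<And>x. x \<in> carrier (Fh i \<nu>) \<Longrightarrow> (ring.algebraic (Fh i \<nu>) over (MF i \<nu> ` carrier MM.Rh)) x"
proof -
  have q_mem: "completion_embed (Fs ! i) \<nu> (q i b) \<in> MF i \<nu> ` carrier MM.Rh" if "b \<in> carrier M" for b
    using MF(3)[OF that] by (intro image_eqI[of _ _ "MM.emb b"]) (simp_all add: that)
  have ek: "completion_embed (Fs ! i) \<nu> (p i c) \<in> MF i \<nu> ` carrier MM.Rh" if c: "c \<in> f ` carrier K" for c
  proof -
    obtain x where x: "x \<in> carrier K" "c = f x" using c by blast
    show ?thesis using q_mem[OF g_closed[OF x(1)]] unfolding x(2) p_f_eq_q_g[OF x(1)] .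
  qed
  have gen: "carrier (Fs ! i) \<subseteq> W" if W: "subring W (Fs ! i)" "p i ` carrier L \<subseteq> W"
    "{x \<in> carrier (Fs ! i). completion_embed (Fs ! i) \<nu> x \<in> MF i \<nu> ` carrier MM.Rh} \<subseteq> W" for W
  proof (rule factor_generated[OF i W(1,2)])
    show "q i ` carrier M \<subseteq> W"
    proof (rule image_subsetI)
      fix b assume "b \<in> carrier M"
      then show "q i b \<in> W" using W(3) q_mem[of b] ring_hom_memE(1)[OF q_hom[OF i], of b] by blast
    qed
  qed
  note * = completion_embeddings[OF F_valued Mh MM.completion_complete MF(1,2)
      LL.field_axioms base_subfield L_finite_separable p_hom[OF i] ek gen A.algebraically_closed_axioms \<iota>_hom]
  show "finite (D i \<nu>)" by (rule *(1); assumption)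
  show "card (D i \<nu>) = ext_degree MM.Rh (Fh i \<nu>) (MF i \<nu>)" by (rule *(2); assumption)
  show "finite_ext MM.Rh (Fh i \<nu>) (MF i \<nu>)" by (rule *(3); assumption)
  show "D i \<nu> \<noteq> {}" by (rule *(4); assumption)
  show "(ring.algebraic (Fh i \<nu>) over (MF i \<nu> ` carrier MM.Rh)) x" if "x \<in> carrier (Fh i \<nu>)" for x
    by (rule *(5); (assumption | rule that))
qed

lemma D_memD:
  assumes "\<delta> \<in> D i \<nu>"
  shows "\<delta> \<in> extensional (carrier (Fh i \<nu>))" "\<delta> \<in> ring_hom (Fh i \<nu>) A" "\<And>x. x \<in> carrier MM.Rh \<Longrightarrow> \<delta> (MF i \<nu> x) = \<iota> x"
  using assms by (auto simp: alg_embs_def)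

lemma D_isometric:
  assumes \<delta>: "\<delta> \<in> D i \<nu>" and U: "U \<in> carrier (Fh i \<nu>)"
  shows "w (\<delta> U) = completion_abs (Fs ! i) \<nu> U"
proof (rule algebraic_isometry[OF Fh_valued A_valued _ _ Fh_embeddings(5) D_memD(2)[OF \<delta>] _ U])
  interpret Mh: valued_field MM.Rh MM.vh by (rule Mh)
  interpret Fh: valued_field "Fh i \<nu>" "completion_abs (Fs ! i) \<nu>" by (rule Fh_valued)
  show "subfield (MF i \<nu> ` carrier MM.Rh) (Fh i \<nu>)"
    by (rule image_subfield(1)[OF Mh.field_axioms Fh.field_axioms MF(1)])
  show "complete_subset (Fh i \<nu>) (completion_abs (Fs ! i) \<nu>) (MF i \<nu> ` carrier MM.Rh)"
    by (rule complete_image[OF Mh.ring_axioms Fh.ring_axioms MF(1,2) MM.completion_complete])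
  fix c assume "c \<in> MF i \<nu> ` carrier MM.Rh"
  then obtain x where x: "x \<in> carrier MM.Rh" "c = MF i \<nu> x" by blast
  show "w (\<delta> c) = completion_abs (Fs ! i) \<nu> c"
    unfolding x(2) D_memD(3)[OF \<delta> x(1)] w(2)[OF x(1)] MF(2)[OF x(1)] ..
qed

text \<open>This will be a bijection from \<open>D i \<nu>\<close> onto the
fibre of the correspondence over \<open>(i, \<nu>)\<close>.\<close>

definition "rest \<delta> = restrict (\<delta> \<circ> LF i \<nu>) (carrier LL.Rh)"

lemma rest_E:
  assumes \<delta>: "\<delta> \<in> D i \<nu>"
  shows "rest \<delta> \<in> E"
proof -
  interpret Lh: valued_field LL.Rh LL.vh by (rule Lh)
  have "rest \<delta> \<in> ring_hom LL.Rh A"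
    unfolding rest_def by (rule restrict_ring_hom[OF Lh.ring_axioms ring_hom_trans[OF LF(1) D_memD(2)[OF \<delta>]]])
  moreover have "rest \<delta> (KL x) = (\<iota> \<circ> KM) x" if "x \<in> carrier KK.Rh" for x
    using ring_hom_memE(1)[OF KL(1) that] LF_KL[OF that] D_memD(3)[OF \<delta> ring_hom_memE(1)[OF KM(1) that]]
    by (simp add: rest_def)
  ultimately show ?thesis unfolding alg_embs_def rest_def using restrict_extensional by blast
qed

lemma rest_factors:
  assumes \<delta>: "\<delta> \<in> D i \<nu>"
  shows "factors (rest \<delta>) i (\<delta> \<circ> completion_embed (Fs ! i) \<nu>)" "pull i (\<delta> \<circ> completion_embed (Fs ! i) \<nu>) = \<nu>"
proof -
  interpret F: valued_field "Fs ! i" \<nu> by (rule F_valued)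
  have "(\<delta> \<circ> F.emb) (p i a) = rest \<delta> (LL.emb a)" if "a \<in> carrier L" for a
    using LF(3)[OF that] LL.emb_closed[OF that] by (simp add: rest_def)
  moreover have "(\<delta> \<circ> F.emb) (q i b) = \<iota> (MM.emb b)" if "b \<in> carrier M" for b
    using D_memD(3)[OF \<delta> MM.emb_closed[OF that]] MF(3)[OF that] by simp
  ultimately show "factors (rest \<delta>) i (\<delta> \<circ> F.emb)"
    unfolding factors_def using ring_hom_trans[OF F.emb_hom D_memD(2)[OF \<delta>]] by blast
  show "pull i (\<delta> \<circ> F.emb) = \<nu>"
  proof (rule extensionalityI[OF restrict_extensional V_memD(2)])
    fix x assume x: "x \<in> carrier (Fs ! i)"
    show "pull i (\<delta> \<circ> F.emb) x = \<nu> x"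
      using D_isometric[OF \<delta> F.emb_closed[OF x]] F.vh_emb[OF x] x by simp
  qed
qed

text \<open>The factor \<open>F\<^sub>i\<close> is generated by \<open>L\<close> and \<open>M\<close>, and it is dense in its completion.\<close>

lemma rest_inj: "inj_on rest (D i \<nu>)"
proof (rule inj_onI)
  interpret F: valued_field "Fs ! i" \<nu> by (rule F_valued)
  fix \<delta> \<delta>' assume \<delta>: "\<delta> \<in> D i \<nu>" "\<delta>' \<in> D i \<nu>" and eq: "rest \<delta> = rest \<delta>'"
  note f' = rest_factors(1)[OF \<delta>(2), folded eq]
  show "\<delta> = \<delta>'"
  proof (rule extensionalityI[OF D_memD(1)[OF \<delta>(1)] D_memD(1)[OF \<delta>(2)]])
    fix U assume U: "U \<in> carrier (Fh i \<nu>)"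
    show "\<delta> U = \<delta>' U"
    proof (rule F.isometry_unique[OF A_valued D_memD(2)[OF \<delta>(1)] D_memD(2)[OF \<delta>(2)] _ _ _ U])
      show "\<delta> (F.emb a) = \<delta>' (F.emb a)" if "a \<in> carrier (Fs ! i)" for a
        using factors_unique(2)[OF i i rest_factors(1)[OF \<delta>(1)] f' that] by simp
    qed (use D_isometric \<delta> in blast)+
  qed
qed

text \<open>With the absolute value \<open>\<nu> = w \<circ> \<gamma>\<close> on \<open>F\<^sub>i\<close>, the map \<open>\<gamma>\<close> is an isometry. Its image lies in a finite extension of
\<open>\<iota>(Mh)\<close>, which is complete even though \<open>A\<close> may not be, so \<open>\<gamma>\<close> extends to the completion of \<open>F\<^sub>i\<close>.\<close>

lemma rest_surj:
  assumes \<beta>: "\<beta> \<in> E" and \<gamma>: "factors \<beta> i \<gamma>" and \<nu>\<gamma>: "\<nu> = pull i \<gamma>"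
  obtains \<delta> where "\<delta> \<in> D i \<nu>" "rest \<delta> = \<beta>"
proof -
  interpret F: valued_field "Fs ! i" \<nu> by (rule F_valued)
  interpret H: valued_field F.Rh F.vh by (rule F.completion_valued_field)
  interpret W: valued_field A w by (rule A_valued)
  let ?k = "\<iota> ` carrier MM.Rh"
  note \<gamma>' = \<gamma>[unfolded factors_def]
  have \<gamma>h: "\<gamma> \<in> ring_hom (Fs ! i) A" using \<gamma>' by blast
  have k: "subfield ?k A" by (rule A.subfield_axioms)
  have p_k: "\<gamma> (p i c) \<in> ?k" if c: "c \<in> f ` carrier K" for c
  proof -
    obtain x where x: "x \<in> carrier K" "c = f x" using c by blast
    have "\<gamma> (p i c) = \<iota> (MM.emb (g x))"
      using \<gamma>' f_closed[OF x(1)] E_balanced[OF \<beta> x(1)] x(2) by simp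
    then show ?thesis using MM.emb_closed[OF g_closed[OF x(1)]] by simp
  qed
  have gen: "carrier (Fs ! i) \<subseteq> W" if W: "subring W (Fs ! i)" "p i ` carrier L \<subseteq> W"
    "{x \<in> carrier (Fs ! i). \<gamma> x \<in> ?k} \<subseteq> W" for W
  proof (rule factor_generated[OF i W(1,2)])
    show "q i ` carrier M \<subseteq> W"
    proof
      fix y assume "y \<in> q i ` carrier M"
      then obtain b where b: "b \<in> carrier M" "y = q i b" by blast
      have "\<gamma> y \<in> ?k" using \<gamma>' b MM.emb_closed[OF b(1)] by simp
      then show "y \<in> W" using W(3) ring_hom_memE(1)[OF q_hom[OF i] b(1)] b(2) by blast
    qed
  qed
  obtain us where us: "set us \<subseteq> carrier L" "\<gamma> ` carrier (Fs ! i) \<subseteq> A.finite_extension ?k (map (\<lambda>u. \<gamma> (p i u)) us)"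
    using image_in_finite_extension[OF LL.field_axioms base_subfield L_finite_separable(1) F.ring_axioms A.field_axioms
        p_hom[OF i] \<gamma>h k p_k gen] by blast
  let ?B = "A.finite_extension ?k (map (\<lambda>u. \<gamma> (p i u)) us)"
  have xs: "set (map (\<lambda>u. \<gamma> (p i u)) us) \<subseteq> carrier A"
    using us(1) ring_hom_memE(1)[OF p_hom[OF i]] ring_hom_memE(1)[OF \<gamma>h] by auto
  note B = complete_finite_extension[OF A_valued k w(4) A.algebraic_extension xs]
  have Bc: "?B \<subseteq> carrier A"
    by (rule A.finite_extension_in_carrier[OF subfieldE(3)[OF k] xs])
  have \<gamma>B: "\<gamma> \<in> ring_hom (Fs ! i) (A\<lparr>carrier := ?B\<rparr>)"
    using \<gamma>h us(2) by (auto simp: ring_hom_def)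
  have \<gamma>\<nu>: "w (\<gamma> x) = \<nu> x" if "x \<in> carrier (Fs ! i)" for x using that \<nu>\<gamma> by simp
  obtain h where h: "h \<in> ring_hom F.Rh (A\<lparr>carrier := ?B\<rparr>)" "\<And>U. U \<in> carrier F.Rh \<Longrightarrow> w (h U) = F.vh U"
      "\<And>a. a \<in> carrier (Fs ! i) \<Longrightarrow> h (F.emb a) = \<gamma> a"
    using F.isometry_extend[OF B(1) _ \<gamma>B \<gamma>\<nu>] B(2) by auto
  have hA: "h \<in> ring_hom F.Rh A" using h(1) Bc by (auto simp: ring_hom_def)
  have hMF: "h (MF i \<nu> U) = \<iota> U" if U: "U \<in> carrier MM.Rh" for U
  proof -
    have "(h \<circ> MF i \<nu>) U = \<iota> U"
    proof (rule MM.isometry_unique[OF A_valued ring_hom_trans[OF MF(1) hA] \<iota>_hom _ w(2) _ U])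
      show "w ((h \<circ> MF i \<nu>) U) = MM.vh U" if "U \<in> carrier MM.Rh" for U
        using h(2)[OF ring_hom_memE(1)[OF MF(1) that]] MF(2)[OF that] by simp
      show "(h \<circ> MF i \<nu>) (MM.emb b) = \<iota> (MM.emb b)" if "b \<in> carrier M" for b
        using MF(3)[OF that] h(3)[OF ring_hom_memE(1)[OF q_hom[OF i] that]] \<gamma>' that by simp
    qed
    then show ?thesis by simp
  qed
  have hLF: "h (LF i \<nu> U) = \<beta> U" if U: "U \<in> carrier LL.Rh" for U
  proof -
    have "(h \<circ> LF i \<nu>) U = \<beta> U"
    proof (rule LL.isometry_unique[OF A_valued ring_hom_trans[OF LF(1) hA] E_memD(2)[OF \<beta>] _ E_isometric[OF \<beta>] _ U])
      show "w ((h \<circ> LF i \<nu>) U) = LL.vh U" if "U \<in> carrier LL.Rh" for U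
        using h(2)[OF ring_hom_memE(1)[OF LF(1) that]] LF(2)[OF that] by simp
      show "(h \<circ> LF i \<nu>) (LL.emb a) = \<beta> (LL.emb a)" if "a \<in> carrier L" for a
        using LF(3)[OF that] h(3)[OF ring_hom_memE(1)[OF p_hom[OF i] that]] \<gamma>' that by simp
    qed
    then show ?thesis by simp
  qed
  show thesis
  proof (rule that)
    have "restrict h (carrier F.Rh) (MF i \<nu> x) = \<iota> x" if "x \<in> carrier MM.Rh" for x
      using hMF[OF that] ring_hom_memE(1)[OF MF(1) that] by simp
    then show "restrict h (carrier F.Rh) \<in> D i \<nu>"
      unfolding alg_embs_def using restrict_ring_hom[OF H.ring_axioms hA] restrict_extensional by blast
    show "rest (restrict h (carrier F.Rh)) = \<beta>"
      unfolding rest_def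
    proof (rule extensionalityI[OF restrict_extensional E_memD(1)[OF \<beta>]])
      fix U assume U: "U \<in> carrier LL.Rh"
      show "restrict (restrict h (carrier F.Rh) \<circ> LF i \<nu>) (carrier LL.Rh) U = \<beta> U"
        using hLF[OF U] ring_hom_memE(1)[OF LF(1) U] U by simp
    qed
  qed
qed

end

subsection \<open>The fibres of the correspondence\<close>

definition fibre :: "nat \<times> ('f \<Rightarrow> real) \<Rightarrow> ((nat \<Rightarrow> 'l) set \<Rightarrow> 'a) set"
  where "fibre x = {\<beta> \<in> E. corresponds K L M f g vL vM Fs \<phi> A \<iota> \<beta> (fst x) (snd x)}"

abbreviation "P \<equiv> SIGMA i:{..<length Fs}. V i"

lemma fibre_iff: "i < length Fs \<Longrightarrow> \<beta> \<in> fibre (i, \<nu>) \<longleftrightarrow> \<beta> \<in> E \<and> (\<exists>\<gamma>. factors \<beta> i \<gamma> \<and> \<nu> = pull i \<gamma>)"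
  using corresponds_iff_factors[of \<beta> i \<nu>] by (auto simp: fibre_def)

lemma fibre_imp_V: "\<lbrakk>i < length Fs; \<beta> \<in> fibre (i, \<nu>)\<rbrakk> \<Longrightarrow> \<nu> \<in> V i"
  unfolding fibre_iff using pull_in_V by blast

lemma fibre_embeddings:
  assumes i: "i < length Fs" and \<nu>: "\<nu> \<in> V i"
  shows "bij_betw (rest i \<nu>) (D i \<nu>) (fibre (i, \<nu>))"
proof (rule bij_betw_imageI[OF rest_inj[OF i \<nu>]])
  show "rest i \<nu> ` D i \<nu> = fibre (i, \<nu>)"
  proof (intro equalityI subsetI)
    fix \<beta> assume "\<beta> \<in> rest i \<nu> ` D i \<nu>"
    then obtain \<delta> where \<delta>: "\<delta> \<in> D i \<nu>" "\<beta> = rest i \<nu> \<delta>" by blast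
    show "\<beta> \<in> fibre (i, \<nu>)"
      unfolding fibre_iff[OF i] \<delta>(2)
      using rest_E[OF i \<nu> \<delta>(1)] rest_factors(1)[OF i \<nu> \<delta>(1)] rest_factors(2)[OF i \<nu> \<delta>(1), symmetric] by blast
  next
    fix \<beta> assume "\<beta> \<in> fibre (i, \<nu>)"
    then obtain \<gamma> where \<gamma>: "\<beta> \<in> E" "factors \<beta> i \<gamma>" "\<nu> = pull i \<gamma>" unfolding fibre_iff[OF i] by blast
    from rest_surj[OF i \<nu> \<gamma>] show "\<beta> \<in> rest i \<nu> ` D i \<nu>" by blast
  qed
qed

lemma card_fibre: "\<lbrakk>i < length Fs; \<nu> \<in> V i\<rbrakk> \<Longrightarrow> card (fibre (i, \<nu>)) = ext_degree MM.Rh (Fh i \<nu>) (MF i \<nu>)"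
  using bij_betw_same_card[OF fibre_embeddings] Fh_embeddings(2) by metis

lemma fibre_ne: "\<lbrakk>i < length Fs; \<nu> \<in> V i\<rbrakk> \<Longrightarrow> fibre (i, \<nu>) \<noteq> {}"
  using bij_betw_imp_surj_on[OF fibre_embeddings] Fh_embeddings(4) by blast

lemma fibre_cover:
  assumes \<beta>: "\<beta> \<in> E" shows "\<exists>x \<in> P. \<beta> \<in> fibre x"
proof -
  obtain i \<gamma> where \<gamma>: "i < length Fs" "factors \<beta> i \<gamma>" using factors_exists[OF \<beta>] by blast
  have "pull i \<gamma> \<in> V i" by (rule pull_in_V[OF \<beta> \<gamma>])
  moreover have "\<beta> \<in> fibre (i, pull i \<gamma>)" unfolding fibre_iff[OF \<gamma>(1)] using \<beta> \<gamma>(2) by blast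
  ultimately show ?thesis using \<gamma>(1) by blast
qed

lemma fibre_disjoint:
  assumes "x \<in> P" "y \<in> P" "\<beta> \<in> fibre x" "\<beta> \<in> fibre y" shows "x = y"
proof -
  obtain i \<nu> j \<nu>' where xy: "x = (i, \<nu>)" "y = (j, \<nu>')" "i < length Fs" "j < length Fs" using assms(1,2) by blast
  obtain \<gamma> \<gamma>' where \<gamma>: "factors \<beta> i \<gamma>" "\<nu> = pull i \<gamma>" "factors \<beta> j \<gamma>'" "\<nu>' = pull j \<gamma>'"
    using assms(3,4) xy by (auto simp: fibre_iff)
  have ij: "i = j" by (rule factors_unique(1)[OF xy(3,4) \<gamma>(1,3)])
  have "pull i \<gamma> = pull i \<gamma>'"
    using factors_unique(2)[OF xy(3,4) \<gamma>(1,3)] by (intro restrict_ext) simp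
  then show ?thesis using ij \<gamma>(2,4) xy(1,2) by simp
qed

text \<open>Both embeddings come from embeddings \<open>\<delta>\<close>, \<open>\<delta>'\<close> of the completed factor. The isomorphism \<open>\<delta>' \<circ> \<delta>\<^sup>-\<^sup>1\<close> between their images is the
identity on \<open>\<iota>(Mh)\<close>, and it extends to an automorphism of the algebraic closure.\<close>

lemma fibre_conjugate:
  assumes i: "i < length Fs" and \<nu>: "\<nu> \<in> V i" and \<beta>: "\<beta> \<in> fibre (i, \<nu>)" "\<beta>' \<in> fibre (i, \<nu>)"
  shows "\<exists>\<sigma> \<in> G. \<forall>y \<in> carrier LL.Rh. \<beta>' y = \<sigma> (\<beta> y)"
proof -
  interpret Fh: valued_field "Fh i \<nu>" "completion_abs (Fs ! i) \<nu>" by (rule Fh_valued[OF i \<nu>])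
  have "\<beta> \<in> rest i \<nu> ` D i \<nu>" "\<beta>' \<in> rest i \<nu> ` D i \<nu>"
    using \<beta> bij_betw_imp_surj_on[OF fibre_embeddings[OF i \<nu>]] by simp_all
  then obtain \<delta> \<delta>' where \<delta>: "\<delta> \<in> D i \<nu>" "\<beta> = rest i \<nu> \<delta>" and \<delta>': "\<delta>' \<in> D i \<nu>" "\<beta>' = rest i \<nu> \<delta>'" by blast
  have \<delta>h: "\<delta> \<in> ring_hom (Fh i \<nu>) A" "\<delta>' \<in> ring_hom (Fh i \<nu>) A"
    by (rule D_memD(2)[OF i \<nu> \<delta>(1)] D_memD(2)[OF i \<nu> \<delta>'(1)])+
  let ?B = "\<delta> ` carrier (Fh i \<nu>)" and ?\<tau> = "\<delta>' \<circ> inv_into (carrier (Fh i \<nu>)) \<delta>"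
  have inj: "inj_on \<delta> (carrier (Fh i \<nu>))" and B: "subfield ?B A"
    by (rule image_subfield[OF Fh.field_axioms A.field_axioms \<delta>h(1)])+
  have \<tau>: "?\<tau> (\<delta> x) = \<delta>' x" if "x \<in> carrier (Fh i \<nu>)" for x using that inj by simp
  have "?\<tau> \<in> ring_hom (A\<lparr>carrier := ?B\<rparr>) A"
    by (rule ring_hom_trans[OF inv_into_hom[OF Fh.field_axioms A.field_axioms \<delta>h(1)] \<delta>h(2)])
  then have sh: "subfield_hom A A ?B ?\<tau>"
    using B A.field_axioms by (simp add: subfield_hom_def subfield_hom_axioms_def)
  have \<iota>: "\<iota> x \<in> ?B" "?\<tau> (\<iota> x) = \<iota> x" if x: "x \<in> carrier MM.Rh" for x
  proof -
    have m: "MF i \<nu> x \<in> carrier (Fh i \<nu>)" by (rule ring_hom_memE(1)[OF MF(1)[OF i \<nu>] x])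
    have e: "\<iota> x = \<delta> (MF i \<nu> x)" using D_memD(3)[OF i \<nu> \<delta>(1) x] by simp
    show "\<iota> x \<in> ?B" unfolding e by (rule imageI[OF m])
    show "?\<tau> (\<iota> x) = \<iota> x" using \<tau>[OF m] D_memD(3)[OF i \<nu> \<delta>'(1) x] e by metis
  qed
  have k: "\<iota> ` carrier MM.Rh \<subseteq> ?B" by (rule image_subsetI) (rule \<iota>(1))
  have \<tau>_fix: "?\<tau> c = c" if "c \<in> \<iota> ` carrier MM.Rh" for c using that \<iota>(2) by (metis imageE)
  obtain \<sigma> where \<sigma>: "\<sigma> \<in> ring_iso A A" "\<forall>c \<in> ?B. \<sigma> c = ?\<tau> c"
    using algebraic_closure_automorphism[OF A.algebraic_closure_axioms sh k \<tau>_fix] by blast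
  have "\<sigma> (\<iota> x) = \<iota> x" if "x \<in> carrier MM.Rh" for x
    using bspec[OF \<sigma>(2) \<iota>(1)[OF that]] \<iota>(2)[OF that] by (rule trans)
  then have "\<sigma> \<in> G"
    unfolding alg_auts_def using \<sigma>(1) by blast
  moreover have "\<beta>' y = \<sigma> (\<beta> y)" if y: "y \<in> carrier LL.Rh" for y
  proof -
    have l: "LF i \<nu> y \<in> carrier (Fh i \<nu>)" by (rule ring_hom_memE(1)[OF LF(1)[OF i \<nu>] y])
    have "\<sigma> (\<delta> (LF i \<nu> y)) = \<delta>' (LF i \<nu> y)" 
      using bspec[OF \<sigma>(2) imageI[OF l]] \<tau>[OF l] by (rule trans)
    then show ?thesis using y by (simp add: \<delta>(2) \<delta>'(2) rest_def[OF i \<nu>])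
  qed
  ultimately show ?thesis by blast
qed

text \<open>An automorphism \<open>\<sigma>\<close> of \<open>A\<close> over \<open>Mh\<close> preserves \<open>w\<close> by uniqueness of the extended absolute value, so
\<open>\<gamma>\<close> and \<open>\<sigma> \<circ> \<gamma>\<close> induce the same absolute value on \<open>F\<^sub>i\<close>.\<close>

lemma conjugate_fibre:
  assumes i: "i < length Fs" and \<beta>: "\<beta> \<in> fibre (i, \<nu>)" and \<beta>': "\<beta>' \<in> E"
    and \<sigma>: "\<sigma> \<in> G" "\<forall>y \<in> carrier LL.Rh. \<beta>' y = \<sigma> (\<beta> y)"
  shows "\<beta>' \<in> fibre (i, \<nu>)"
proof -
  obtain \<gamma> where \<gamma>: "factors \<beta> i \<gamma>" "\<nu> = pull i \<gamma>" using \<beta> unfolding fibre_iff[OF i] by blast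
  note \<gamma>' = \<gamma>(1)[unfolded factors_def]
  have \<sigma>\<iota>: "\<sigma> (\<iota> x) = \<iota> x" if "x \<in> carrier MM.Rh" for x
    using \<sigma>(1) that by (auto simp: alg_auts_def ring_iso_def)
  have \<sigma>h: "\<sigma> \<in> ring_hom A A" using \<sigma>(1) by (auto simp: alg_auts_def ring_iso_def)
  have w\<sigma>: "w (\<sigma> x) = w x" if "x \<in> carrier A" for x
  proof (rule w(3)[OF absolute_value_pullback[OF A.field_axioms A.field_axioms \<sigma>h w(1)] _ that])
    show "w (\<sigma> (\<iota> y)) = MM.vh y" if "y \<in> carrier MM.Rh" for y using \<sigma>\<iota>[OF that] w(2)[OF that] by simp
  qed
  have "factors \<beta>' i (\<sigma> \<circ> \<gamma>)"
    unfolding factors_def using \<gamma>' \<sigma>(2) \<sigma>\<iota> ring_hom_trans[OF conjunct1[OF \<gamma>'] \<sigma>h] by simp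
  moreover have "\<nu> = pull i (\<sigma> \<circ> \<gamma>)"
    unfolding \<gamma>(2) using w\<sigma>[OF ring_hom_memE(1)[OF conjunct1[OF \<gamma>']]] by (intro restrict_ext) simp
  ultimately show ?thesis unfolding fibre_iff[OF i] using \<beta>' by blast
qed

lemma conj_rel_iff: "(\<beta>, \<beta>') \<in> conj_rel LL.Rh G E \<longleftrightarrow> (\<exists>x \<in> P. \<beta> \<in> fibre x \<and> \<beta>' \<in> fibre x)"
proof
  assume "(\<beta>, \<beta>') \<in> conj_rel LL.Rh G E"
  then obtain \<sigma> where \<sigma>: "\<beta> \<in> E" "\<beta>' \<in> E" "\<sigma> \<in> G" "\<forall>y \<in> carrier LL.Rh. \<beta>' y = \<sigma> (\<beta> y)"
    by (auto simp: conj_rel_def)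
  obtain x where x: "x \<in> P" "\<beta> \<in> fibre x" using fibre_cover[OF \<sigma>(1)] by blast
  obtain i \<nu> where i\<nu>: "x = (i, \<nu>)" "i < length Fs" using x(1) by blast
  have "\<beta>' \<in> fibre x" unfolding i\<nu>(1)
    by (rule conjugate_fibre[OF i\<nu>(2) _ \<sigma>(2-4)]) (use x(2) i\<nu>(1) in simp)
  then show "\<exists>x \<in> P. \<beta> \<in> fibre x \<and> \<beta>' \<in> fibre x" using x by blast
next
  assume "\<exists>x \<in> P. \<beta> \<in> fibre x \<and> \<beta>' \<in> fibre x"
  then obtain i \<nu> where i\<nu>: "i < length Fs" "\<nu> \<in> V i" and \<beta>: "\<beta> \<in> fibre (i, \<nu>)" "\<beta>' \<in> fibre (i, \<nu>)" by blast
  then show "(\<beta>, \<beta>') \<in> conj_rel LL.Rh G E"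
    using fibre_conjugate[OF i\<nu> \<beta>] \<beta> unfolding conj_rel_def fibre_def by blast
qed

lemma fibre_partition:
  shows "equiv E (conj_rel LL.Rh G E)" (is ?eq) and "bij_betw fibre P (E // conj_rel LL.Rh G E)" (is ?bij)
    and "\<And>x \<beta>. \<lbrakk>x \<in> P; \<beta> \<in> fibre x\<rbrakk> \<Longrightarrow> conj_rel LL.Rh G E `` {\<beta>} = fibre x" (is "\<And>x \<beta>. _ \<Longrightarrow> _ \<Longrightarrow> ?cls x \<beta>")
proof -
  have ne: "fibre x \<noteq> {}" if "x \<in> P" for x using that fibre_ne by blast
  have sub: "fibre x \<subseteq> E" for x by (auto simp: fibre_def)
  note part = quotient_by_partition[of P fibre E "conj_rel LL.Rh G E"]
  show ?eq by (rule part(1); (rule ne sub fibre_cover conj_rel_iff | erule (3) fibre_disjoint); assumption)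
  show ?bij by (rule part(2); (rule ne sub fibre_cover conj_rel_iff | erule (3) fibre_disjoint); assumption)
  show "?cls x \<beta>" if "x \<in> P" "\<beta> \<in> fibre x" for x \<beta>
    by (rule part(3)[OF _ _ _ _ _ that]; (rule ne sub fibre_cover conj_rel_iff | erule (3) fibre_disjoint); assumption)
qed

lemma finite_P: "finite P"
proof -
  have "finite (E // conj_rel LL.Rh G E)"
    by (rule finite_quotient[OF Lh_embeddings(1) equiv_type[OF fibre_partition(1)]])
  then show ?thesis using bij_betw_finite[OF fibre_partition(2)] by blast
qed

text \<open>Each \<open>\<nu> \<in> V i\<close> has a nonempty fibre in the finite set \<open>E\<close>, and different fibres are disjoint.\<close>

lemma finite_V:
  assumes "i < length Fs" shows "finite (V i)"
proof -
  have "Pair i ` V i \<subseteq> P" using assms by blast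
  then have "finite (Pair i ` V i)" using finite_P by (rule finite_subset)
  then show ?thesis by (rule finite_imageD) (simp add: inj_on_def)
qed

lemma degree_sum:
  "(\<Sum>i<length Fs. \<Sum>\<nu> \<in> V i. ext_degree MM.Rh (Fh i \<nu>) (MF i \<nu>)) = ext_degree KK.Rh LL.Rh KL"
proof -
  have "(\<Sum>i<length Fs. \<Sum>\<nu> \<in> V i. ext_degree MM.Rh (Fh i \<nu>) (MF i \<nu>)) = (\<Sum>i<length Fs. \<Sum>\<nu> \<in> V i. card (fibre (i, \<nu>)))"
    by (intro sum.cong refl) (simp add: card_fibre)
  also have "\<dots> = (\<Sum>x \<in> P. card (fibre x))"
    by (subst sum.Sigma) (simp_all add: finite_V)
  also have "\<dots> = card (\<Union>x \<in> P. fibre x)"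
  proof (rule card_UN_disjoint[symmetric, OF finite_P])
    show "\<forall>x \<in> P. finite (fibre x)"
      using finite_subset[OF _ Lh_embeddings(1)] by (auto simp: fibre_def)
    show "\<forall>x \<in> P. \<forall>y \<in> P. x \<noteq> y \<longrightarrow> fibre x \<inter> fibre y = {}" using fibre_disjoint by blast
  qed
  also have "(\<Union>x \<in> P. fibre x) = E" using fibre_cover by (auto simp: fibre_def)
  finally show ?thesis using Lh_embeddings(2) by simp
qed

lemma canonical_bijection:
  assumes "\<beta> \<in> E" "i < length Fs"
  shows "corresponds K L M f g vL vM Fs \<phi> A \<iota> \<beta> i \<nu> \<longleftrightarrow>
    \<nu> \<in> V i \<and> fibre (i, \<nu>) = conj_rel LL.Rh G E `` {\<beta>}"
proof
  assume "corresponds K L M f g vL vM Fs \<phi> A \<iota> \<beta> i \<nu>"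
  then have \<beta>: "\<beta> \<in> fibre (i, \<nu>)" using assms(1) by (simp add: fibre_def)
  have "\<nu> \<in> V i" by (rule fibre_imp_V[OF assms(2) \<beta>])
  then show "\<nu> \<in> V i \<and> fibre (i, \<nu>) = conj_rel LL.Rh G E `` {\<beta>}"
    using fibre_partition(3)[of "(i, \<nu>)" \<beta>] \<beta> assms(2) by blast
next
  assume "\<nu> \<in> V i \<and> fibre (i, \<nu>) = conj_rel LL.Rh G E `` {\<beta>}"
  then have "\<beta> \<in> fibre (i, \<nu>)" using equiv_class_self[OF fibre_partition(1) assms(1)] by simp
  then show "corresponds K L M f g vL vM Fs \<phi> A \<iota> \<beta> i \<nu>" by (simp add: fibre_def)
qed

end

section \<open>The bijection and the degree formula\<close>

theorem theorem1p2:
  fixes K :: "('k, 'z) ring_scheme" and L :: "('l, 'x) ring_scheme" and M :: "('m, 'y) ring_scheme"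
    and f :: "'k \<Rightarrow> 'l" and g :: "'k \<Rightarrow> 'm"
    and vK :: "'k \<Rightarrow> real" and vL :: "'l \<Rightarrow> real" and vM :: "'m \<Rightarrow> real"
    and Fs :: "('f, 'w) ring_scheme list"
    and \<phi> :: "(('l \<times> 'm) \<Rightarrow>\<^sub>0 int) set \<Rightarrow> 'f list"
    and A :: "('a, 'v) ring_scheme" and \<iota> :: "(nat \<Rightarrow> 'm) set \<Rightarrow> 'a"
  assumes "field K" and "field L" and "field M"
    and "f \<in> ring_hom K L" and "g \<in> ring_hom K M"
    and "finite_ext K L f" and "separable_ext K L f"
    and "0 < length Fs" and "\<forall>i<length Fs. field (Fs ! i)"
    and "\<phi> \<in> ring_iso (tensor_ring K L M f g) (RDirProd_list Fs)"
    and "absolute_value K vK" and "absolute_value L vL" and "absolute_value M vM"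
    and "\<forall>x \<in> carrier K. vL (f x) = vK x" and "\<forall>x \<in> carrier K. vM (g x) = vK x"
    and "\<iota> \<in> ring_hom (field_completion M vM) A"
    and "algebraic_closure A (\<iota> ` carrier (field_completion M vM))"
  shows "let
      p = left_emb K L M f g \<phi>;
      q = right_emb K L M f g \<phi>;
      V = (\<lambda>i. ext_abs L vL M vM (Fs ! i) (p i) (q i));
      KL = completion_map K vK L vL f;
      KM = completion_map K vK M vM g;
      MF = (\<lambda>i \<nu>. completion_map M vM (Fs ! i) \<nu> (q i));
      E = alg_embs (field_completion K vK) (field_completion L vL) A KL (\<iota> \<circ> KM);
      G = alg_auts (field_completion M vM) A \<iota>;
      r = conj_rel (field_completion L vL) G E
    in
      (equiv E r \<and>
       (\<exists>\<Psi>. bij_betw \<Psi> (SIGMA i:{..<length Fs}. V i) (E // r) \<and>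
         (\<forall>\<beta> \<in> E. \<forall>i<length Fs. \<forall>\<nu>.
            corresponds K L M f g vL vM Fs \<phi> A \<iota> \<beta> i \<nu> \<longleftrightarrow>
              \<nu> \<in> V i \<and> \<Psi> (i, \<nu>) = r `` {\<beta>}))) \<and>
      (finite_ext (field_completion K vK) (field_completion L vL) KL \<and>
       (\<forall>i<length Fs. finite (V i) \<and>
         (\<forall>\<nu> \<in> V i. finite_ext (field_completion M vM) (field_completion (Fs ! i) \<nu>) (MF i \<nu>))) \<and>
       (\<Sum>i<length Fs. \<Sum>\<nu> \<in> V i. ext_degree (field_completion M vM) (field_completion (Fs ! i) \<nu>) (MF i \<nu>))
         = ext_degree (field_completion K vK) (field_completion L vL) KL)"
proof -
  have fc: "tensor_product K L M f g"
    using assms(2,3) ring_hom_memE(1)[OF assms(4)] ring_hom_memE(1)[OF assms(5)]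
    by (simp add: tensor_product_def tensor_product_axioms_def fieldE(1))
  have td: "tensor_decomposition K L M f g Fs \<phi>"
    using fc assms(9,10) by (simp add: tensor_decomposition_def tensor_decomposition_axioms_def)
  have vf: "valued_field K vK" "valued_field L vL" "valued_field M vM"
    using assms(1-3,11-13) by (simp_all add: valued_field_def valued_field_axioms_def)
  have ax: "valued_tensor_decomposition_axioms K L M f g vK vL vM A \<iota>"
    using assms(4-7,14-16) by (simp add: valued_tensor_decomposition_axioms_def)
  interpret valued_tensor_decomposition K L M f g Fs \<phi> vK vL vM A \<iota>
    by (rule valued_tensor_decomposition.intro[OF td vf assms(17) ax])
  let ?r = "conj_rel LL.Rh G E"
  have 1: "equiv E ?r" by (rule fibre_partition(1))
  have 2: "\<exists>\<Psi>. bij_betw \<Psi> P (E // ?r) \<and> (\<forall>\<beta> \<in> E. \<forall>i<length Fs. \<forall>\<nu>.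
      corresponds K L M f g vL vM Fs \<phi> A \<iota> \<beta> i \<nu> \<longleftrightarrow> \<nu> \<in> V i \<and> \<Psi> (i, \<nu>) = ?r `` {\<beta>})"
    by (intro exI[of _ fibre] conjI fibre_partition(2) ballI allI impI canonical_bijection)
  have 3: "\<forall>i<length Fs. finite (V i) \<and> (\<forall>\<nu> \<in> V i. finite_ext MM.Rh (Fh i \<nu>) (MF i \<nu>))"
    by (intro allI impI conjI ballI finite_V Fh_embeddings(3))
  show ?thesis
    unfolding Let_def
    by (intro conjI 1 2 3 Lh_embeddings(3) degree_sum)
qed

end
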